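(* Let $n>2$ and $g\ge 2$. For each of the four natural projections $$\alpha:\mathrm{Aut}\,F_n\to \mathrm{Out}\,F_n,\quad \beta:\mathrm{Out}\,F_n\to GL(n,\mathbb Z),\quad \gamma:\mathrm{Aut}\,\pi_1\mathcal F_g\to \mathrm{Out}\,\pi_1\mathcal F_g,\quad \delta:\mathrm{Out}_+\pi_1\mathcal F_g\to Sp(2g,\mathbb Z),$$ there exists a finite cyclic subgroup of the target group which does not lift to the source group. *)

theory Defs
  imports "HOL-Algebra.Algebra" "Jordan_Normal_Form.Determinant"
begin

type_synonym letter = "nat \<times> bool"   \<comment> \<open>(generator index, inverted?)\<close>
type_synonym word = "letter list"

definition inv_letter :: "letter \<Rightarrow> letter" where
  "inv_letter = (\<lambda>(i, b). (i, \<not> b))"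

fun reduced :: "word \<Rightarrow> bool" where
  "reduced [] = True"
| "reduced [x] = True"
| "reduced (x # y # xs) = (y \<noteq> inv_letter x \<and> reduced (y # xs))"

fun red_cons :: "letter \<Rightarrow> word \<Rightarrow> word" where
  "red_cons x [] = [x]"
| "red_cons x (y # ys) = (if y = inv_letter x then ys else x # y # ys)"

definition reduce :: "word \<Rightarrow> word" where
  "reduce w = foldr red_cons w []"

definition free_group :: "nat \<Rightarrow> word monoid" where
  "free_group n = \<lparr>carrier = {w. reduced w \<and> (\<forall>l \<in> set w. fst l < n)},
                   monoid.mult = (\<lambda>u v. reduce (u @ v)), monoid.one = []\<rparr>"

definition gen :: "nat \<Rightarrow> word" where
  "gen i = [(i, False)]"

definition expsum :: "nat \<Rightarrow> word \<Rightarrow> int" where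
  "expsum i w = sum_list (map (\<lambda>(j, b). if j = i then (if b then -1 else 1) else 0) w)"

definition Aut :: "('a, 'c) monoid_scheme \<Rightarrow> ('a \<Rightarrow> 'a) monoid" where
  "Aut G = AutoGroup G"

definition inn :: "('a, 'c) monoid_scheme \<Rightarrow> ('a \<Rightarrow> 'a) set" where
  "inn G = {(\<lambda>x \<in> carrier G. h \<otimes>\<^bsub>G\<^esub> x \<otimes>\<^bsub>G\<^esub> inv\<^bsub>G\<^esub> h) | h. h \<in> carrier G}"

definition Out :: "('a, 'c) monoid_scheme \<Rightarrow> ('a \<Rightarrow> 'a) set monoid" where
  "Out G = Aut G Mod inn G"

definition proj_out :: "('a, 'c) monoid_scheme \<Rightarrow> ('a \<Rightarrow> 'a) \<Rightarrow> ('a \<Rightarrow> 'a) set" where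
  "proj_out G \<phi> = inn G #>\<^bsub>Aut G\<^esub> \<phi>"

definition GL :: "nat \<Rightarrow> int mat monoid" where
  "GL n = \<lparr>carrier = {A. A \<in> carrier_mat n n \<and> (det A = 1 \<or> det A = -1)},
           monoid.mult = (\<lambda>A B. A * B), monoid.one = 1\<^sub>m n\<rparr>"

text \<open>Standard symplectic form w.r.t. the basis \<open>a_1..a_g, b_1..b_g\<close>.\<close>
definition J_symp :: "nat \<Rightarrow> int mat" where
  "J_symp g = mat (2*g) (2*g) (\<lambda>(i, j).
      if i < g \<and> j = i + g then 1 else if g \<le> i \<and> j = i - g then -1 else 0)"

definition Sp :: "nat \<Rightarrow> int mat monoid" where
  "Sp g = \<lparr>carrier = {A. A \<in> carrier_mat (2*g) (2*g) \<and> transpose_mat A * J_symp g * A = J_symp g},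
           monoid.mult = (\<lambda>A B. A * B), monoid.one = 1\<^sub>m (2*g)\<rparr>"

definition abmat :: "nat \<Rightarrow> (word \<Rightarrow> word) \<Rightarrow> int mat" where
  "abmat n \<phi> = mat n n (\<lambda>(i, j). expsum i (\<phi> (gen j)))"

definition beta :: "nat \<Rightarrow> (word \<Rightarrow> word) set \<Rightarrow> int mat" where
  "beta n C = abmat n (SOME \<phi>. \<phi> \<in> C)"

text \<open>Generators \<open>a_i = x_i\<close>, \<open>b_i = x_{g+i}\<close> (\<open>i < g\<close>); relator \<open>\<Prod>[a_i,b_i]\<close>.\<close>
definition surf_relator :: "nat \<Rightarrow> word" where
  "surf_relator g = concat (map (\<lambda>i. [(i, False), (g + i, False), (i, True), (g + i, True)]) [0..<g])"

definition surf_N :: "nat \<Rightarrow> word set" where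
  "surf_N g = generate (free_group (2*g))
     {h \<otimes>\<^bsub>free_group (2*g)\<^esub> surf_relator g \<otimes>\<^bsub>free_group (2*g)\<^esub> inv\<^bsub>free_group (2*g)\<^esub> h
       | h. h \<in> carrier (free_group (2*g))}"

definition surface_group :: "nat \<Rightarrow> word set monoid" where
  "surface_group g = free_group (2*g) Mod surf_N g"

text \<open>Action of an automorphism of the surface group on \<open>H_1 = Z^{2g}\<close>.\<close>
definition hmat :: "nat \<Rightarrow> (word set \<Rightarrow> word set) \<Rightarrow> int mat" where
  "hmat g \<phi> = mat (2*g) (2*g)
     (\<lambda>(i, j). expsum i (SOME w. w \<in> \<phi> (surf_N g #>\<^bsub>free_group (2*g)\<^esub> gen j)))"

definition delta :: "nat \<Rightarrow> (word set \<Rightarrow> word set) set \<Rightarrow> int mat" where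
  "delta g C = hmat g (SOME \<phi>. \<phi> \<in> C)"

text \<open>\<open>Out_+\<close>: outer automorphism classes acting symplectically on \<open>H_1\<close>
  (equivalently: orientation preserving).\<close>
definition Out_plus :: "nat \<Rightarrow> (word set \<Rightarrow> word set) set monoid" where
  "Out_plus g = (Out (surface_group g))
     \<lparr>carrier := {C \<in> carrier (Out (surface_group g)). delta g C \<in> carrier (Sp g)}\<rparr>"

definition fin_cyclic_subgroup :: "('a, 'c) monoid_scheme \<Rightarrow> 'a set \<Rightarrow> bool" where
  "fin_cyclic_subgroup H C \<longleftrightarrow> subgroup C H \<and> finite C \<and> (\<exists>x \<in> carrier H. C = generate H {x})"

definition lifts :: "('b, 'd) monoid_scheme \<Rightarrow> ('b \<Rightarrow> 'a) \<Rightarrow> 'a set \<Rightarrow> bool" where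
  "lifts G f C \<longleftrightarrow> (\<exists>C'. subgroup C' G \<and> inj_on f C' \<and> f ` C' = C)"

end

theory Submission
  imports Defs
begin

text \<open>
  A lift of a cyclic group of order dividing \<open>m\<close> is generated by an element of order dividing \<open>m\<close>.

  For the projections onto the outer automorphism groups, take \<open>\<phi>\<close> with \<open>\<phi>\<^sup>m\<close> equal to conjugation by
  some \<open>h\<close>, induced by a fixed point free periodic map of a graph or surface. If \<open>\<phi>\<close>
  followed by conjugation by \<open>k\<close> had trivial \<open>m\<close>-th power, then \<open>u = k \<phi>(k) \<cdots> \<phi>\<^sup>m\<^sup>-\<^sup>1(k) h\<close> would be central. Central elements
  die in the abelianization, whereas the class of \<open>h\<close> is not a norm. For genus two the class of \<open>h\<close>
  is a norm, and one compares instead a Heisenberg quotient, in which \<open>u\<close> has an odd central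
  coordinate, with a dihedral quotient, in which this coordinate of a central element vanishes.

  For the projections onto matrix groups, take the matrix \<open>x \<mapsto> y \<mapsto> y - x\<close> of order six, extended by the
  identity. Suppose \<open>\<phi>\<close> induces it and \<open>\<phi>\<^sup>6\<close> is inner. Modulo the third term \<open>\<gamma>\<^sub>3\<close> of the lower central
  series one corrects \<open>\<phi>\<^sup>3\<close> by an inner automorphism to \<open>\<tau>\<close> such that \<open>\<tau>\<^sup>2\<close> is conjugation by some \<open>h\<close> in
  \<open>\<gamma>\<^sub>2\<close>. The element \<open>q = x \<tau>(x)\<close> of \<open>\<gamma>\<^sub>2\<close> is a quadratic function of \<open>x\<close> modulo squares, and invariance
  under the rotation forces \<open>q = [y, x]\<close> there. Now consider the next quotient through maps onto
  dihedral groups of order 16. Invariance of \<open>\<tau>(q) q\<^sup>-\<^sup>1\<close> under \<open>\<phi>\<close> shows that \<open>h q\<close> has even \<open>[y, x]\<close>-coordinate,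
  so that of \<open>h\<close> is odd. But a generator \<open>z\<close> outside the rotated plane can be chosen with \<open>\<tau>(z) = z\<close> modulo \<open>\<gamma>\<^sub>3\<close>,
  and then \<open>\<tau>\<^sup>2(z) = h z h\<^sup>-\<^sup>1\<close> forces the coordinate of \<open>h\<close> to be even.
\<close>

section \<open>Free groups and their universal property\<close>

text \<open>The natural representative of the order six matrix rotates a one-holed torus, and its
  sixth power is the twist along the boundary: conjugation by a commutator of \<open>x\<close> and
  \<open>y\<close> on the rank two part, the identity on \<open>z\<close>. The difficulty is to
  exclude all other representatives, which differ from it by arbitrary automorphisms acting
  trivially on the abelianization. On \<open>\<gamma>\<^sub>2\<close> modulo
  \<open>\<gamma>\<^sub>3\<close> the map \<open>\<phi>\<^sup>3\<close> is the identity modulo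
  squares, so that only parities survive such changes; this is why \<open>q\<close> is determined
  modulo squares only. The parity of \<open>h\<close> cannot be read off in class two, where
  conjugation by an element of \<open>\<gamma>\<^sub>2\<close> is trivial: it shows in the
  commutators of \<open>h\<close> with generators, in \<open>\<gamma>\<^sub>3\<close> modulo
  \<open>\<gamma>\<^sub>4\<close>. The dihedral group of order 16 is a small class three quotient
  that sees them, because a commutator with a reflection doubles a translation and so sends
  \<open>\<gamma>\<^sub>4\<close> into the multiples of 8. A third generator is indispensable: for
  rank two and for genus one the matrices do lift.\<close>

lemma inv_letter_inv_letter [simp]: "inv_letter (inv_letter x) = x"
  by (simp add: inv_letter_def split: prod.splits)

lemma fst_inv_letter [simp]: "fst (inv_letter x) = fst x"
  by (simp add: inv_letter_def split: prod.splits)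

lemma reduced_Cons_D: "reduced (x # w) \<Longrightarrow> reduced w"
  by (cases w) auto

lemma reduced_red_cons: "reduced w \<Longrightarrow> reduced (red_cons x w)"
  by (cases w) (auto dest: reduced_Cons_D)

lemma set_red_cons: "set (red_cons x w) \<subseteq> insert x (set w)"
  by (cases w) auto

text \<open>The delicate case is a word starting with \<open>x\<close>: by reducedness the letter
  behind it is not \<open>inv_letter x\<close>, so putting \<open>x\<close> back does not cancel a
  second time.\<close>

lemma red_cons_cancel: "reduced w \<Longrightarrow> red_cons x (red_cons (inv_letter x) w) = w"
proof (cases w)
  case (Cons y ys)
  assume "reduced w"
  then show ?thesis using Cons by (cases ys) auto
qed auto

lemma red_cons_cancel': "reduced w \<Longrightarrow> red_cons (inv_letter x) (red_cons x w) = w"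
  using red_cons_cancel[of w "inv_letter x"] by simp

lemma red_cons_reduced: "reduced (x # w) \<Longrightarrow> red_cons x w = x # w"
  by (cases w) auto

lemma reduced_foldr: "reduced v \<Longrightarrow> reduced (foldr red_cons u v)"
  by (induction u) (auto intro: reduced_red_cons)

lemma set_foldr_red_cons: "set (foldr red_cons u v) \<subseteq> set u \<union> set v"
proof (induction u)
  case (Cons a u)
  then show ?case using set_red_cons[of a "foldr red_cons u v"] by auto
qed auto

lemma foldr_red_cons_reduced: "reduced u \<Longrightarrow> foldr red_cons u [] = u"
proof (induction u)
  case (Cons a u)
  then show ?case using reduced_Cons_D red_cons_reduced by simp
qed auto

lemma foldr_red_cons_red_cons:
  "reduced v \<Longrightarrow> foldr red_cons (red_cons x w) v = red_cons x (foldr red_cons w v)"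
proof (cases w)
  case (Cons y ys)
  assume "reduced v"
  then show ?thesis using Cons by (auto simp: red_cons_cancel reduced_foldr)
qed auto

text \<open>Van der Waerden's argument: letters act on reduced words by \<open>red_cons\<close>, as
  mutually inverse bijections, and composition of these actions is associative. This yields
  associativity of the free group.\<close>

lemma foldr_red_cons_foldr:
  "reduced v \<Longrightarrow> foldr red_cons (foldr red_cons w w') v = foldr red_cons w (foldr red_cons w' v)"
  by (induction w) (auto simp: foldr_red_cons_red_cons)

lemma reduce_append: "reduced v \<Longrightarrow> reduce (u @ v) = foldr red_cons u v"
  by (simp add: reduce_def foldr_red_cons_reduced)

definition inv_word :: "word \<Rightarrow> word" where
  "inv_word w = rev (map inv_letter w)"

lemma reduced_append_single:
  "reduced (w @ [x]) \<longleftrightarrow> reduced w \<and> (w = [] \<or> x \<noteq> inv_letter (last w))"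
  by (induction w rule: reduced.induct) auto

lemma reduced_inv_word: "reduced w \<Longrightarrow> reduced (inv_word w)"
proof (induction w rule: reduced.induct)
  case (3 x y xs)
  then have "reduced (inv_word (y # xs))" and "y \<noteq> inv_letter x" by auto
  moreover have "inv_word (x # y # xs) = inv_word (y # xs) @ [inv_letter x]"
    by (simp add: inv_word_def)
  moreover have "last (inv_word (y # xs)) = inv_letter y"
    by (simp add: inv_word_def)
  ultimately show ?case
    by (auto simp: reduced_append_single)
qed (auto simp: inv_word_def)

lemma foldr_inv_word: "reduced v \<Longrightarrow> foldr red_cons (inv_word w) (foldr red_cons w v) = v"
  by (induction w arbitrary: v) (auto simp: inv_word_def red_cons_cancel' reduced_foldr)

lemma carrier_free_group: "carrier (free_group n) = {w. reduced w \<and> (\<forall>l \<in> set w. fst l < n)}"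
  by (simp add: free_group_def)

lemma mult_free_group: "reduced v \<Longrightarrow> u \<otimes>\<^bsub>free_group n\<^esub> v = foldr red_cons u v"
  by (simp add: free_group_def reduce_append)

lemma one_free_group: "\<one>\<^bsub>free_group n\<^esub> = []"
  by (simp add: free_group_def)

lemma group_free_group: "group (free_group n)"
proof (rule groupI)
  fix u v assume uv: "u \<in> carrier (free_group n)" "v \<in> carrier (free_group n)"
  then show "u \<otimes>\<^bsub>free_group n\<^esub> v \<in> carrier (free_group n)"
    using set_foldr_red_cons[of u v]
    by (auto simp: carrier_free_group mult_free_group reduced_foldr)
  fix w assume w: "w \<in> carrier (free_group n)"
  show "u \<otimes>\<^bsub>free_group n\<^esub> v \<otimes>\<^bsub>free_group n\<^esub> w = u \<otimes>\<^bsub>free_group n\<^esub> (v \<otimes>\<^bsub>free_group n\<^esub> w)"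
    using uv w by (simp add: carrier_free_group mult_free_group reduced_foldr foldr_red_cons_foldr)
next
  fix u assume u: "u \<in> carrier (free_group n)"
  then show "\<one>\<^bsub>free_group n\<^esub> \<otimes>\<^bsub>free_group n\<^esub> u = u"
    by (simp add: carrier_free_group mult_free_group one_free_group)
  show "\<exists>v\<in>carrier (free_group n). v \<otimes>\<^bsub>free_group n\<^esub> u = \<one>\<^bsub>free_group n\<^esub>"
  proof
    show "inv_word u \<in> carrier (free_group n)"
    proof -
      have "fst l < n" if "l \<in> set (inv_word u)" for l
      proof -
        from that obtain l' where "l' \<in> set u" "l = inv_letter l'" by (auto simp: inv_word_def)
        then show ?thesis using u by (simp add: carrier_free_group)
      qed
      then show ?thesis using u by (simp add: carrier_free_group reduced_inv_word)
    qed
    show "inv_word u \<otimes>\<^bsub>free_group n\<^esub> u = \<one>\<^bsub>free_group n\<^esub>"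
      using u foldr_inv_word[of "[]" u]
      by (simp add: carrier_free_group mult_free_group one_free_group foldr_red_cons_reduced)
  qed
qed (simp add: carrier_free_group one_free_group)

lemma gen_closed [simp]: "i < n \<Longrightarrow> gen i \<in> carrier (free_group n)"
  by (simp add: gen_def carrier_free_group)

lemma inv_gen: "i < n \<Longrightarrow> inv\<^bsub>free_group n\<^esub> (gen i) = [(i, True)]"
  by (rule group.inv_equality[OF group_free_group])
    (simp_all add: gen_def carrier_free_group mult_free_group one_free_group inv_letter_def)

section \<open>Evaluation of words in an arbitrary group\<close>

definition ev_letter :: "('a, 'c) monoid_scheme \<Rightarrow> (nat \<Rightarrow> 'a) \<Rightarrow> letter \<Rightarrow> 'a" where
  "ev_letter G f l = (if snd l then inv\<^bsub>G\<^esub> (f (fst l)) else f (fst l))"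

definition ev :: "('a, 'c) monoid_scheme \<Rightarrow> (nat \<Rightarrow> 'a) \<Rightarrow> word \<Rightarrow> 'a" where
  "ev G f w = foldr (\<lambda>l a. ev_letter G f l \<otimes>\<^bsub>G\<^esub> a) w \<one>\<^bsub>G\<^esub>"

lemma ev_Nil [simp]: "ev G f [] = \<one>\<^bsub>G\<^esub>"
  by (simp add: ev_def)

lemma ev_Cons [simp]: "ev G f (l # w) = ev_letter G f l \<otimes>\<^bsub>G\<^esub> ev G f w"
  by (simp add: ev_def)

lemma (in group) ev_letter_closed:
  "(\<And>i. i < n \<Longrightarrow> f i \<in> carrier G) \<Longrightarrow> fst l < n \<Longrightarrow> ev_letter G f l \<in> carrier G"
  by (simp add: ev_letter_def)

lemma (in group) ev_closed:
  assumes "\<And>i. i < n \<Longrightarrow> f i \<in> carrier G"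
  shows "\<forall>l \<in> set w. fst l < n \<Longrightarrow> ev G f w \<in> carrier G"
  by (induction w) (auto intro!: ev_letter_closed assms)

lemma (in group) ev_red_cons:
  assumes f: "\<And>i. i < n \<Longrightarrow> f i \<in> carrier G" and "fst l < n" "\<forall>l \<in> set w. fst l < n"
  shows "ev G f (red_cons l w) = ev_letter G f l \<otimes> ev G f w"
proof (cases w)
  case (Cons y ys)
  have "ev_letter G f l \<otimes> (ev_letter G f (inv_letter l) \<otimes> ev G f ys) = ev G f ys"
    using assms Cons ev_closed[of n f ys]
    by (cases l) (auto simp: ev_letter_def inv_letter_def m_assoc[symmetric])
  then show ?thesis using Cons by auto
qed simp

lemma (in group) ev_hom:
  assumes f: "\<And>i. i < n \<Longrightarrow> f i \<in> carrier G"
  shows "ev G f \<in> hom (free_group n) G"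
proof (rule homI)
  fix u v assume uv: "u \<in> carrier (free_group n)" "v \<in> carrier (free_group n)"
  have "ev G f (foldr red_cons u v) = ev G f u \<otimes> ev G f v"
    if "\<forall>l \<in> set u. fst l < n" using that
  proof (induction u)
    case Nil
    then show ?case using uv f ev_closed[of n f v] by (simp add: carrier_free_group)
  next
    case (Cons a u)
    have "ev G f (red_cons a (foldr red_cons u v)) = ev_letter G f a \<otimes> ev G f (foldr red_cons u v)"
      using uv Cons set_foldr_red_cons[of u v]
      by (intro ev_red_cons[where n = n]) (auto simp: carrier_free_group f)
    then show ?case using Cons uv f
      by (simp add: m_assoc ev_letter_closed[of n] ev_closed[of n] carrier_free_group)
  qed
  then show "ev G f (u \<otimes>\<^bsub>free_group n\<^esub> v) = ev G f u \<otimes> ev G f v"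
    using uv by (simp add: mult_free_group carrier_free_group)
qed (use f ev_closed in \<open>auto simp: carrier_free_group\<close>)

lemma (in group) ev_gen: "f i \<in> carrier G \<Longrightarrow> ev G f (gen i) = f i"
  by (simp add: gen_def ev_letter_def)

lemma free_group_generate: "carrier (free_group n) = generate (free_group n) (gen ` {..<n})"
proof
  interpret F: group "free_group n" by (rule group_free_group)
  show "generate (free_group n) (gen ` {..<n}) \<subseteq> carrier (free_group n)"
    by (rule F.generate_incl) auto
  have "w \<in> generate (free_group n) (gen ` {..<n})" if "w \<in> carrier (free_group n)" for w
    using that
  proof (induction w)
    case Nil
    then show ?case using generate.one[of "free_group n"] by (simp add: one_free_group)
  next
    case (Cons l w)
    then have w: "w \<in> carrier (free_group n)" and l: "fst l < n"
      by (auto simp: carrier_free_group dest: reduced_Cons_D)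
    have "[l] \<in> generate (free_group n) (gen ` {..<n})"
    proof (cases "snd l")
      case True
      then have "[l] = inv\<^bsub>free_group n\<^esub> (gen (fst l))"
        using l by (simp add: inv_gen prod_eq_iff)
      then show ?thesis using l generate.inv[of "gen (fst l)" "gen ` {..<n}" "free_group n"] by auto
    next
      case False
      then have "[l] = gen (fst l)" by (simp add: gen_def prod_eq_iff)
      then show ?thesis using l generate.incl[of "gen (fst l)" "gen ` {..<n}" "free_group n"] by auto
    qed
    from generate.eng[OF this Cons.IH[OF w]]
    have "[l] \<otimes>\<^bsub>free_group n\<^esub> w \<in> generate (free_group n) (gen ` {..<n})" .
    moreover have "[l] \<otimes>\<^bsub>free_group n\<^esub> w = l # w"
      using Cons.prems w by (simp add: carrier_free_group mult_free_group red_cons_reduced)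
    ultimately show ?case by simp
  qed
  then show "carrier (free_group n) \<subseteq> generate (free_group n) (gen ` {..<n})" by blast
qed

section \<open>Exponent sums as homomorphisms to the integers\<close>

definition intg :: "int monoid" where
  "intg = \<lparr>carrier = UNIV, monoid.mult = (+), monoid.one = 0\<rparr>"

lemma intg_simps [simp]: "carrier intg = UNIV" "a \<otimes>\<^bsub>intg\<^esub> b = a + b" "\<one>\<^bsub>intg\<^esub> = 0"
  by (simp_all add: intg_def)

lemma group_intg: "group intg"
  by (rule groupI) (auto intro: exI[of _ "- x" for x])

lemma inv_intg [simp]: "inv\<^bsub>intg\<^esub> a = - a"
  by (rule group.inv_equality[OF group_intg]) auto

lemma expsum_eq_ev: "expsum i w = ev intg (\<lambda>j. if j = i then 1 else 0) w"
  by (induction w) (auto simp: expsum_def ev_letter_def)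

lemma expsum_hom: "expsum i \<in> hom (free_group n) intg"
proof -
  have "expsum i = ev intg (\<lambda>j. if j = i then 1 else 0)"
    by (simp add: fun_eq_iff expsum_eq_ev)
  then show ?thesis using group.ev_hom[OF group_intg, of n "\<lambda>j. if j = i then 1 else 0"] by simp
qed

lemma expsum_gen [simp]: "expsum i (gen j) = (if j = i then 1 else 0)"
  by (simp add: expsum_def gen_def)

lemma (in group) group_homI: "group H \<Longrightarrow> h \<in> hom G H \<Longrightarrow> group_hom G H h"
  by (simp add: group_hom_def group_hom_axioms_def is_group)

lemma hom_eq_on_generate:
  assumes "group G" "group H" "f \<in> hom G H" "f' \<in> hom G H" "S \<subseteq> carrier G"
    and eq: "\<And>s. s \<in> S \<Longrightarrow> f s = f' s" and "x \<in> generate G S"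
  shows "f x = f' x"
proof -
  interpret f: group_hom G H f using assms by (simp add: group_hom_def group_hom_axioms_def)
  interpret f': group_hom G H f' using assms by (simp add: group_hom_def group_hom_axioms_def)
  have S: "s \<in> carrier G" if "s \<in> generate G S" for s
    using group.generate_in_carrier[OF assms(1,5) that] .
  show ?thesis using assms(7)
    by (induction rule: generate.induct) (use assms(5) eq S in \<open>auto simp: subset_iff\<close>)
qed

section \<open>Surface groups and their universal property\<close>

text \<open>Adjacent letters never share an index: \<open>i\<close> and \<open>g + i\<close>
  alternate inside a block, and \<open>g + i\<close> is followed by \<open>i + 1\<close> of the next
  block. The induction runs over suffixes of the product.\<close>

lemma surf_relator_in_carrier: "surf_relator g \<in> carrier (free_group (2*g))"
proof -
  have "reduced (concat (map (\<lambda>i. [(i, False), (g + i, False), (i, True), (g + i, True)]) [j..<g]))" for j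
  proof (induction "g - j" arbitrary: j)
    case (Suc d)
    then have "j < g" "d = g - Suc j" by auto
    then show ?case using Suc(1)[of "Suc j"]
      by (cases "Suc j < g") (auto simp: upt_conv_Cons inv_letter_def)
  qed simp
  then show ?thesis by (auto simp: surf_relator_def carrier_free_group)
qed

lemma normal_surf_N: "surf_N g \<lhd> free_group (2*g)"
proof -
  let ?F = "free_group (2*g)"
  interpret F: group "?F" by (rule group_free_group)
  note R = surf_relator_in_carrier
  show ?thesis unfolding surf_N_def
  proof (rule F.normal_generateI)
    fix k l assume "k \<in> {h \<otimes>\<^bsub>?F\<^esub> surf_relator g \<otimes>\<^bsub>?F\<^esub> inv\<^bsub>?F\<^esub> h
       | h. h \<in> carrier (?F)}" and l: "l \<in> carrier (?F)"
    then obtain h where h: "h \<in> carrier (?F)"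
      "k = h \<otimes>\<^bsub>?F\<^esub> surf_relator g \<otimes>\<^bsub>?F\<^esub> inv\<^bsub>?F\<^esub> h" by auto
    have "l \<otimes>\<^bsub>?F\<^esub> k \<otimes>\<^bsub>?F\<^esub> inv\<^bsub>?F\<^esub> l =
      (l \<otimes>\<^bsub>?F\<^esub> h) \<otimes>\<^bsub>?F\<^esub> surf_relator g \<otimes>\<^bsub>?F\<^esub> inv\<^bsub>?F\<^esub> (l \<otimes>\<^bsub>?F\<^esub> h)"
      using h l R by (simp add: F.m_assoc F.inv_mult_group)
    then show "l \<otimes>\<^bsub>?F\<^esub> k \<otimes>\<^bsub>?F\<^esub> inv\<^bsub>?F\<^esub> l \<in>
      {h \<otimes>\<^bsub>?F\<^esub> surf_relator g \<otimes>\<^bsub>?F\<^esub> inv\<^bsub>?F\<^esub> h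
       | h. h \<in> carrier (?F)}"
      using h l by blast
  qed (use R in auto)
qed

definition sgen :: "nat \<Rightarrow> nat \<Rightarrow> word set" where
  "sgen g i = surf_N g #>\<^bsub>free_group (2*g)\<^esub> gen i"

lemma group_surface_group: "group (surface_group g)"
  unfolding surface_group_def by (rule normal.factorgroup_is_group[OF normal_surf_N])

lemma surface_proj_hom: "(\<lambda>w. surf_N g #>\<^bsub>free_group (2*g)\<^esub> w) \<in> hom (free_group (2*g)) (surface_group g)"
  unfolding surface_group_def by (rule normal.r_coset_hom_Mod[OF normal_surf_N])

lemma sgen_closed [simp]: "i < 2*g \<Longrightarrow> sgen g i \<in> carrier (surface_group g)"
  using hom_in_carrier[OF surface_proj_hom, of "gen i" g] by (simp add: sgen_def)

lemma surface_group_generate: "carrier (surface_group g) = generate (surface_group g) (sgen g ` {..<2*g})"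
proof -
  let ?F = "free_group (2*g)"
  interpret h: group_hom "?F" "surface_group g" "\<lambda>w. surf_N g #>\<^bsub>?F\<^esub> w"
    using group_free_group group_surface_group surface_proj_hom
    by (simp add: group_hom_def group_hom_axioms_def)
  have "carrier (surface_group g) = (\<lambda>w. surf_N g #>\<^bsub>?F\<^esub> w) ` carrier (?F)"
    by (simp add: surface_group_def carrier_FactGroup)
  also have "\<dots> = generate (surface_group g) ((\<lambda>w. surf_N g #>\<^bsub>?F\<^esub> w) ` gen ` {..<2*g})"
    unfolding free_group_generate by (rule h.generate_img[symmetric]) auto
  finally show ?thesis by (simp add: sgen_def image_image)
qed

section \<open>Commutators, ordered products and the surface relation\<close>

definition comm :: "('a, 'c) monoid_scheme \<Rightarrow> 'a \<Rightarrow> 'a \<Rightarrow> 'a" where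
  "comm G a b = a \<otimes>\<^bsub>G\<^esub> b \<otimes>\<^bsub>G\<^esub> inv\<^bsub>G\<^esub> a \<otimes>\<^bsub>G\<^esub> inv\<^bsub>G\<^esub> b"

definition lprod :: "('a, 'c) monoid_scheme \<Rightarrow> (nat \<Rightarrow> 'a) \<Rightarrow> nat list \<Rightarrow> 'a" where
  "lprod G p is = foldr (\<lambda>i a. p i \<otimes>\<^bsub>G\<^esub> a) is \<one>\<^bsub>G\<^esub>"

lemma lprod_Nil [simp]: "lprod G p [] = \<one>\<^bsub>G\<^esub>"
  and lprod_Cons [simp]: "lprod G p (i # is) = p i \<otimes>\<^bsub>G\<^esub> lprod G p is"
  by (simp_all add: lprod_def)

lemma (in group) comm_closed [simp]: "a \<in> carrier G \<Longrightarrow> b \<in> carrier G \<Longrightarrow> comm G a b \<in> carrier G"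
  by (simp add: comm_def)

lemma (in group) lprod_closed: "(\<And>i. i \<in> set is \<Longrightarrow> p i \<in> carrier G) \<Longrightarrow> lprod G p is \<in> carrier G"
  by (induction "is") auto

lemma (in group) lprod_append:
  "(\<And>i. i \<in> set is \<union> set js \<Longrightarrow> p i \<in> carrier G) \<Longrightarrow>
    lprod G p (is @ js) = lprod G p is \<otimes> lprod G p js"
  by (induction "is") (auto simp: m_assoc lprod_closed)

lemma lprod_cong: "(\<And>i. i \<in> set is \<Longrightarrow> p i = q i) \<Longrightarrow> lprod G p is = lprod G q is"
  by (induction "is") auto

lemma (in group) lprod_one: "(\<And>i. i \<in> set is \<Longrightarrow> p i = \<one>) \<Longrightarrow> lprod G p is = \<one>"
  by (induction "is") auto

lemma (in group) ev_surf_relator: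
  assumes f: "\<And>i. i < 2*g \<Longrightarrow> f i \<in> carrier G"
  shows "ev G f (surf_relator g) = lprod G (\<lambda>i. comm G (f i) (f (g + i))) [0..<g]"
proof -
  have "ev G f (concat (map (\<lambda>i. [(i, False), (g + i, False), (i, True), (g + i, True)]) is)) =
      lprod G (\<lambda>i. comm G (f i) (f (g + i))) is" if "set is \<subseteq> {..<g}" for "is"
    using that
  proof (induction "is")
    case (Cons i "is")
    let ?w = "concat (map (\<lambda>i. [(i, False), (g + i, False), (i, True), (g + i, True)]) is)"
    have "ev G f ?w \<in> carrier G"
      by (rule ev_closed[where n = "2*g"]) (use Cons.prems f in auto)
    then show ?case using Cons f
      by (simp add: ev_letter_def comm_def m_assoc)
  qed simp
  then show ?thesis by (simp add: surf_relator_def lessThan_def subset_iff)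
qed

lemma surf_relator_in_surf_N: "surf_relator g \<in> surf_N g"
proof -
  let ?F = "free_group (2*g)"
  interpret F: group "?F" by (rule group_free_group)
  have "\<one>\<^bsub>?F\<^esub> \<otimes>\<^bsub>?F\<^esub> surf_relator g \<otimes>\<^bsub>?F\<^esub> inv\<^bsub>?F\<^esub> \<one>\<^bsub>?F\<^esub> \<in> surf_N g"
    unfolding surf_N_def by (rule generate.incl) (use F.one_closed in blast)
  then show ?thesis
    using surf_relator_in_carrier[of g] by simp
qed

lemma surface_relation:
  "lprod (surface_group g) (\<lambda>i. comm (surface_group g) (sgen g i) (sgen g (g + i))) [0..<g] = \<one>\<^bsub>surface_group g\<^esub>"
proof -
  interpret S: group "surface_group g" by (rule group_surface_group)
  interpret F: group "free_group (2*g)" by (rule group_free_group)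
  let ?N = "\<lambda>w. surf_N g #>\<^bsub>free_group (2*g)\<^esub> w"
  note R = surf_relator_in_carrier
  have "?N (surf_relator g) = ev (surface_group g) (sgen g) (surf_relator g)"
    by (rule hom_eq_on_generate[OF group_free_group group_surface_group surface_proj_hom
          S.ev_hom[where n = "2*g" and f = "sgen g"], where S = "gen ` {..<2*g}"])
       (use R in \<open>auto simp: free_group_generate[symmetric] S.ev_gen sgen_def[symmetric]\<close>)
  moreover have "?N (surf_relator g) = \<one>\<^bsub>surface_group g\<^esub>"
    using surf_relator_in_surf_N normal_imp_subgroup[OF normal_surf_N]
    by (simp add: surface_group_def F.coset_join2 R)
  ultimately show ?thesis using S.ev_surf_relator[of g "sgen g"] by simp
qed

text \<open>The formula on all cosets, beyond the values on generators, is what later shows that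
  exponent sums do not depend on the word chosen in a coset.\<close>

lemma surface_hom_exists:
  assumes "group H" and f: "\<And>i. i < 2*g \<Longrightarrow> f i \<in> carrier H"
    and rel: "lprod H (\<lambda>i. comm H (f i) (f (g + i))) [0..<g] = \<one>\<^bsub>H\<^esub>"
  shows "\<exists>h \<in> hom (surface_group g) H. (\<forall>i<2*g. h (sgen g i) = f i) \<and>
    (\<forall>w \<in> carrier (free_group (2*g)). h (surf_N g #>\<^bsub>free_group (2*g)\<^esub> w) = ev H f w)"
proof -
  let ?F = "free_group (2*g)"
  interpret H: group H by fact
  interpret F: group "?F" by (rule group_free_group)
  interpret e: group_hom "?F" H "ev H f"
    using H.ev_hom[of "2*g" f] f by (simp add: group_hom_def group_hom_axioms_def F.is_group H.is_group)
  interpret N: normal "surf_N g" "?F" by (rule normal_surf_N)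
  note R = surf_relator_in_carrier
  have "generate (?F) {h \<otimes>\<^bsub>?F\<^esub> surf_relator g \<otimes>\<^bsub>?F\<^esub> inv\<^bsub>?F\<^esub> h
       | h. h \<in> carrier (?F)} \<subseteq> kernel (?F) H (ev H f)"
  proof (rule F.generate_subgroup_incl[OF _ e.subgroup_kernel], rule subsetI)
    fix k assume "k \<in> {h \<otimes>\<^bsub>?F\<^esub> surf_relator g \<otimes>\<^bsub>?F\<^esub> inv\<^bsub>?F\<^esub> h
       | h. h \<in> carrier (?F)}"
    then obtain h where h: "h \<in> carrier (?F)"
      "k = h \<otimes>\<^bsub>?F\<^esub> surf_relator g \<otimes>\<^bsub>?F\<^esub> inv\<^bsub>?F\<^esub> h" by auto
    have "ev H f (surf_relator g) = \<one>\<^bsub>H\<^esub>" using H.ev_surf_relator[of g f] f rel by simp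
    then show "k \<in> kernel (?F) H (ev H f)"
      using h R by (simp add: kernel_def)
  qed
  then have N: "surf_N g \<subseteq> kernel (?F) H (ev H f)" by (simp add: surf_N_def)
  have "ev H f x = ev H f y" if xy: "x \<in> carrier (?F)" "y \<in> carrier (?F)"
    "surf_N g #>\<^bsub>?F\<^esub> x = surf_N g #>\<^bsub>?F\<^esub> y" for x y
  proof -
    have "x \<in> surf_N g #>\<^bsub>?F\<^esub> y" using xy F.rcos_self[OF xy(1) N.is_subgroup] by simp
    then obtain n where "n \<in> surf_N g" "x = n \<otimes>\<^bsub>?F\<^esub> y" by (auto simp: r_coset_def)
    then show ?thesis using N xy by (auto simp: kernel_def)
  qed
  then obtain h where "h \<in> hom (?F Mod surf_N g) H"
    "\<And>x. x \<in> carrier (?F) \<Longrightarrow> h (surf_N g #>\<^bsub>?F\<^esub> x) = ev H f x"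
    using FactGroup_universal[OF e.homh normal_surf_N] by metis
  then show ?thesis using f H.ev_gen
    by (intro bexI[of _ h]) (auto simp: surface_group_def sgen_def)
qed

section \<open>Lifting finite cyclic groups of outer automorphisms\<close>

lemma fin_cyclic_subgroup_generate:
  assumes "group T" "A \<in> carrier T" "A [^]\<^bsub>T\<^esub> m = \<one>\<^bsub>T\<^esub>" "(m::nat) > 0"
  shows "fin_cyclic_subgroup T (generate T {A})" "card (generate T {A}) dvd m"
proof -
  interpret T: group T by fact
  have dvd: "T.ord A dvd m" using assms T.pow_eq_id by simp
  then have "T.ord A \<noteq> 0" using assms(4) by auto
  then have "finite (generate T {A})"
    using T.generate_pow_card[OF assms(2)] by (metis card.infinite)
  then show "fin_cyclic_subgroup T (generate T {A})"
    using assms(2) T.generate_is_subgroup[of "{A}"] by (auto simp: fin_cyclic_subgroup_def)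
  show "card (generate T {A}) dvd m" using T.generate_pow_card[OF assms(2)] dvd by simp
qed

text \<open>Left multiplication by an element of \<open>C\<close> is an injection of the finite set
  \<open>C\<close> into itself, which produces inverses. Closure under inverses is not assumed
  because \<open>Out_plus\<close> has not been shown to be a group, so that inverses in that
  structure carry little information.\<close>

lemma (in group) finite_submonoid_pow_card:
  assumes "C \<subseteq> carrier G" "finite C" "\<one> \<in> C" and mult: "\<And>x y. x \<in> C \<Longrightarrow> y \<in> C \<Longrightarrow> x \<otimes> y \<in> C"
    and "x \<in> C"
  shows "x [^] card C = \<one>"
proof -
  have inv: "inv y \<in> C" if y: "y \<in> C" for y
  proof -
    have "(\<lambda>z. y \<otimes> z) ` C = C"
      using y assms(1,2) mult by (intro endo_inj_surj) (auto intro!: inj_onI simp: subset_iff)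
    then obtain z where "z \<in> C" "y \<otimes> z = \<one>" using assms(3) by (metis imageE)
    then show ?thesis using inv_equality[of z y] inv_comm[of y z] y assms(1) by (auto simp: subset_iff)
  qed
  have sub: "subgroup C G" by (rule subgroupI) (use assms inv in auto)
  interpret C: group "G\<lparr>carrier := C\<rparr>" by (rule subgroup_imp_group[OF sub])
  have "x [^]\<^bsub>G\<lparr>carrier := C\<rparr>\<^esub> Coset.order (G\<lparr>carrier := C\<rparr>) = \<one>"
    using C.pow_order_eq_1[of x] assms(5) by simp
  then show ?thesis using nat_pow_consistent[of x "card C" C] by (simp add: Coset.order_def)
qed

text \<open>The domain of \<open>f\<close> is allowed to be a subset of a group, as it is for \<open>Out_plus\<close>.\<close>
lemma lifts_generate_obtains:
  assumes "group T" "A \<in> carrier T" "A [^]\<^bsub>T\<^esub> m = \<one>\<^bsub>T\<^esub>" "(m::nat) > 0"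
    and "group S" "K \<subseteq> carrier S" "lifts (S\<lparr>carrier := K\<rparr>) f (generate T {A})"
  obtains c where "c \<in> K" "f c = A" "c [^]\<^bsub>S\<^esub> m = \<one>\<^bsub>S\<^esub>"
proof -
  interpret S: group S by fact
  obtain C where C: "subgroup C (S\<lparr>carrier := K\<rparr>)" "inj_on f C" "f ` C = generate T {A}"
    using assms(7) by (auto simp: lifts_def)
  have "A \<in> generate T {A}" by (rule generate.incl) simp
  then obtain c where c: "c \<in> C" "f c = A" using C(3) by (metis imageE)
  have fin: "finite C"
    using fin_cyclic_subgroup_generate(1)[OF assms(1-4)] finite_imageD[OF _ C(2)] C(3)
    by (simp add: fin_cyclic_subgroup_def)
  \<comment> \<open>Here \<open>f\<close> is an arbitrary function, so the order of \<open>c\<close>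
    is bounded through \<open>card C\<close>, which injectivity identifies with the order of the
    cyclic target.\<close>
  have "card C dvd m"
    using fin_cyclic_subgroup_generate(2)[OF assms(1-4)] C(2,3) card_image[OF C(2)] by simp
  moreover have "c [^]\<^bsub>S\<^esub> card C = \<one>\<^bsub>S\<^esub>"
    using C(1) fin c assms(6) by (intro S.finite_submonoid_pow_card) (auto simp: subgroup_def)
  moreover have "c \<in> K" using C(1) c by (auto simp: subgroup_def)
  ultimately have "c [^]\<^bsub>S\<^esub> m = \<one>\<^bsub>S\<^esub>"
    using S.pow_eq_id[of c "card C"] S.pow_eq_id[of c m] assms(6) dvd_trans by blast
  then show ?thesis using that[of c] c(2) \<open>c \<in> K\<close> by blast
qed

section \<open>Automorphisms, inner automorphisms and outer classes\<close>

context group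
begin

lemma inv_cancel [simp]:
  "h \<in> carrier G \<Longrightarrow> a \<in> carrier G \<Longrightarrow> inv h \<otimes> (h \<otimes> a) = a"
  "h \<in> carrier G \<Longrightarrow> a \<in> carrier G \<Longrightarrow> h \<otimes> (inv h \<otimes> a) = a"
  by (simp_all add: m_assoc[symmetric])

lemma carrier_Aut [simp]: "carrier (Aut G) = auto G"
  by (simp add: Aut_def AutoGroup_def)

lemma group_Aut: "group (Aut G)"
  by (simp add: Aut_def AutoGroup)

lemma mult_Aut: "\<phi> \<in> auto G \<Longrightarrow> \<psi> \<in> auto G \<Longrightarrow> \<phi> \<otimes>\<^bsub>Aut G\<^esub> \<psi> = compose (carrier G) \<phi> \<psi>"
  by (simp add: Aut_def AutoGroup_def BijGroup_def auto_def)

lemma one_Aut: "\<one>\<^bsub>Aut G\<^esub> = (\<lambda>x\<in>carrier G. x)"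
  by (simp add: Aut_def AutoGroup_def BijGroup_def)

lemma auto_closed: "\<phi> \<in> auto G \<Longrightarrow> x \<in> carrier G \<Longrightarrow> \<phi> x \<in> carrier G"
  by (auto simp: auto_def hom_def)

lemma auto_eqI: "\<phi> \<in> auto G \<Longrightarrow> \<psi> \<in> auto G \<Longrightarrow> (\<And>x. x \<in> carrier G \<Longrightarrow> \<phi> x = \<psi> x) \<Longrightarrow> \<phi> = \<psi>"
  by (auto simp: auto_def Bij_def intro: extensionalityI)

lemma pow_Aut:
  assumes "\<phi> \<in> auto G" "x \<in> carrier G"
  shows "(\<phi> [^]\<^bsub>Aut G\<^esub> (m::nat)) x = (\<phi> ^^ m) x"
proof -
  interpret A: group "Aut G" by (rule group_Aut)
  have "\<phi> [^]\<^bsub>Aut G\<^esub> m \<in> auto G" for m :: nat using A.nat_pow_closed[of \<phi> m] assms by simp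
  then show ?thesis using assms
  proof (induction m arbitrary: x)
    case 0
    then show ?case by (simp add: one_Aut)
  next
    case (Suc m)
    then show ?case
      by (simp add: mult_Aut compose_def funpow_Suc_right auto_closed del: funpow.simps)
  qed
qed

definition conj_by :: "'a \<Rightarrow> 'a \<Rightarrow> 'a" where
  "conj_by h = (\<lambda>x\<in>carrier G. h \<otimes> x \<otimes> inv h)"

lemma inn_eq: "inn G = conj_by ` carrier G"
  by (auto simp: inn_def conj_by_def)

lemma conj_by_hom: "h \<in> carrier G \<Longrightarrow> conj_by h \<in> hom G G"
  by (rule homI) (auto simp: conj_by_def m_assoc)

lemma conj_by_auto: "h \<in> carrier G \<Longrightarrow> conj_by h \<in> auto G"
proof -
  assume h: "h \<in> carrier G"
  have "bij_betw (conj_by h) (carrier G) (carrier G)"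
    by (rule bij_betw_byWitness[where f' = "conj_by (inv h)"])
      (use h in \<open>auto simp: conj_by_def m_assoc\<close>)
  then show ?thesis using conj_by_hom[OF h] by (simp add: auto_def Bij_def conj_by_def)
qed

lemma conj_by_mult: "h \<in> carrier G \<Longrightarrow> k \<in> carrier G \<Longrightarrow>
    conj_by h \<otimes>\<^bsub>Aut G\<^esub> conj_by k = conj_by (h \<otimes> k)"
  using conj_by_auto[of h] conj_by_auto[of k]
  by (auto simp: mult_Aut compose_def fun_eq_iff restrict_def conj_by_def m_assoc inv_mult_group)

lemma normal_inn: "inn G \<lhd> Aut G"
proof -
  interpret A: group "Aut G" by (rule group_Aut)
  have one: "conj_by \<one> = \<one>\<^bsub>Aut G\<^esub>"
    by (rule auto_eqI) (use A.one_closed in \<open>auto simp: conj_by_auto one_Aut\<close>, simp add: conj_by_def)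
  have inv: "inv\<^bsub>Aut G\<^esub> (conj_by h) = conj_by (inv h)" if "h \<in> carrier G" for h
    using that by (intro A.inv_equality) (auto simp: conj_by_auto conj_by_mult one)
  have "subgroup (inn G) (Aut G)"
    unfolding inn_eq by (rule A.subgroupI) (use inv in \<open>auto simp: conj_by_auto conj_by_mult\<close>)
  then show ?thesis
  proof (rule A.normal_invI)
    fix \<phi> c assume \<phi>: "\<phi> \<in> carrier (Aut G)" and "c \<in> inn G"
    then obtain h where h: "h \<in> carrier G" "c = conj_by h" by (auto simp: inn_eq)
    interpret \<phi>: group_hom G G \<phi> using \<phi> by unfold_locales (simp add: auto_def)
    have "\<phi> \<otimes>\<^bsub>Aut G\<^esub> c = conj_by (\<phi> h) \<otimes>\<^bsub>Aut G\<^esub> \<phi>"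
    proof (rule auto_eqI)
      fix x assume "x \<in> carrier G"
      then show "(\<phi> \<otimes>\<^bsub>Aut G\<^esub> c) x = (conj_by (\<phi> h) \<otimes>\<^bsub>Aut G\<^esub> \<phi>) x"
        using \<phi> h by (simp add: mult_Aut conj_by_auto compose_def) (simp add: conj_by_def)
    qed (use \<phi> h A.m_closed in \<open>auto simp: conj_by_auto\<close>)
    then have "\<phi> \<otimes>\<^bsub>Aut G\<^esub> c \<otimes>\<^bsub>Aut G\<^esub> inv\<^bsub>Aut G\<^esub> \<phi> = conj_by (\<phi> h)"
      using \<phi> h A.m_assoc[of "conj_by (\<phi> h)" \<phi> "inv\<^bsub>Aut G\<^esub> \<phi>"] A.r_inv[OF \<phi>]
        A.r_one[of "conj_by (\<phi> h)"] A.inv_closed[OF \<phi>] by (simp add: conj_by_auto)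
    then show "\<phi> \<otimes>\<^bsub>Aut G\<^esub> c \<otimes>\<^bsub>Aut G\<^esub> inv\<^bsub>Aut G\<^esub> \<phi> \<in> inn G"
      using h by (simp add: inn_eq)
  qed
qed

lemma group_Out: "group (Out G)"
  unfolding Out_def by (rule normal.factorgroup_is_group[OF normal_inn])

lemma proj_out_closed: "\<phi> \<in> auto G \<Longrightarrow> proj_out G \<phi> \<in> carrier (Out G)"
  by (simp add: proj_out_def Out_def carrier_FactGroup)

lemma proj_out_eq_one_iff: "\<phi> \<in> auto G \<Longrightarrow> proj_out G \<phi> = \<one>\<^bsub>Out G\<^esub> \<longleftrightarrow> \<phi> \<in> inn G"
proof -
  interpret A: group "Aut G" by (rule group_Aut)
  interpret N: normal "inn G" "Aut G" by (rule normal_inn)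
  show "\<phi> \<in> auto G \<Longrightarrow> ?thesis"
    using A.coset_join1[of "inn G" \<phi>] A.coset_join2[of \<phi> "inn G"] N.subset N.is_subgroup
    by (auto simp: proj_out_def Out_def)
qed

lemma pow_proj_out: "\<phi> \<in> auto G \<Longrightarrow> proj_out G \<phi> [^]\<^bsub>Out G\<^esub> (m::nat) = proj_out G (\<phi> [^]\<^bsub>Aut G\<^esub> m)"
  using normal.FactGroup_pow[OF normal_inn, of \<phi> m] by (simp add: proj_out_def Out_def)

lemma in_innE:
  assumes "\<psi> \<in> inn G"
  obtains h where "h \<in> carrier G" "\<And>x. x \<in> carrier G \<Longrightarrow> \<psi> x = h \<otimes> x \<otimes> inv h"
  using assms by (auto simp: inn_eq conj_by_def)

text \<open>Phrased for the Hilbert choice because \<open>beta\<close> and \<open>delta\<close> read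
  their matrices off exactly this representative.\<close>

lemma Out_torsion:
  assumes c: "c \<in> carrier (Out G)" "c [^]\<^bsub>Out G\<^esub> (m::nat) = \<one>\<^bsub>Out G\<^esub>"
  shows "(SOME \<phi>. \<phi> \<in> c) \<in> auto G"
    "\<exists>h\<in>carrier G. \<forall>x\<in>carrier G. ((SOME \<phi>. \<phi> \<in> c) ^^ m) x = h \<otimes> x \<otimes> inv h"
proof -
  interpret A: group "Aut G" by (rule group_Aut)
  interpret N: normal "inn G" "Aut G" by (rule normal_inn)
  obtain \<phi>0 where \<phi>0: "\<phi>0 \<in> auto G" "c = inn G #>\<^bsub>Aut G\<^esub> \<phi>0"
    using c(1) by (auto simp: Out_def carrier_FactGroup)
  define \<phi> where "\<phi> = (SOME \<phi>. \<phi> \<in> c)"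
  have "\<phi>0 \<in> c" using \<phi>0 A.rcos_self[of \<phi>0 "inn G"] N.is_subgroup by simp
  then have "\<phi> \<in> c" unfolding \<phi>_def by (rule someI[where P = "\<lambda>\<phi>. \<phi> \<in> c"])
  then have \<phi>: "\<phi> \<in> auto G" "c = proj_out G \<phi>"
    using \<phi>0 N.elemrcos_carrier[OF A.is_group, of \<phi>0 \<phi>] A.repr_independence[of \<phi> "inn G" \<phi>0] N.is_subgroup
    by (auto simp: proj_out_def)
  then have "\<phi> [^]\<^bsub>Aut G\<^esub> m \<in> inn G"
    using c(2) proj_out_eq_one_iff[of "\<phi> [^]\<^bsub>Aut G\<^esub> m"] A.nat_pow_closed[of \<phi> m] by (simp add: pow_proj_out)
  then obtain h where "h \<in> carrier G" "\<And>x. x \<in> carrier G \<Longrightarrow> (\<phi> [^]\<^bsub>Aut G\<^esub> m) x = h \<otimes> x \<otimes> inv h"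
    using in_innE by metis
  then show "(SOME \<phi>. \<phi> \<in> c) \<in> auto G"
    "\<exists>h\<in>carrier G. \<forall>x\<in>carrier G. ((SOME \<phi>. \<phi> \<in> c) ^^ m) x = h \<otimes> x \<otimes> inv h"
    using \<phi>(1) pow_Aut[OF \<phi>(1)] unfolding \<phi>_def[symmetric] by auto
qed

text \<open>Every preimage of the class of \<open>\<phi>\<close> is \<open>\<phi>\<close> followed
  by conjugation by some \<open>k\<close>, and a lift of the cyclic group makes its
  \<open>m\<close>-th power trivial, against \<open>no\<close>.\<close>

lemma proj_out_not_lifting:
  assumes \<phi>: "\<phi> \<in> auto G" and m: "(m::nat) > 0" and h: "h \<in> carrier G"
    and pow: "\<And>x. x \<in> carrier G \<Longrightarrow> (\<phi> ^^ m) x = h \<otimes> x \<otimes> inv h"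
    and no: "\<And>k. k \<in> carrier G \<Longrightarrow> \<not> (\<forall>x\<in>carrier G. ((\<lambda>y. k \<otimes> \<phi> y \<otimes> inv k) ^^ m) x = x)"
  shows "\<exists>C. fin_cyclic_subgroup (Out G) C \<and> \<not> lifts (Aut G) (proj_out G) C"
proof (intro exI conjI notI)
  interpret A: group "Aut G" by (rule group_Aut)
  interpret N: normal "inn G" "Aut G" by (rule normal_inn)
  interpret O: group "Out G" by (rule group_Out)
  have "\<phi> [^]\<^bsub>Aut G\<^esub> m = conj_by h"
    by (rule auto_eqI) (use \<phi> h A.nat_pow_closed[of \<phi> m] in
        \<open>simp_all add: pow_Aut pow conj_by_auto\<close>, simp add: conj_by_def)
  then have one: "proj_out G \<phi> [^]\<^bsub>Out G\<^esub> m = \<one>\<^bsub>Out G\<^esub>"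
    using \<phi> h by (simp add: pow_proj_out proj_out_eq_one_iff conj_by_auto) (simp add: inn_eq)
  note A = O.is_group proj_out_closed[OF \<phi>] one m
  show "fin_cyclic_subgroup (Out G) (generate (Out G) {proj_out G \<phi>})"
    by (rule fin_cyclic_subgroup_generate[OF A])
  assume "lifts (Aut G) (proj_out G) (generate (Out G) {proj_out G \<phi>})"
  then obtain c where c: "c \<in> auto G" "proj_out G c = proj_out G \<phi>" "c [^]\<^bsub>Aut G\<^esub> m = \<one>\<^bsub>Aut G\<^esub>"
    using lifts_generate_obtains[OF A A.is_group, of "auto G" "proj_out G"]
    by (metis carrier_Aut partial_object.surjective partial_object.update_convs(1) subset_refl)
  have "c \<in> inn G #>\<^bsub>Aut G\<^esub> \<phi>"
    using c(1,2) A.rcos_self[of c "inn G"] N.is_subgroup by (simp add: proj_out_def)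
  then obtain k where k: "k \<in> carrier G" "c = conj_by k \<otimes>\<^bsub>Aut G\<^esub> \<phi>"
    by (auto simp: r_coset_def inn_eq)
  have cx: "c x = k \<otimes> \<phi> x \<otimes> inv k" if "x \<in> carrier G" for x
    using that k \<phi> by (simp add: mult_Aut conj_by_auto compose_def) (simp add: conj_by_def auto_closed)
  have "((\<lambda>y. k \<otimes> \<phi> y \<otimes> inv k) ^^ j) x = (c ^^ j) x \<and> (c ^^ j) x \<in> carrier G" if "x \<in> carrier G" for x j
    using that by (induction j) (auto simp: cx k(1) \<phi> auto_closed)
  then have "((\<lambda>y. k \<otimes> \<phi> y \<otimes> inv k) ^^ m) x = x" if "x \<in> carrier G" for x
    using that c pow_Aut[of c x m] by (simp add: one_Aut)
  with no[OF k(1)] show False by blast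
qed

text \<open>The witness is the twisted product \<open>k \<phi>(k) ... \<phi>^(j-1)(k)\<close>. As
  \<open>e\<close> is invariant under \<open>\<phi>\<close>, each factor contributes
  \<open>e k\<close>.\<close>

lemma conj_pow_decompose:
  assumes \<phi>: "\<phi> \<in> hom G G" and k: "k \<in> carrier G"
    and e: "e \<in> hom G intg" "\<And>x. x \<in> carrier G \<Longrightarrow> e (\<phi> x) = e x"
  shows "\<exists>u\<in>carrier G. e u = int j * e k \<and>
    (\<forall>x\<in>carrier G. ((\<lambda>y. k \<otimes> \<phi> y \<otimes> inv k) ^^ j) x = u \<otimes> (\<phi> ^^ j) x \<otimes> inv u)"
proof (induction j)
  case 0
  interpret e: group_hom G intg e using e group_intg by (simp add: group_homI is_group)
  show ?case using e.hom_one by (intro bexI[of _ \<one>]) auto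
next
  case (Suc j)
  then obtain u where u: "u \<in> carrier G" "e u = int j * e k"
    "\<And>x. x \<in> carrier G \<Longrightarrow> ((\<lambda>y. k \<otimes> \<phi> y \<otimes> inv k) ^^ j) x = u \<otimes> (\<phi> ^^ j) x \<otimes> inv u" by blast
  interpret e: group_hom G intg e using e group_intg by (simp add: group_homI is_group)
  interpret \<phi>: group_hom G G \<phi> using \<phi> by (simp add: group_homI is_group)
  have cl: "(\<phi> ^^ j) x \<in> carrier G" if "x \<in> carrier G" for x
    using that by (induction j) auto
  show ?case
    using u k cl by (intro bexI[of _ "k \<otimes> \<phi> u"]) (auto simp: e(2) m_assoc inv_mult_group algebra_simps)
qed

text \<open>A root of a bijection is a bijection, and the \<open>m\<close>-th power is a
  conjugation; the restriction supplies the extensionality demanded by \<open>auto\<close>.\<close>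

lemma restrict_auto:
  assumes \<phi>: "\<phi> \<in> hom G G" and m: "(m::nat) > 0" and h: "h \<in> carrier G"
    and pow: "\<And>x. x \<in> carrier G \<Longrightarrow> (\<phi> ^^ m) x = h \<otimes> x \<otimes> inv h"
  shows "restrict \<phi> (carrier G) \<in> auto G"
proof -
  interpret \<phi>: group_hom G G \<phi> using \<phi> by (simp add: group_homI is_group)
  obtain j where j: "m = Suc j" using m by (cases m) auto
  have cl: "(\<phi> ^^ i) x \<in> carrier G" if "x \<in> carrier G" for i x
    using that by (induction i) auto
  have "inj_on \<phi> (carrier G)"
  proof (rule inj_onI)
    fix x y assume xy: "x \<in> carrier G" "y \<in> carrier G" "\<phi> x = \<phi> y"
    then have "(\<phi> ^^ m) x = (\<phi> ^^ m) y" by (simp add: j funpow_Suc_right del: funpow.simps)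
    then show "x = y" using xy h by (simp add: pow)
  qed
  moreover have "\<phi> ` carrier G = carrier G"
  proof
    show "carrier G \<subseteq> \<phi> ` carrier G"
    proof
      fix x assume x: "x \<in> carrier G"
      have "(\<phi> ^^ m) (inv h \<otimes> x \<otimes> h) = x" using x h by (simp add: pow m_assoc)
      then have "\<phi> ((\<phi> ^^ j) (inv h \<otimes> x \<otimes> h)) = x" by (simp add: j)
      then show "x \<in> \<phi> ` carrier G" using cl[of "inv h \<otimes> x \<otimes> h" j] x h
        by (auto intro!: image_eqI[of x \<phi> "(\<phi> ^^ j) (inv h \<otimes> x \<otimes> h)"])
    qed
  qed auto
  ultimately have "bij_betw (restrict \<phi> (carrier G)) (carrier G) (carrier G)"
    by (simp add: bij_betw_def)
  then show ?thesis using \<phi> by (auto simp: auto_def Bij_def hom_def)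
qed

lemma funpow_hom: "\<phi> \<in> hom G G \<Longrightarrow> (\<phi> ^^ j) \<in> hom G G"
  by (induction j) (auto simp: hom_def Pi_iff)

lemma funpow_eq_conjI:
  assumes "\<phi> \<in> hom G G" "h \<in> carrier G" "S \<subseteq> carrier G" "carrier G = generate G S"
    and "\<And>s. s \<in> S \<Longrightarrow> (\<phi> ^^ m) s = h \<otimes> s \<otimes> inv h" and x: "x \<in> carrier G"
  shows "(\<phi> ^^ m) x = h \<otimes> x \<otimes> inv h"
proof -
  have "(\<phi> ^^ m) x = conj_by h x"
    by (rule hom_eq_on_generate[OF is_group is_group funpow_hom[OF assms(1)] conj_by_hom[OF assms(2)] assms(3)])
      (use assms in \<open>auto simp: conj_by_def subset_iff\<close>)
  then show ?thesis using x by (simp add: conj_by_def)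
qed

text \<open>Spares the geometric constructions below from showing that their endomorphisms are
  bijective or extensional.\<close>

lemma proj_out_not_lifting':
  assumes \<phi>: "\<phi> \<in> hom G G" and m: "(m::nat) > 0" and h: "h \<in> carrier G"
    and pow: "\<And>x. x \<in> carrier G \<Longrightarrow> (\<phi> ^^ m) x = h \<otimes> x \<otimes> inv h"
    and no: "\<And>k. k \<in> carrier G \<Longrightarrow> \<not> (\<forall>x\<in>carrier G. ((\<lambda>y. k \<otimes> \<phi> y \<otimes> inv k) ^^ m) x = x)"
  shows "\<exists>C. fin_cyclic_subgroup (Out G) C \<and> \<not> lifts (Aut G) (proj_out G) C"
proof (rule proj_out_not_lifting[OF restrict_auto[OF assms(1-4)] m h])
  interpret \<phi>: group_hom G G \<phi> using \<phi> by (simp add: group_homI is_group)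
  have eq: "((\<lambda>y. k \<otimes> restrict \<phi> (carrier G) y \<otimes> inv k) ^^ j) x = ((\<lambda>y. k \<otimes> \<phi> y \<otimes> inv k) ^^ j) x \<and>
      ((\<lambda>y. k \<otimes> \<phi> y \<otimes> inv k) ^^ j) x \<in> carrier G"
    if "x \<in> carrier G" "k \<in> carrier G" for x k j
    using that by (induction j) auto
  have "(restrict \<phi> (carrier G) ^^ j) x = (\<phi> ^^ j) x \<and> (\<phi> ^^ j) x \<in> carrier G" if "x \<in> carrier G" for x j
    using that by (induction j) auto
  then show "(restrict \<phi> (carrier G) ^^ m) x = h \<otimes> x \<otimes> inv h" if "x \<in> carrier G" for x
    using that pow by simp
  show "\<not> (\<forall>x\<in>carrier G. ((\<lambda>y. k \<otimes> restrict \<phi> (carrier G) y \<otimes> inv k) ^^ m) x = x)"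
    if "k \<in> carrier G" for k
    using no[OF that] eq[OF _ that] by auto
qed

text \<open>If the class of \<open>\<phi>\<close> lifted, some \<open>u\<close> with \<open>e u = m * e k + 1\<close> would be central.\<close>
lemma proj_out_not_lifting_expsum:
  assumes \<phi>: "\<phi> \<in> hom G G" and m: "(m::nat) \<ge> 2" and h: "h \<in> carrier G"
    and pow: "\<And>x. x \<in> carrier G \<Longrightarrow> (\<phi> ^^ m) x = h \<otimes> x \<otimes> inv h"
    and e: "e \<in> hom G intg" "\<And>x. x \<in> carrier G \<Longrightarrow> e (\<phi> x) = e x" "e h = 1"
    and central: "\<And>u. u \<in> carrier G \<Longrightarrow> (\<And>x. x \<in> carrier G \<Longrightarrow> u \<otimes> x = x \<otimes> u) \<Longrightarrow> e u = 0"
  shows "\<exists>C. fin_cyclic_subgroup (Out G) C \<and> \<not> lifts (Aut G) (proj_out G) C"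
proof -
  interpret e: group_hom G intg e using e group_intg by (simp add: group_homI is_group)
  interpret \<phi>: group_hom G G \<phi> using \<phi> by (simp add: group_homI is_group)
  show ?thesis
  proof (rule proj_out_not_lifting'[OF \<phi> _ h pow])
    fix k assume k: "k \<in> carrier G"
    obtain u where u: "u \<in> carrier G" "e u = int m * e k"
      "\<And>x. x \<in> carrier G \<Longrightarrow> ((\<lambda>y. k \<otimes> \<phi> y \<otimes> inv k) ^^ m) x = u \<otimes> (\<phi> ^^ m) x \<otimes> inv u"
      using conj_pow_decompose[OF \<phi> k e(1,2), of m] by blast
    show "\<not> (\<forall>x\<in>carrier G. ((\<lambda>y. k \<otimes> \<phi> y \<otimes> inv k) ^^ m) x = x)"
    proof
      assume "\<forall>x\<in>carrier G. ((\<lambda>y. k \<otimes> \<phi> y \<otimes> inv k) ^^ m) x = x"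
      then have "(u \<otimes> h) \<otimes> x = x \<otimes> (u \<otimes> h)" if "x \<in> carrier G" for x
      proof -
        have "x = u \<otimes> h \<otimes> x \<otimes> inv (u \<otimes> h)"
          using \<open>\<forall>x\<in>carrier G. _ x = x\<close> that u h by (simp add: pow m_assoc inv_mult_group)
        then show ?thesis using that u h inv_solve_right[of x "u \<otimes> h \<otimes> x" "u \<otimes> h"] by simp
      qed
      then have "e (u \<otimes> h) = 0" using u h by (intro central) auto
      then have "int m * e k = - 1" using u h e(3) by simp
      then have "int m dvd 1" by (metis dvd_minus_iff dvd_triv_left)
      then show False using m by simp
    qed
  qed (use m in auto)
qed

end

section \<open>The Heisenberg group and the infinite dihedral group\<close>

text \<open>Integral upper unitriangular matrices of size three, with \<open>a\<close> and
  \<open>b\<close> next to the diagonal and \<open>c\<close> in the corner; the universal target for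
  reading off one commutator coordinate in class two.\<close>

definition heis :: "(int \<times> int \<times> int) monoid" where
  "heis = \<lparr>carrier = UNIV,
     monoid.mult = (\<lambda>(a, b, c) (a', b', c'). (a + a', b + b', c + c' + a * b')), monoid.one = (0, 0, 0)\<rparr>"

lemma heis_simps [simp]: "carrier heis = UNIV"
  "(a, b, c) \<otimes>\<^bsub>heis\<^esub> (a', b', c') = (a + a', b + b', c + c' + a * b')" "\<one>\<^bsub>heis\<^esub> = (0, 0, 0)"
  by (simp_all add: heis_def)

lemma group_heis: "group heis"
proof (rule groupI)
  fix x assume "x \<in> carrier heis"
  show "\<exists>y\<in>carrier heis. y \<otimes>\<^bsub>heis\<^esub> x = \<one>\<^bsub>heis\<^esub>"
  proof (cases x)
    case (fields a b c)
    then show ?thesis by (intro bexI[of _ "(- a, - b, a * b - c)"]) auto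
  qed
qed (auto simp: algebra_simps)

lemma inv_heis [simp]: "inv\<^bsub>heis\<^esub> (a, b, c) = (- a, - b, a * b - c)"
  by (rule group.inv_equality[OF group_heis]) auto

lemma comm_heis [simp]: "comm heis (a, b, c) (a', b', c') = (0, 0, a * b' - a' * b)"
  by (simp add: comm_def algebra_simps)

text \<open>\<open>(p, s)\<close> is the isometry \<open>x \<mapsto> p + x\<close> (\<open>s = False\<close>) or \<open>x \<mapsto> p - x\<close> (\<open>s = True\<close>) of the integers.\<close>
definition dinf :: "(int \<times> bool) monoid" where
  "dinf = \<lparr>carrier = UNIV,
     monoid.mult = (\<lambda>(p, s) (p', s'). (if s then p - p' else p + p', s \<noteq> s')), monoid.one = (0, False)\<rparr>"

lemma dinf_simps [simp]: "carrier dinf = UNIV"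
  "(p, s) \<otimes>\<^bsub>dinf\<^esub> (p', s') = (if s then p - p' else p + p', s \<noteq> s')" "\<one>\<^bsub>dinf\<^esub> = (0, False)"
  by (simp_all add: dinf_def)

lemma group_dinf: "group dinf"
proof (rule groupI)
  fix x assume "x \<in> carrier dinf"
  show "\<exists>y\<in>carrier dinf. y \<otimes>\<^bsub>dinf\<^esub> x = \<one>\<^bsub>dinf\<^esub>"
  proof (cases x)
    case (Pair p s)
    then show ?thesis by (intro bexI[of _ "(if s then p else - p, s)"]) auto
  qed
qed auto

lemma inv_dinf [simp]: "inv\<^bsub>dinf\<^esub> (p, s) = (if s then p else - p, s)"
  by (rule group.inv_equality[OF group_dinf]) auto

lemma comm_dinf [simp]:
  "comm dinf (p, s) (p', s') = ((if s' then 2 * p else 0) - (if s then 2 * p' else 0), False)"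
  by (cases s; cases s'; simp add: comm_def)

lemma free_hom_exists:
  assumes "group H" "\<And>i. i < n \<Longrightarrow> f i \<in> carrier H"
  shows "\<exists>h \<in> hom (free_group n) H. \<forall>i<n. h (gen i) = f i"
  using group.ev_hom[OF assms] group.ev_gen[OF assms(1), of f] assms(2)
  by (intro bexI[of _ "ev H f"]) auto

lemma lprod_heis_center: "lprod heis (\<lambda>i. (0, 0, c i)) is = (0, 0, sum_list (map c is))"
  by (induction "is") auto

text \<open>The surface relator is sent to a central element whose corner entry is the intersection
  pairing of \<open>a\<close> and \<open>b\<close>; the hypothesis is the vanishing of the cup
  product of these two classes.\<close>

lemma surface_heis_hom_exists:
  assumes "(\<Sum>i<g. a i * b (g + i) - a (g + i) * b i) = (0::int)"
  shows "\<exists>h \<in> hom (surface_group g) heis. \<forall>i<2*g. h (sgen g i) = (a i, b i, 0)"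
proof -
  have "sum_list (map (\<lambda>i. a i * b (g + i) - a (g + i) * b i) [0..<g]) = 0"
    using assms by (simp add: interv_sum_list_conv_sum_set_nat atLeast0LessThan)
  then have "lprod heis (\<lambda>i. comm heis (a i, b i, 0) (a (g + i), b (g + i), 0)) [0..<g] = \<one>\<^bsub>heis\<^esub>"
    by (simp add: lprod_heis_center)
  then show ?thesis
    using surface_hom_exists[OF group_heis, of g "\<lambda>i. (a i, b i, 0)"] by auto
qed

text \<open>The commutator of \<open>u\<close> with an element having first coordinates
  \<open>1\<close> and \<open>0\<close> has minus the second coordinate of \<open>u\<close> as
  corner entry.\<close>

lemma heis_central:
  assumes "\<eta> \<in> hom G heis" "x \<in> carrier G" "u \<in> carrier G" "u \<otimes>\<^bsub>G\<^esub> x = x \<otimes>\<^bsub>G\<^esub> u" "fst (\<eta> x) = 1" "fst (snd (\<eta> x)) = 0"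
  shows "fst (snd (\<eta> u)) = 0"
proof -
  have "\<eta> u \<otimes>\<^bsub>heis\<^esub> \<eta> x = \<eta> x \<otimes>\<^bsub>heis\<^esub> \<eta> u"
    using assms(1-4) by (metis hom_mult)
  then show ?thesis using assms(5,6) by (cases "\<eta> u"; cases "\<eta> x") auto
qed

lemma heis_snd_hom: "\<eta> \<in> hom G heis \<Longrightarrow> (\<lambda>x. fst (snd (\<eta> x))) \<in> hom G intg"
proof (rule homI)
  fix x y assume "\<eta> \<in> hom G heis" "x \<in> carrier G" "y \<in> carrier G"
  then show "fst (snd (\<eta> (x \<otimes>\<^bsub>G\<^esub> y))) = fst (snd (\<eta> x)) \<otimes>\<^bsub>intg\<^esub> fst (snd (\<eta> y))"
    by (cases "\<eta> x"; cases "\<eta> y") (simp add: hom_mult)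
qed simp

lemma heis_fst_hom: "\<eta> \<in> hom G heis \<Longrightarrow> (\<lambda>x. fst (\<eta> x)) \<in> hom G intg"
proof (rule homI)
  fix x y assume "\<eta> \<in> hom G heis" "x \<in> carrier G" "y \<in> carrier G"
  then show "fst (\<eta> (x \<otimes>\<^bsub>G\<^esub> y)) = fst (\<eta> x) \<otimes>\<^bsub>intg\<^esub> fst (\<eta> y)"
    by (cases "\<eta> x"; cases "\<eta> y") (simp add: hom_mult)
qed simp

text \<open>Uses the same choice of a word in the coset as \<open>hmat\<close>, so that the entries
  of \<open>hmat\<close> are values of \<open>sexp\<close>.\<close>

definition sexp :: "nat \<Rightarrow> nat \<Rightarrow> word set \<Rightarrow> int" where
  "sexp g i C = expsum i (SOME w. w \<in> C)"

lemma sexp_hom: "sexp g i \<in> hom (surface_group g) intg"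
  and sexp_sgen: "j < 2*g \<Longrightarrow> sexp g i (sgen g j) = (if j = i then 1 else 0)"
proof -
  let ?F = "free_group (2*g)"
  interpret F: group "?F" by (rule group_free_group)
  interpret N: normal "surf_N g" "?F" by (rule normal_surf_N)
  let ?d = "\<lambda>j. if j = i then 1 else (0::int)"
  have "lprod intg (\<lambda>j. comm intg (?d j) (?d (g + j))) [0..<g] = \<one>\<^bsub>intg\<^esub>"
    by (rule group.lprod_one[OF group_intg]) (simp add: comm_def)
  then obtain h where h: "h \<in> hom (surface_group g) intg" "\<forall>j<2*g. h (sgen g j) = ?d j"
    "\<forall>w \<in> carrier (?F). h (surf_N g #>\<^bsub>?F\<^esub> w) = expsum i w"
    using surface_hom_exists[OF group_intg, of g ?d] by (auto simp: expsum_eq_ev)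
  have eq: "sexp g i C = h C" if C: "C \<in> carrier (surface_group g)" for C
  proof -
    obtain w0 where w0: "w0 \<in> carrier (?F)" "C = surf_N g #>\<^bsub>?F\<^esub> w0"
      using C unfolding surface_group_def carrier_FactGroup by blast
    define w where "w = (SOME w. w \<in> C)"
    have "w0 \<in> C" unfolding w0(2) by (rule F.rcos_self[OF w0(1) N.is_subgroup])
    then have "w \<in> C" unfolding w_def by (rule someI[where P = "\<lambda>w. w \<in> C"])
    then have w: "w \<in> surf_N g #>\<^bsub>?F\<^esub> w0" unfolding w0(2) .
    have "w \<in> carrier (?F)"
      by (rule N.elemrcos_carrier[OF F.is_group w0(1) w])
    moreover have "C = surf_N g #>\<^bsub>?F\<^esub> w"
      unfolding w0(2) by (rule F.repr_independence[OF w w0(1) N.is_subgroup])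
    ultimately have "h C = expsum i w" using h(3) by metis
    then show ?thesis unfolding sexp_def w_def[symmetric] by simp
  qed
  show "sexp g i \<in> hom (surface_group g) intg"
    using h(1) group.is_monoid[OF group_surface_group, of g]
    by (auto simp: hom_def eq monoid.m_closed)
  show "sexp g i (sgen g j) = (if j = i then 1 else 0)" if "j < 2*g"
    using h(2) that by (simp add: eq)
qed

section \<open>Central elements die in the abelianization\<close>

lemma free_central_expsum:
  assumes "n \<ge> 2" "t < n" and u: "u \<in> carrier (free_group n)"
    and c: "\<And>x. x \<in> carrier (free_group n) \<Longrightarrow> u \<otimes>\<^bsub>free_group n\<^esub> x = x \<otimes>\<^bsub>free_group n\<^esub> u"
  shows "expsum t u = 0"
proof -
  \<comment> \<open>Any generator other than \<open>gen t\<close> detects the exponent of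
    \<open>gen t\<close> through a commutator.\<close>
  define i where "i = (if t = 0 then 1 else (0::nat))"
  have i: "i < n" "i \<noteq> t" using assms by (auto simp: i_def)
  obtain \<eta> where \<eta>: "\<eta> \<in> hom (free_group n) heis"
    "\<And>j. j < n \<Longrightarrow> \<eta> (gen j) = (if j = i then 1 else 0, if j = t then 1 else 0, 0)"
    using free_hom_exists[OF group_heis, of n "\<lambda>j. (if j = i then 1 else 0, if j = t then 1 else 0, 0)"] by auto
  have "expsum t u = fst (snd (\<eta> u))"
    by (rule hom_eq_on_generate[OF group_free_group group_intg expsum_hom heis_snd_hom[OF \<eta>(1)], where S = "gen ` {..<n}"])
      (use u \<eta> in \<open>auto simp: free_group_generate[symmetric]\<close>)
  also have "\<dots> = 0"
    by (rule heis_central[OF \<eta>(1), of "gen i"]) (use i u c \<eta> in auto)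
  finally show ?thesis .
qed

lemma surface_central_sexp:
  assumes "g \<ge> 2" "t < 2*g" and u: "u \<in> carrier (surface_group g)"
    and c: "\<And>x. x \<in> carrier (surface_group g) \<Longrightarrow> u \<otimes>\<^bsub>surface_group g\<^esub> x = x \<otimes>\<^bsub>surface_group g\<^esub> u"
  shows "sexp g t u = 0"
proof -
  \<comment> \<open>A generator from a handle not containing \<open>t\<close>: the two coordinate
    classes then pair to zero, which \<open>surface_heis_hom_exists\<close> needs. This is where two
    handles are required.\<close>
  define i where "i = (if t = 0 \<or> t = g then 1 else (0::nat))"
  have i: "i < 2*g" "i \<noteq> t" "i + g \<noteq> t" "i < g" "t + g \<noteq> i" using assms by (auto simp: i_def)
  have "(\<Sum>j<g. (if j = i then 1 else 0) * (if g + j = t then 1 else 0)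
      - (if g + j = i then 1 else 0) * (if j = t then 1 else (0::int))) = 0"
    using i by (intro sum.neutral) auto
  then obtain \<eta> where \<eta>: "\<eta> \<in> hom (surface_group g) heis"
    "\<And>j. j < 2*g \<Longrightarrow> \<eta> (sgen g j) = (if j = i then 1 else 0, if j = t then 1 else 0, 0)"
    using surface_heis_hom_exists[where g = g and a = "\<lambda>j. if j = i then 1 else 0" and b = "\<lambda>j. if j = t then 1 else 0"]
    by auto
  have "sexp g t u = fst (snd (\<eta> u))"
    by (rule hom_eq_on_generate[OF group_surface_group group_intg sexp_hom heis_snd_hom[OF \<eta>(1)], where S = "sgen g ` {..<2*g}"])
      (use u \<eta> in \<open>auto simp: surface_group_generate[symmetric] sexp_sgen\<close>)
  also have "\<dots> = 0"
    by (rule heis_central[OF \<eta>(1), of "sgen g i"]) (use i u c \<eta> in auto)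
  finally show ?thesis .
qed

section \<open>From automorphisms to outer automorphisms of free groups\<close>

text \<open>\<open>\<phi>\<close> is induced by the free rotation of the circle with \<open>n - 1\<close> loops attached at equidistant
  points; \<open>t\<close> is the circle.\<close>
lemma proj_out_free_group_not_lifting:
  assumes n: "n > 2"
  shows "\<exists>C. fin_cyclic_subgroup (Out (free_group n)) C \<and> \<not> lifts (Aut (free_group n)) (proj_out (free_group n)) C"
proof -
  let ?F = "free_group n"
  interpret F: group "?F" by (rule group_free_group)
  \<comment> \<open>One generator is the circle, leaving \<open>n - 1\<close> loops to rotate. The
    contradiction will be that \<open>m\<close> divides one, hence \<open>n > 2\<close>.\<close>
  define m where "m = n - 1"
  have m: "m \<ge> 2" "m < n" "\<And>i. i < m \<Longrightarrow> i < n" "0 < n" using n by (auto simp: m_def)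
  define t where "t = gen m"
  have t: "t \<in> carrier (?F)" using m by (simp add: t_def)
  \<comment> \<open>The last loop is carried past the base point and returns around the circle,
    which is the conjugation by \<open>t\<close>.\<close>
  define f where "f i = (if i = m then t else if Suc i = m then t \<otimes>\<^bsub>?F\<^esub> gen 0 \<otimes>\<^bsub>?F\<^esub> inv\<^bsub>?F\<^esub> t else gen (Suc i))" for i
  have f: "f i \<in> carrier (?F)" if "i < n" for i
    using that m t by (auto simp: f_def m_def)
  define \<phi> where "\<phi> = ev (?F) f"
  have \<phi>: "\<phi> \<in> hom (?F) (?F)" unfolding \<phi>_def by (rule F.ev_hom[OF f])
  interpret \<phi>: group_hom "?F" "?F" \<phi>
    using \<phi> by (simp add: F.group_homI F.is_group)
  have \<phi>_gen: "\<phi> (gen i) = f i" if "i < n" for i unfolding \<phi>_def using that f by (simp add: F.ev_gen)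
  have \<phi>_t: "\<phi> t = t" using m by (simp add: t_def \<phi>_gen) (simp add: f_def t_def)
  have orbit: "(\<phi> ^^ j) (gen i) = (if i + j < m then gen (i + j) else t \<otimes>\<^bsub>?F\<^esub> gen (i + j - m) \<otimes>\<^bsub>?F\<^esub> inv\<^bsub>?F\<^esub> t)"
    if "i < m" "j \<le> m" for i j
    using that(2)
  proof (induction j)
    case (Suc j)
    have "i + j - m < m" "i + j - m < n" "Suc (i + j - m) < m" if "\<not> i + j < m" using that \<open>i < m\<close> Suc.prems m by auto
    then show ?case using Suc \<open>i < m\<close> t m
      by (auto simp: \<phi>_gen \<phi>_t f_def Suc_diff_le)
  qed (use that in auto)
  have pow: "(\<phi> ^^ m) x = t \<otimes>\<^bsub>?F\<^esub> x \<otimes>\<^bsub>?F\<^esub> inv\<^bsub>?F\<^esub> t" if "x \<in> carrier (?F)" for x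
  proof (rule F.funpow_eq_conjI[OF \<phi> t _ free_group_generate _ that])
    fix s assume "s \<in> gen ` {..<n}"
    then obtain i where i: "i < n" "s = gen i" by auto
    show "(\<phi> ^^ m) s = t \<otimes>\<^bsub>?F\<^esub> s \<otimes>\<^bsub>?F\<^esub> inv\<^bsub>?F\<^esub> t"
    proof (cases "i = m")
      case True
      have "(\<phi> ^^ j) t = t" for j by (induction j) (auto simp: \<phi>_t)
      then show ?thesis using True i t by (simp add: F.m_assoc t_def[symmetric])
    next
      case False
      then have "i < m" using i by (simp add: m_def)
      then show ?thesis using orbit[of i m] i by simp
    qed
  qed auto
  show ?thesis
  proof (rule F.proj_out_not_lifting_expsum[OF \<phi> m(1) t pow expsum_hom[of m n]])
    interpret e: group_hom "?F" intg "expsum m"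
      using expsum_hom group_intg by (simp add: F.group_homI F.is_group)
    show "expsum m (\<phi> x) = expsum m x" if x: "x \<in> carrier (?F)" for x
    proof -
      have h: "(\<lambda>x. expsum m (\<phi> x)) \<in> hom (?F) intg"
        by (rule homI) auto
      show ?thesis
        by (rule hom_eq_on_generate[OF group_free_group group_intg h expsum_hom, where S = "gen ` {..<n}"])
          (use x m t in \<open>auto simp: free_group_generate[symmetric] \<phi>_gen f_def t_def\<close>)
    qed
    show "expsum m t = 1" by (simp add: t_def)
  qed (use m free_central_expsum[of n m] in auto)
qed

section \<open>From automorphisms to outer automorphisms of surface groups\<close>

lemma (in group_hom) hom_comm:
  "a \<in> carrier G \<Longrightarrow> b \<in> carrier G \<Longrightarrow> h (comm G a b) = comm H (h a) (h b)"
  by (simp add: comm_def)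

lemma (in group_hom) hom_lprod:
  "(\<And>i. i \<in> set is \<Longrightarrow> p i \<in> carrier G) \<Longrightarrow> h (lprod G p is) = lprod H (\<lambda>i. h (p i)) is"
  by (induction "is") (auto simp: G.lprod_closed)

lemma lprod_map: "lprod G p (map f is) = lprod G (\<lambda>i. p (f i)) is"
  by (induction "is") auto

lemma (in group) comm_conj:
  assumes "a \<in> carrier G" "b \<in> carrier G" "s \<in> carrier G"
  shows "comm G (s \<otimes> a \<otimes> inv s) (s \<otimes> b \<otimes> inv s) = s \<otimes> comm G a b \<otimes> inv s"
  using assms by (simp add: comm_def m_assoc inv_mult_group)

lemma (in group) inv_comm_eq: "a \<in> carrier G \<Longrightarrow> b \<in> carrier G \<Longrightarrow> inv (comm G a b) = comm G b a"
  by (simp add: comm_def m_assoc inv_mult_group)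

text \<open>\<open>\<phi>\<close> is induced by the free rotation of order \<open>g - 1\<close> of a torus with \<open>g - 1\<close> handles attached.\<close>
lemma proj_out_surface_group_not_lifting_ge3:
  assumes g: "g \<ge> 3"
  shows "\<exists>C. fin_cyclic_subgroup (Out (surface_group g)) C \<and> \<not> lifts (Aut (surface_group g)) (proj_out (surface_group g)) C"
proof -
  define G where "G = surface_group g"
  interpret G: group G unfolding G_def by (rule group_surface_group)
  define m where "m = g - 1"
  have m: "m \<ge> 2" "g = Suc m" using g by (auto simp: m_def)
  define a where "a i = sgen g i" for i
  define b where "b i = sgen g (g + i)" for i
  have ab: "a i \<in> carrier G" "b i \<in> carrier G" if "i \<le> m" for i
    using that m by (auto simp: a_def b_def G_def)
  define t where "t = a m"
  define S where "S = b m"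
  have t: "t \<in> carrier G" and S: "S \<in> carrier G" using ab by (auto simp: t_def S_def)
  define p where "p i = comm G (a i) (b i)" for i
  have p: "p i \<in> carrier G" if "i \<le> m" for i using that ab by (simp add: p_def)
  have lp: "lprod G p [i..<j] \<in> carrier G" if "j \<le> Suc m" for i j
    using that by (intro G.lprod_closed) (auto intro!: p)
  have rel: "lprod G p [0..<m] \<otimes>\<^bsub>G\<^esub> comm G t S = \<one>\<^bsub>G\<^esub>"
  proof -
    have "lprod G p [0..<Suc m] = \<one>\<^bsub>G\<^esub>"
      using surface_relation[of g] m by (simp add: G_def p_def[abs_def] a_def b_def)
    moreover have "lprod G p [0..<Suc m] = lprod G p [0..<m] \<otimes>\<^bsub>G\<^esub> lprod G p [m]"
      unfolding upt_Suc using p by (subst G.lprod_append[symmetric]) auto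
    ultimately show ?thesis using p[of m] by (simp add: p_def t_def S_def)
  qed
  have lprod_snoc: "lprod G p [i..<m] = lprod G p [i..<m - 1] \<otimes>\<^bsub>G\<^esub> p (m - 1)" if "i < m" for i
  proof -
    have "[i..<m] = [i..<m - 1] @ [m - 1]" using that m upt_Suc[of i "m - 1"] by simp
    then have "lprod G p [i..<m] = lprod G p [i..<m - 1] \<otimes>\<^bsub>G\<^esub> lprod G p [m - 1]"
      using p by (simp only:) (rule G.lprod_append, auto intro!: p)
    then show ?thesis using p by simp
  qed
  \<comment> \<open>The handles move down by one place, and the one that passes the cut reappears
    conjugated by the torus generator \<open>S\<close>.\<close>
  define cyc where "cyc x i = (if i = 0 then S \<otimes>\<^bsub>G\<^esub> x (m - 1) \<otimes>\<^bsub>G\<^esub> inv\<^bsub>G\<^esub> S else x (i - 1))" for x :: "nat \<Rightarrow> word set" and i :: nat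
  \<comment> \<open>The factor \<open>p (m - 1)\<close> in the image of \<open>t\<close> compensates
    for moving that handle commutator from the end of the product of handles to its beginning, so
    that the relator survives.\<close>
  define f where "f i = (if i = m then p (m - 1) \<otimes>\<^bsub>G\<^esub> t else if i = g + m then S
    else if i < g then cyc a i else cyc b (i - g))" for i
  have cyc: "cyc a i \<in> carrier G" "cyc b i \<in> carrier G" if "i < m" for i
    using that ab S m by (auto simp: cyc_def)
  have f: "f i \<in> carrier G" if "i < 2*g" for i
    using that cyc[of i] cyc[of "i - g"] p t S m by (auto simp: f_def)
  have comm_cyc: "comm G (cyc a i) (cyc b i) = cyc p i" if "i < m" for i
    using that ab S m by (auto simp: cyc_def p_def G.comm_conj)
  have fcomm: "comm G (f i) (f (g + i)) = (if i = m then comm G (p (m - 1) \<otimes>\<^bsub>G\<^esub> t) S else cyc p i)" if "i \<le> m" for i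
    using that m comm_cyc[of i] by (auto simp: f_def)
  have frel: "lprod G (\<lambda>i. comm G (f i) (f (g + i))) [0..<g] = \<one>\<^bsub>G\<^esub>"
  proof -
    define Q where "Q = lprod G p [0..<m - 1]"
    define P where "P = p (m - 1)"
    have QP: "Q \<in> carrier G" "P \<in> carrier G" using lp[of "m - 1" 0] p[of "m - 1"] m by (auto simp: Q_def P_def)
    have upt: "[0..<g] = 0 # map Suc [0..<m - 1] @ [m]"
      using m by (simp add: map_Suc_upt upt_conv_Cons upt_Suc)
    have "lprod G (\<lambda>i. comm G (f i) (f (g + i))) [0..<g] =
        comm G (f 0) (f (g + 0)) \<otimes>\<^bsub>G\<^esub> lprod G (\<lambda>i. comm G (f i) (f (g + i))) (map Suc [0..<m - 1] @ [m])"
      unfolding upt by simp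
    also have "lprod G (\<lambda>i. comm G (f i) (f (g + i))) (map Suc [0..<m - 1] @ [m]) =
        lprod G (\<lambda>i. comm G (f i) (f (g + i))) (map Suc [0..<m - 1]) \<otimes>\<^bsub>G\<^esub> lprod G (\<lambda>i. comm G (f i) (f (g + i))) [m]"
      using m f by (intro G.lprod_append) auto
    also have "lprod G (\<lambda>i. comm G (f i) (f (g + i))) (map Suc [0..<m - 1]) = Q"
      unfolding lprod_map Q_def by (rule lprod_cong) (subst fcomm, auto simp: cyc_def)
    also have "lprod G (\<lambda>i. comm G (f i) (f (g + i))) [m] = comm G (P \<otimes>\<^bsub>G\<^esub> t) S"
      using QP t S fcomm[of m] by (simp add: P_def)
    also have "comm G (f 0) (f (g + 0)) = S \<otimes>\<^bsub>G\<^esub> P \<otimes>\<^bsub>G\<^esub> inv\<^bsub>G\<^esub> S"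
      using m fcomm[of 0] by (simp add: cyc_def P_def)
    finally have 1: "lprod G (\<lambda>i. comm G (f i) (f (g + i))) [0..<g] =
      S \<otimes>\<^bsub>G\<^esub> P \<otimes>\<^bsub>G\<^esub> inv\<^bsub>G\<^esub> S \<otimes>\<^bsub>G\<^esub> (Q \<otimes>\<^bsub>G\<^esub> comm G (P \<otimes>\<^bsub>G\<^esub> t) S)" .
    have "Q \<otimes>\<^bsub>G\<^esub> P \<otimes>\<^bsub>G\<^esub> comm G t S = \<one>\<^bsub>G\<^esub>" using rel lprod_snoc[of 0] m by (simp add: Q_def P_def)
    then have "Q = inv\<^bsub>G\<^esub> (P \<otimes>\<^bsub>G\<^esub> comm G t S)"
      using QP t S G.inv_equality[of Q "P \<otimes>\<^bsub>G\<^esub> comm G t S"] by (simp add: G.m_assoc)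
    then show ?thesis unfolding 1 using QP t S
      by (simp add: comm_def G.m_assoc G.inv_mult_group)
  qed
  obtain \<phi> where \<phi>: "\<phi> \<in> hom G G" and \<phi>_gen: "\<And>i. i < 2*g \<Longrightarrow> \<phi> (sgen g i) = f i"
    using surface_hom_exists[OF G.is_group f frel] unfolding G_def by blast
  interpret \<phi>: group_hom G G \<phi> using \<phi> by (simp add: G.group_homI G.is_group)
  have \<phi>_a: "\<phi> (a i) = cyc a i" and \<phi>_b: "\<phi> (b i) = cyc b i" if "i < m" for i
    using that m \<phi>_gen[of i] \<phi>_gen[of "g + i"] by (auto simp: a_def b_def f_def)
  have \<phi>_t: "\<phi> t = p (m - 1) \<otimes>\<^bsub>G\<^esub> t" and \<phi>_S: "\<phi> S = S"
    using m \<phi>_gen[of m] \<phi>_gen[of "g + m"] by (auto simp: t_def S_def a_def b_def f_def)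
  have \<phi>_p: "\<phi> (p i) = cyc p i" if "i < m" for i
    using that ab \<phi>_a \<phi>_b comm_cyc by (simp add: p_def \<phi>.hom_comm)
  have \<phi>_S_pow: "(\<phi> ^^ j) S = S" for j by (induction j) (auto simp: \<phi>_S)
  have orbit: "(\<phi> ^^ j) (x i) = (if j \<le> i then x (i - j) else S \<otimes>\<^bsub>G\<^esub> x (i + m - j) \<otimes>\<^bsub>G\<^esub> inv\<^bsub>G\<^esub> S)"
    if "i < m" "j \<le> m" and x: "\<And>i. i < m \<Longrightarrow> x i \<in> carrier G \<and> \<phi> (x i) = cyc x i" for i j x
    using that(2)
  proof (induction j)
    case (Suc j)
    have 1: "i + m - j < m" "i + m - j - 1 = i + m - Suc j" "i + m - j \<noteq> 0" if "\<not> j \<le> i" using that \<open>i < m\<close> Suc.prems by auto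
    show ?case
    proof (cases "j \<le> i")
      case True
      have "i - j - 1 = i - Suc j" by simp
      then show ?thesis using Suc True \<open>i < m\<close> x[of "i - j"]
        by (auto simp: cyc_def not_less_eq_eq)
    next
      case False
      then show ?thesis using Suc \<open>i < m\<close> x[of "i + m - j"] 1[OF False] S
        by (simp add: cyc_def \<phi>_S)
    qed
  qed simp
  \<comment> \<open>At each step \<open>t\<close> collects one more handle commutator. After
    \<open>m\<close> steps the surface relation turns the whole product into
    \<open>inv (comm G t S)\<close>, so that \<open>t\<close> too ends up conjugated by
    \<open>S\<close>.\<close>
  have orbit_t: "(\<phi> ^^ j) t = lprod G p [m - j..<m] \<otimes>\<^bsub>G\<^esub> t" if "j \<le> m" for j
    using that
  proof (induction j)
    case 0
    then show ?case using t by simp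
  next
    case (Suc j)
    have cl: "p i \<in> carrier G" if "i \<in> set [m - j..<m]" for i using that p by auto
    have "\<phi> (lprod G p [m - j..<m]) = lprod G (\<lambda>i. \<phi> (p i)) (map Suc [m - Suc j..<m - 1])"
      using \<phi>.hom_lprod[of "[m - j..<m]" p] cl Suc.prems m by (simp add: map_Suc_upt Suc_diff_Suc)
    also have "\<dots> = lprod G p [m - Suc j..<m - 1]"
      unfolding lprod_map by (rule lprod_cong) (auto simp: \<phi>_p cyc_def)
    finally show ?case
      using Suc t p lp[of m "m - j"] lp[of "m - 1" "m - Suc j"] lprod_snoc[of "m - Suc j"] m
      by (simp add: \<phi>_t G.m_assoc)
  qed
  have gens: "sgen g ` {..<2*g} \<subseteq> carrier G" "carrier G = generate G (sgen g ` {..<2*g})"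
    unfolding G_def using sgen_closed surface_group_generate by blast+
  have pow: "(\<phi> ^^ m) x = S \<otimes>\<^bsub>G\<^esub> x \<otimes>\<^bsub>G\<^esub> inv\<^bsub>G\<^esub> S" if "x \<in> carrier G" for x
  proof (rule G.funpow_eq_conjI[OF \<phi> S gens _ that])
    fix s assume "s \<in> sgen g ` {..<2*g}"
    then obtain i where i: "i < 2*g" "s = sgen g i" by auto
    consider "i < m" | "i = m" | "g \<le> i" "i - g < m" | "i = g + m" using i m by linarith
    then show "(\<phi> ^^ m) s = S \<otimes>\<^bsub>G\<^esub> s \<otimes>\<^bsub>G\<^esub> inv\<^bsub>G\<^esub> S"
    proof cases
      case 1
      then show ?thesis using orbit[of i m a] i ab \<phi>_a by (simp add: a_def)
    next
      case 2
      have "lprod G p [0..<m] = inv\<^bsub>G\<^esub> (comm G t S)"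
        using rel t S lp[of m 0] G.inv_equality[of "lprod G p [0..<m]" "comm G t S"] by simp
      then show ?thesis using 2 orbit_t[of m] i t S
        by (simp add: t_def[unfolded a_def, symmetric] G.inv_comm_eq) (simp add: comm_def G.m_assoc)
    next
      case 3
      then show ?thesis using orbit[of "i - g" m b] i ab \<phi>_b by (simp add: b_def)
    next
      case 4
      then show ?thesis using i S \<phi>_S_pow[of m] by (simp add: S_def[unfolded b_def, symmetric] G.m_assoc)
    qed
  qed
  have e: "sexp g (g + m) \<in> hom G intg" unfolding G_def by (rule sexp_hom)
  interpret e: group_hom G intg "sexp g (g + m)"
    using e group_intg by (simp add: G.group_homI G.is_group)
  have "\<exists>C. fin_cyclic_subgroup (Out G) C \<and> \<not> lifts (Aut G) (proj_out G) C"
  proof (rule G.proj_out_not_lifting_expsum[OF \<phi> m(1) S pow e])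
    show "sexp g (g + m) (\<phi> x) = sexp g (g + m) x" if x: "x \<in> carrier G" for x
    proof -
      have h: "(\<lambda>x. sexp g (g + m) (\<phi> x)) \<in> hom G intg"
        by (rule homI) auto
      have e_ab: "sexp g (g + m) (a i) = 0" "sexp g (g + m) (b i) = (if i = m then 1 else 0)" if "i \<le> m" for i
        using that m by (auto simp: a_def b_def sexp_sgen)
      have e_cyc: "sexp g (g + m) (cyc a i) = 0" "sexp g (g + m) (cyc b i) = 0" if "i < m" for i
        using that m(1) ab S e_ab by (auto simp: cyc_def)
      have e_p: "sexp g (g + m) (p (m - 1)) = 0"
        using ab by (simp add: p_def e.hom_comm) (simp add: comm_def)
      have "sexp g (g + m) (f i) = sexp g (g + m) (sgen g i)" if i: "i < 2*g" for i
      proof -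
        consider "i < m" | "i = m" | "g \<le> i" "i - g < m" | "i = g + m" using i m by linarith
        then show ?thesis
          by cases (use m(1) i e_cyc[of i] e_cyc[of "i - g"] e_p e_ab[of m] p[of "m - 1"] t in
            \<open>auto simp: f_def sexp_sgen t_def S_def\<close>)
      qed
      then have "sexp g (g + m) (\<phi> s) = sexp g (g + m) s" if "s \<in> sgen g ` {..<2*g}" for s
        using that \<phi>_gen by auto
      then show ?thesis
        by (rule hom_eq_on_generate[OF G.is_group group_intg h e gens(1)])
          (simp_all only: gens(2)[symmetric] x)
    qed
    show "sexp g (g + m) S = 1" using m by (simp add: S_def b_def sexp_sgen)
    show "sexp g (g + m) u = 0" if "u \<in> carrier G" "\<And>x. x \<in> carrier G \<Longrightarrow> u \<otimes>\<^bsub>G\<^esub> x = x \<otimes>\<^bsub>G\<^esub> u" for u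
      using surface_central_sexp[of g "g + m" u] that g m by (simp add: G_def)
  qed
  then show ?thesis by (simp add: G_def)
qed

text \<open>The map sending \<open>(a, b, c)\<close> to \<open>(b + 2 * c, odd a)\<close> is a
  homomorphism from \<open>heis\<close> onto the dihedral group of order eight, that is,
  \<open>dinf\<close> with translations taken modulo 4. Two homomorphisms matching under it on
  generators match everywhere; this transfers information about the parity of the corner entry to
  \<open>dinf\<close>.\<close>

lemma heis_dinf_parity:
  assumes G: "group G" "carrier G = generate G S" "S \<subseteq> carrier G"
    and \<eta>: "\<eta> \<in> hom G heis" and \<theta>: "\<theta> \<in> hom G dinf"
    and S: "\<And>s. s \<in> S \<Longrightarrow> \<theta> s = (fst (snd (\<eta> s)) + 2 * snd (snd (\<eta> s)), odd (fst (\<eta> s)))"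
    and x: "x \<in> carrier G"
  shows "snd (\<theta> x) \<longleftrightarrow> odd (fst (\<eta> x))"
    and "4 dvd fst (\<theta> x) - fst (snd (\<eta> x)) - 2 * snd (snd (\<eta> x))"
proof -
  interpret G: group G by fact
  interpret \<eta>: group_hom G heis \<eta> using \<eta> G group_heis by (simp add: group_hom_def group_hom_axioms_def)
  interpret \<theta>: group_hom G dinf \<theta> using \<theta> G group_dinf by (simp add: group_hom_def group_hom_axioms_def)
  define P where "P x \<longleftrightarrow> (snd (\<theta> x) \<longleftrightarrow> odd (fst (\<eta> x))) \<and>
    4 dvd fst (\<theta> x) - fst (snd (\<eta> x)) - 2 * snd (snd (\<eta> x))" for x
  have inv_closed: "P (inv\<^bsub>G\<^esub> y)" if "y \<in> carrier G" "P y" for y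
  proof -
    obtain a b c p s where y: "\<eta> y = (a, b, c)" "\<theta> y = (p, s)" by (metis prod_cases3 surj_pair)
    then have ps: "s = odd a" "4 dvd p - b - 2 * c" using that(2) by (auto simp: P_def)
    show ?thesis
    proof (cases "odd a")
      case True
      then obtain a' where "a = 2 * a' + 1" by (metis oddE)
      then have "p - (- b) - 2 * (a * b - c) = (p - b - 2 * c) + 4 * (c - a' * b)" by (simp add: algebra_simps)
      then have "4 dvd p - (- b) - 2 * (a * b - c)" using ps(2) by (metis dvd_add dvd_triv_left)
      then show ?thesis using True y ps that(1) by (simp add: P_def)
    next
      case False
      then obtain a' where "a = 2 * a'" by auto
      then have "- p - (- b) - 2 * (a * b - c) = - (p - b - 2 * c) + 4 * (- a' * b)" by (simp add: algebra_simps)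
      then have "4 dvd - p - (- b) - 2 * (a * b - c)" using ps(2) by (metis dvd_add dvd_triv_left dvd_minus_iff)
      then show ?thesis using False y ps that(1) by (simp add: P_def)
    qed
  qed
  have mult: "P (y \<otimes>\<^bsub>G\<^esub> z)" if "y \<in> carrier G" "P y" "z \<in> carrier G" "P z" for y z
  proof -
    obtain a b c p s where y: "\<eta> y = (a, b, c)" "\<theta> y = (p, s)" by (metis prod_cases3 surj_pair)
    then have ps: "s = odd a" "4 dvd p - b - 2 * c" using that(2) by (auto simp: P_def)
    obtain a' b' c' p' s' where z: "\<eta> z = (a', b', c')" "\<theta> z = (p', s')" by (metis prod_cases3 surj_pair)
    then have ps': "s' = odd a'" "4 dvd p' - b' - 2 * c'" using that(4) by (auto simp: P_def)
    show ?thesis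
    proof (cases "odd a")
      case True
      then obtain d where "a = 2 * d + 1" by (metis oddE)
      then have "p - p' - (b + b') - 2 * (c + c' + a * b') = (p - b - 2 * c) - (p' - b' - 2 * c') + 4 * (- b' - c' - d * b')"
        by (simp add: algebra_simps)
      then have "4 dvd p - p' - (b + b') - 2 * (c + c' + a * b')" using ps(2) ps'(2) by (metis dvd_add dvd_diff dvd_triv_left)
      then show ?thesis using True y z ps ps' that(1,3) by (simp add: P_def)
    next
      case False
      then obtain d where "a = 2 * d" by auto
      then have "p + p' - (b + b') - 2 * (c + c' + a * b') = (p - b - 2 * c) + (p' - b' - 2 * c') + 4 * (- d * b')"
        by (simp add: algebra_simps)
      then have "4 dvd p + p' - (b + b') - 2 * (c + c' + a * b')" using ps(2) ps'(2) by (metis dvd_add dvd_triv_left)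
      then show ?thesis using False y z ps ps' that(1,3) by (simp add: P_def)
    qed
  qed
  have "x \<in> generate G S" using x G(2) by simp
  then have "P x"
  proof (induction rule: generate.induct)
    case one
    then show ?case by (simp add: P_def)
  next
    case (incl h)
    then show ?case using S by (simp add: P_def)
  next
    case (inv h)
    then show ?case using S G(3) by (intro inv_closed) (auto simp: P_def)
  next
    case (eng h1 h2)
    then show ?case using G.generate_in_carrier[OF G(3)] by (intro mult) auto
  qed
  then show "snd (\<theta> x) \<longleftrightarrow> odd (fst (\<eta> x))"
    and "4 dvd fst (\<theta> x) - fst (snd (\<eta> x)) - 2 * snd (snd (\<eta> x))" by (auto simp: P_def)
qed

text \<open>\<open>\<phi>\<close> is induced by an orientation-reversing free involution of the genus two surface.\<close>
lemma proj_out_surface_group_2_not_lifting: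
  "\<exists>C. fin_cyclic_subgroup (Out (surface_group 2)) C \<and> \<not> lifts (Aut (surface_group 2)) (proj_out (surface_group 2)) C"
proof -
  define G where "G = surface_group 2"
  interpret G: group G unfolding G_def by (rule group_surface_group)
  define a0 a1 b0 b1 where "a0 = sgen 2 0" "a1 = sgen 2 1" "b0 = sgen 2 2" "b1 = sgen 2 3"
  note gens = a0_a1_b0_b1_def
  have cl [simp]: "a0 \<in> carrier G" "a1 \<in> carrier G" "b0 \<in> carrier G" "b1 \<in> carrier G"
    by (auto simp: gens G_def)
  define P where "P = comm G a0 b0"
  have P [simp]: "P \<in> carrier G" by (simp add: P_def)
  have upt2: "[0..<2] = [0, 1::nat]" by (simp add: upt_rec)
  have less4: "i < 4 \<longleftrightarrow> i = 0 \<or> i = 1 \<or> i = 2 \<or> i = 3" for i :: nat by auto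
  have rel: "P \<otimes>\<^bsub>G\<^esub> comm G a1 b1 = \<one>\<^bsub>G\<^esub>"
  proof -
    have "P \<otimes>\<^bsub>G\<^esub> (comm G a1 b1 \<otimes>\<^bsub>G\<^esub> \<one>\<^bsub>G\<^esub>) = \<one>\<^bsub>G\<^esub>"
      using surface_relation[of 2] by (simp add: upt2 gens G_def P_def numeral_3_eq_3 numeral_2_eq_2)
    then show ?thesis by simp
  qed
  have P': "comm G b1 a1 = P"
    using rel G.inv_equality[of P "comm G a1 b1"] by (simp add: G.inv_comm_eq)
  \<comment> \<open>Exchanging the handles while swapping \<open>a\<close> with \<open>b\<close>
    reverses the orientation and fixes \<open>P\<close>. Conjugating by \<open>P\<close> on the way
    back preserves the relator and makes the square conjugation by \<open>P\<close>.\<close>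
  define f where "f i = (if i = 0 then b1 else if i = 2 then a1
    else if i = 1 then P \<otimes>\<^bsub>G\<^esub> b0 \<otimes>\<^bsub>G\<^esub> inv\<^bsub>G\<^esub> P else P \<otimes>\<^bsub>G\<^esub> a0 \<otimes>\<^bsub>G\<^esub> inv\<^bsub>G\<^esub> P)" for i :: nat
  have f: "f i \<in> carrier G" for i by (simp add: f_def)
  have "comm G b0 a0 = inv\<^bsub>G\<^esub> P" by (simp add: P_def G.inv_comm_eq)
  then have "lprod G (\<lambda>i. comm G (f i) (f (2 + i))) [0..<2] = \<one>\<^bsub>G\<^esub>"
    by (simp add: upt2 f_def G.comm_conj P')
  then obtain \<phi> where \<phi>: "\<phi> \<in> hom G G" and "\<And>i. i < 4 \<Longrightarrow> \<phi> (sgen 2 i) = f i"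
    using surface_hom_exists[OF G.is_group, of 2 f] f unfolding G_def by auto
  then have \<phi>_gen: "\<phi> a0 = b1" "\<phi> b0 = a1" "\<phi> a1 = P \<otimes>\<^bsub>G\<^esub> b0 \<otimes>\<^bsub>G\<^esub> inv\<^bsub>G\<^esub> P" "\<phi> b1 = P \<otimes>\<^bsub>G\<^esub> a0 \<otimes>\<^bsub>G\<^esub> inv\<^bsub>G\<^esub> P"
    by (auto simp: gens f_def)
  interpret \<phi>: group_hom G G \<phi> using \<phi> by (simp add: G.group_homI G.is_group)
  have \<phi>_P: "\<phi> P = P" unfolding P_def by (simp add: \<phi>.hom_comm \<phi>_gen) (simp add: P' P_def[symmetric])
  have S: "sgen 2 ` {..<2*2} = {a0, a1, b0, b1}"
    by (auto simp: gens less4 image_def)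
  have gen: "carrier G = generate G {a0, a1, b0, b1}"
    using surface_group_generate[of 2] S by (simp add: G_def)
  have pow: "(\<phi> ^^ 2) x = P \<otimes>\<^bsub>G\<^esub> x \<otimes>\<^bsub>G\<^esub> inv\<^bsub>G\<^esub> P" if "x \<in> carrier G" for x
    by (rule G.funpow_eq_conjI[OF \<phi> P _ gen _ that]) (auto simp: \<phi>_gen \<phi>_P numeral_2_eq_2)
  \<comment> \<open>The values are constant on the \<open>\<phi>\<close>-orbits of generators up to
    conjugacy, so \<open>\<eta>\<close> is \<open>\<phi>\<close>-invariant, and the two handles
    contribute opposite commutators. As \<open>\<eta> P\<close> is the generator of the centre,
    \<open>u\<close> below gets the corner entry \<open>2 * c + a * b + 1\<close>.\<close>
  obtain \<eta> where \<eta>: "\<eta> \<in> hom G heis" and "\<And>i. i < 4 \<Longrightarrow> \<eta> (sgen 2 i) = (of_bool (i = 0 \<or> i = 3), of_bool (i = 1 \<or> i = 2), 0)"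
    using surface_heis_hom_exists[where g = 2 and a = "\<lambda>i. of_bool (i = 0 \<or> i = 3)" and b = "\<lambda>i. of_bool (i = 1 \<or> i = 2)"]
    by (auto simp: G_def lessThan_nat_numeral lessThan_Suc)
  then have \<eta>_gen: "\<eta> a0 = (1, 0, 0)" "\<eta> b1 = (1, 0, 0)" "\<eta> a1 = (0, 1, 0)" "\<eta> b0 = (0, 1, 0)"
    by (auto simp: gens)
  interpret \<eta>: group_hom G heis \<eta> using \<eta> G.is_group group_heis by (simp add: group_hom_def group_hom_axioms_def)
  have \<eta>_P: "\<eta> P = (0, 0, 1)" by (simp add: P_def \<eta>.hom_comm \<eta>_gen)
  have \<eta>_\<phi>: "\<eta> (\<phi> x) = \<eta> x" if "x \<in> carrier G" for x
  proof -
    have h: "(\<lambda>x. \<eta> (\<phi> x)) \<in> hom G heis" by (rule homI) auto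
    show ?thesis
      by (rule hom_eq_on_generate[OF G.is_group group_heis h \<eta>, where S = "{a0, a1, b0, b1}"])
        (use that in \<open>auto simp: gen[symmetric] \<phi>_gen \<eta>_P \<eta>_gen\<close>)
  qed
  \<comment> \<open>Matches \<open>\<eta>\<close> on generators in the sense of
    \<open>heis_dinf_parity\<close>. In \<open>dinf\<close> a translation commuting with a
    reflection is trivial, so a central element cannot have an odd corner entry.\<close>
  define f' where "f' i = (if i = 0 \<or> i = 3 then (0, True) else (1::int, False))" for i :: nat
  have "lprod dinf (\<lambda>i. comm dinf (f' i) (f' (2 + i))) [0..<2] = \<one>\<^bsub>dinf\<^esub>"
    by (simp add: upt2 f'_def)
  then obtain \<theta> where \<theta>: "\<theta> \<in> hom G dinf" and "\<And>i. i < 4 \<Longrightarrow> \<theta> (sgen 2 i) = f' i"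
    using surface_hom_exists[OF group_dinf, of 2 f'] unfolding G_def by auto
  then have \<theta>_gen: "\<theta> a0 = (0, True)" "\<theta> b1 = (0, True)" "\<theta> a1 = (1, False)" "\<theta> b0 = (1, False)"
    by (auto simp: gens f'_def)
  interpret \<theta>: group_hom G dinf \<theta> using \<theta> G.is_group group_dinf by (simp add: group_hom_def group_hom_axioms_def)
  have "\<exists>C. fin_cyclic_subgroup (Out G) C \<and> \<not> lifts (Aut G) (proj_out G) C"
  proof (rule G.proj_out_not_lifting'[OF \<phi> _ P pow])
    fix k assume k: "k \<in> carrier G"
    show "\<not> (\<forall>x\<in>carrier G. ((\<lambda>y. k \<otimes>\<^bsub>G\<^esub> \<phi> y \<otimes>\<^bsub>G\<^esub> inv\<^bsub>G\<^esub> k) ^^ 2) x = x)"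
    proof
      assume *: "\<forall>x\<in>carrier G. ((\<lambda>y. k \<otimes>\<^bsub>G\<^esub> \<phi> y \<otimes>\<^bsub>G\<^esub> inv\<^bsub>G\<^esub> k) ^^ 2) x = x"
      define u where "u = k \<otimes>\<^bsub>G\<^esub> \<phi> k \<otimes>\<^bsub>G\<^esub> P"
      have u: "u \<in> carrier G" using k by (simp add: u_def)
      have central: "u \<otimes>\<^bsub>G\<^esub> x = x \<otimes>\<^bsub>G\<^esub> u" if x: "x \<in> carrier G" for x
      proof -
        have "\<phi> (\<phi> x) = P \<otimes>\<^bsub>G\<^esub> x \<otimes>\<^bsub>G\<^esub> inv\<^bsub>G\<^esub> P" using pow[OF x] by (simp add: numeral_2_eq_2)
        then have "x = u \<otimes>\<^bsub>G\<^esub> x \<otimes>\<^bsub>G\<^esub> inv\<^bsub>G\<^esub> u"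
          using bspec[OF *, OF x] k x by (simp add: numeral_2_eq_2 u_def G.m_assoc G.inv_mult_group)
        then show ?thesis using x u G.inv_solve_right[of x "u \<otimes>\<^bsub>G\<^esub> x" u] by simp
      qed
      obtain a b c where abc: "\<eta> k = (a, b, c)" by (metis prod_cases3)
      then have \<eta>_u: "\<eta> u = (2 * a, 2 * b, 2 * c + a * b + 1)"
        using k by (simp add: u_def \<eta>_\<phi> \<eta>_P)
      have "\<eta> u \<otimes>\<^bsub>heis\<^esub> \<eta> a0 = \<eta> a0 \<otimes>\<^bsub>heis\<^esub> \<eta> u" "\<eta> u \<otimes>\<^bsub>heis\<^esub> \<eta> b0 = \<eta> b0 \<otimes>\<^bsub>heis\<^esub> \<eta> u"
        using central[of a0] central[of b0] u by (metis \<eta>.hom_mult cl)+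
      then have ab: "a = 0" "b = 0" by (auto simp: \<eta>_u \<eta>_gen)
      note par = heis_dinf_parity[OF G.is_group gen _ \<eta> \<theta> _ u]
      have "snd (\<theta> u) \<longleftrightarrow> odd (fst (\<eta> u))"
        and 4: "4 dvd fst (\<theta> u) - fst (snd (\<eta> u)) - 2 * snd (snd (\<eta> u))"
        by (rule par, auto simp: \<eta>_gen \<theta>_gen)+
      then have "\<not> snd (\<theta> u)" using ab by (simp add: \<eta>_u)
      moreover have "\<theta> u \<otimes>\<^bsub>dinf\<^esub> \<theta> a0 = \<theta> a0 \<otimes>\<^bsub>dinf\<^esub> \<theta> u"
        using central[of a0] u by (metis \<theta>.hom_mult cl(1))
      ultimately have "fst (\<theta> u) = 0" by (cases "\<theta> u") (auto simp: \<theta>_gen)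
      then show False using 4 ab by (simp add: \<eta>_u) presburger
    qed
  qed simp
  then show ?thesis by (simp add: G_def)
qed

lemma proj_out_surface_group_not_lifting:
  assumes "g \<ge> 2"
  shows "\<exists>C. fin_cyclic_subgroup (Out (surface_group g)) C \<and> \<not> lifts (Aut (surface_group g)) (proj_out (surface_group g)) C"
proof (cases "g = 2")
  case True
  then show ?thesis using proj_out_surface_group_2_not_lifting by simp
next
  case False
  then show ?thesis using assms proj_out_surface_group_not_lifting_ge3[of g] by simp
qed

section \<open>Automorphisms of groups of nilpotency class two\<close>

text \<open>In class two commutators are bimultiplicative and depend only on the classes of their
  arguments in the abelianization, so computations in \<open>D\<close> reduce to bilinear
  algebra.\<close>

locale class2_group = group +
  fixes D
  defines "D \<equiv> derived G (carrier G)"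
  assumes central: "l \<in> derived G (carrier G) \<Longrightarrow> a \<in> carrier G \<Longrightarrow> a \<otimes> l = l \<otimes> a"
begin

lemma generate_derived_set: "generate G (derived_set G (carrier G)) = D"
  by (simp only: D_def derived_def)

lemma subgroup_D: "subgroup D G"
  unfolding D_def by (rule derived_is_subgroup) simp

lemma D_closed [simp]: "l \<in> D \<Longrightarrow> l \<in> carrier G"
  using subgroup_D subgroup.subset by blast

lemma D_mult [simp]: "l \<in> D \<Longrightarrow> l' \<in> D \<Longrightarrow> l \<otimes> l' \<in> D"
  using subgroup_D by (simp add: subgroup.m_closed)

lemma D_inv [simp]: "l \<in> D \<Longrightarrow> inv l \<in> D"
  using subgroup_D by (simp add: subgroup.m_inv_closed)

lemma D_one [simp]: "\<one> \<in> D"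
  using subgroup_D by (simp add: subgroup.one_closed)

lemma comm_in_D [simp]: "a \<in> carrier G \<Longrightarrow> b \<in> carrier G \<Longrightarrow> comm G a b \<in> D"
  unfolding D_def derived_def comm_def by (rule generate.incl) auto

lemma D_central: "l \<in> D \<Longrightarrow> a \<in> carrier G \<Longrightarrow> a \<otimes> l = l \<otimes> a"
  unfolding D_def by (rule central)

lemma D_lcomm: "l \<in> D \<Longrightarrow> a \<in> carrier G \<Longrightarrow> b \<in> carrier G \<Longrightarrow> a \<otimes> (l \<otimes> b) = l \<otimes> (a \<otimes> b)"
  by (metis D_central D_closed m_assoc)

text \<open>Restricting both arguments to \<open>D\<close> makes the two previous laws usable as ordered rewrite rules.\<close>
lemma D_ac:
  "l \<in> D \<Longrightarrow> l' \<in> D \<Longrightarrow> l \<otimes> l' = l' \<otimes> l"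
  "l \<in> D \<Longrightarrow> l' \<in> D \<Longrightarrow> b \<in> carrier G \<Longrightarrow> l \<otimes> (l' \<otimes> b) = l' \<otimes> (l \<otimes> b)"
  by (simp_all add: D_central D_lcomm)

lemma comm_mult_left:
  assumes "a \<in> carrier G" "b \<in> carrier G" "c \<in> carrier G"
  shows "comm G (a \<otimes> b) c = comm G a c \<otimes> comm G b c"
proof -
  have "comm G (a \<otimes> b) c = a \<otimes> (comm G b c \<otimes> (c \<otimes> inv a \<otimes> inv c))"
    using assms by (simp add: comm_def m_assoc inv_mult_group)
  also have "\<dots> = comm G b c \<otimes> (a \<otimes> (c \<otimes> inv a \<otimes> inv c))"
    using assms by (intro D_lcomm) auto
  also have "a \<otimes> (c \<otimes> inv a \<otimes> inv c) = comm G a c"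
    using assms by (simp add: comm_def m_assoc)
  finally show ?thesis using assms by (simp add: D_ac)
qed

lemma comm_mult_right:
  assumes "a \<in> carrier G" "b \<in> carrier G" "c \<in> carrier G"
  shows "comm G c (a \<otimes> b) = comm G c a \<otimes> comm G c b"
proof -
  have "comm G c (a \<otimes> b) = inv (comm G (a \<otimes> b) c)" using assms by (simp add: inv_comm_eq)
  then show ?thesis using assms by (simp add: comm_mult_left inv_mult_group inv_comm_eq D_ac)
qed

lemma comm_one [simp]: "a \<in> carrier G \<Longrightarrow> comm G a \<one> = \<one>" "a \<in> carrier G \<Longrightarrow> comm G \<one> a = \<one>"
  by (simp_all add: comm_def)

lemma comm_self [simp]: "a \<in> carrier G \<Longrightarrow> comm G a a = \<one>"
  by (simp add: comm_def m_assoc)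

lemma comm_inv_left: "a \<in> carrier G \<Longrightarrow> b \<in> carrier G \<Longrightarrow> comm G (inv a) b = inv (comm G a b)"
  using comm_mult_left[of "inv a" a b] inv_equality[of "comm G (inv a) b" "comm G a b"] by simp

lemma comm_inv_right: "a \<in> carrier G \<Longrightarrow> b \<in> carrier G \<Longrightarrow> comm G a (inv b) = inv (comm G a b)"
  using comm_mult_right[of "inv b" b a] inv_equality[of "comm G a (inv b)" "comm G a b"] by simp

lemma comm_D_left: "l \<in> D \<Longrightarrow> b \<in> carrier G \<Longrightarrow> comm G l b = \<one>"
  using D_central[of l b] by (simp add: comm_def m_assoc[symmetric])
     (metis D_closed m_assoc r_inv inv_closed r_one)

lemma comm_D_right: "l \<in> D \<Longrightarrow> b \<in> carrier G \<Longrightarrow> comm G b l = \<one>"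
  using comm_D_left[of l b] inv_comm_eq[of l b] by simp

text \<open>Equality in the abelianization. Membership in the carrier is built in so that chains by
  \<open>cg_trans\<close> carry it along.\<close>

definition cg :: "'a \<Rightarrow> 'a \<Rightarrow> bool" where
  "cg a b \<longleftrightarrow> a \<in> carrier G \<and> b \<in> carrier G \<and> (\<exists>d\<in>D. a = b \<otimes> d)"

lemma cg_refl [simp]: "a \<in> carrier G \<Longrightarrow> cg a a"
  unfolding cg_def by (auto intro!: bexI[of _ \<one>])

lemma cg_D: "b \<in> carrier G \<Longrightarrow> d \<in> D \<Longrightarrow> cg (b \<otimes> d) b"
  by (auto simp: cg_def)

lemma cg_sym: "cg a b \<Longrightarrow> cg b a"
proof -
  assume "cg a b"
  then obtain d where "a \<in> carrier G" "b \<in> carrier G" "d \<in> D" "a = b \<otimes> d" by (auto simp: cg_def)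
  then have "b = a \<otimes> inv d" by (simp add: m_assoc)
  then show ?thesis using \<open>a \<in> _\<close> \<open>b \<in> _\<close> \<open>d \<in> D\<close> by (auto simp: cg_def)
qed

lemma cg_trans [trans]: "cg a b \<Longrightarrow> cg b c \<Longrightarrow> cg a c"
  by (auto simp: cg_def m_assoc)

lemma cg_mult: "cg a b \<Longrightarrow> cg a' b' \<Longrightarrow> cg (a \<otimes> a') (b \<otimes> b')"
proof -
  assume "cg a b" "cg a' b'"
  then obtain d d' where d: "a \<in> carrier G" "b \<in> carrier G" "d \<in> D" "a = b \<otimes> d"
    "a' \<in> carrier G" "b' \<in> carrier G" "d' \<in> D" "a' = b' \<otimes> d'" by (auto simp: cg_def)
  then have "a \<otimes> a' = b \<otimes> b' \<otimes> (d \<otimes> d')" using D_lcomm[of d b' d'] by (simp add: m_assoc)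
  then show ?thesis using d by (auto simp: cg_def)
qed

lemma cg_inv: "cg a b \<Longrightarrow> cg (inv a) (inv b)"
proof -
  assume "cg a b"
  then obtain d where d: "a \<in> carrier G" "b \<in> carrier G" "d \<in> D" "a = b \<otimes> d" by (auto simp: cg_def)
  then have "inv a = inv b \<otimes> inv d" using D_central[of "inv d" "inv b"] by (simp add: inv_mult_group)
  then show ?thesis using d by (auto simp: cg_def)
qed

lemma cg_commute: "a \<in> carrier G \<Longrightarrow> b \<in> carrier G \<Longrightarrow> cg (a \<otimes> b) (b \<otimes> a)"
proof -
  assume ab: "a \<in> carrier G" "b \<in> carrier G"
  then have "a \<otimes> b = comm G a b \<otimes> (b \<otimes> a)" by (simp add: comm_def m_assoc)
  also have "\<dots> = b \<otimes> a \<otimes> comm G a b" using ab D_central[of "comm G a b" "b \<otimes> a"] by simp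
  finally show ?thesis using ab by (auto simp: cg_def)
qed

lemma cg_conj: "a \<in> carrier G \<Longrightarrow> k \<in> carrier G \<Longrightarrow> cg (k \<otimes> a \<otimes> inv k) a"
  using cg_commute[of "k \<otimes> a" "inv k"] by (simp add: m_assoc[symmetric])

lemma cg_one_iff: "cg a \<one> \<longleftrightarrow> a \<in> D"
  by (auto simp: cg_def)

lemma comm_cg_left: "cg a a' \<Longrightarrow> b \<in> carrier G \<Longrightarrow> comm G a b = comm G a' b"
  by (auto simp: cg_def comm_mult_left comm_D_left)

lemma comm_cg_right: "cg b b' \<Longrightarrow> a \<in> carrier G \<Longrightarrow> comm G a b = comm G a b'"
  by (auto simp: cg_def comm_mult_right comm_D_right)

lemma D_endo:
  assumes "f \<in> hom G G" "l \<in> D"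
  shows "f l \<in> D"
proof -
  interpret f: group_hom G G f using assms by (simp add: group_homI is_group)
  have "l \<in> generate G (derived_set G (carrier G))" using assms(2) by (simp only: generate_derived_set)
  then show ?thesis
  proof (induction rule: generate.induct)
    case (incl h)
    then show ?case using f.hom_comm by (auto simp: comm_def[symmetric])
  next
    case (inv h)
    then obtain a b where "a \<in> carrier G" "b \<in> carrier G" "h = comm G a b" by (auto simp: comm_def)
    then show ?case by (simp add: f.hom_comm)
  next
    case (eng h1 h2)
    have "h1 \<in> D" "h2 \<in> D" using eng.hyps by (simp_all only: generate_derived_set)
    then show ?case using eng by simp
  qed simp
qed

lemma cg_hom: "f \<in> hom G G \<Longrightarrow> cg a b \<Longrightarrow> cg (f a) (f b)"
proof -
  assume f: "f \<in> hom G G" and "cg a b"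
  then obtain d where d: "a \<in> carrier G" "b \<in> carrier G" "d \<in> D" "a = b \<otimes> d" by (auto simp: cg_def)
  then have "f a = f b \<otimes> f d" using hom_mult[OF f, of b d] by simp
  then show ?thesis unfolding cg_def using d hom_in_carrier[OF f] D_endo[OF f] by blast
qed

end

text \<open>On the abelianization \<open>f\<close> is the matrix of order six on \<open>x\<close>,
  \<open>y\<close> and the identity on \<open>Z\<close>, so its cube is minus one on the former and
  one on the latter. The locale will be applied to the map that \<open>\<phi>\<close> induces on
  \<open>G Mod gamma3 G\<close>.\<close>

locale class2_rotation = class2_group +
  fixes f x y Z
  assumes f: "f \<in> hom G G"
    and x [simp]: "x \<in> carrier G" and y [simp]: "y \<in> carrier G" and Z: "Z \<subseteq> carrier G"
    and gen: "carrier G = generate G (insert x (insert y Z))"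
    and fx: "cg (f x) y" and fy: "cg (f y) (y \<otimes> inv x)" and fz: "z \<in> Z \<Longrightarrow> cg (f z) z"
    and torsion_free: "l \<in> D \<Longrightarrow> l \<otimes> l = \<one> \<Longrightarrow> l = \<one>"
begin

sublocale f: group_hom G G f
  using f by (simp add: group_homI is_group)

lemma f_D [simp]: "l \<in> D \<Longrightarrow> f l \<in> D"
  by (rule D_endo[OF f])

lemma ffx: "cg (f (f x)) (y \<otimes> inv x)"
  using cg_trans[OF cg_hom[OF f fx] fy] .

lemma fffx: "cg (f (f (f x))) (inv x)"
proof -
  have "cg (f (f (f x))) (f (y \<otimes> inv x))" by (rule cg_hom[OF f ffx])
  also have "f (y \<otimes> inv x) = f y \<otimes> inv (f x)" by simp
  also have "cg (f y \<otimes> inv (f x)) (y \<otimes> inv x \<otimes> inv y)" by (intro cg_mult cg_inv fy fx)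
  also have "cg (y \<otimes> inv x \<otimes> inv y) (inv x)" by (rule cg_conj) auto
  finally show ?thesis .
qed

lemma ffy: "cg (f (f y)) (inv x)"
proof -
  have "cg (f (f y)) (f (y \<otimes> inv x))" by (rule cg_hom[OF f fy])
  also have "f (y \<otimes> inv x) = f y \<otimes> inv (f x)" by simp
  also have "cg (f y \<otimes> inv (f x)) (y \<otimes> inv x \<otimes> inv y)" by (intro cg_mult cg_inv fy fx)
  also have "cg (y \<otimes> inv x \<otimes> inv y) (inv x)" by (rule cg_conj) auto
  finally show ?thesis .
qed

lemma fffy: "cg (f (f (f y))) (inv y)"
proof -
  have "cg (f (f (f y))) (f (inv x))" by (rule cg_hom[OF f ffy])
  also have "f (inv x) = inv (f x)" by simp
  also have "cg (inv (f x)) (inv y)" by (rule cg_inv[OF fx])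
  finally show ?thesis .
qed

text \<open>On \<open>D\<close>, written without inverses: the polynomial \<open>(T - 1) * (T\<^sup>2 - T + 1)\<close> annihilates \<open>f\<close>.\<close>
definition annihilated :: "'a \<Rightarrow> bool" where
  "annihilated l \<longleftrightarrow> f (f (f l)) \<otimes> (f l \<otimes> f l) = f (f l) \<otimes> f (f l) \<otimes> l"

lemma annihilated_mult:
  assumes "l \<in> D" "l' \<in> D" "annihilated l" "annihilated l'"
  shows "annihilated (l \<otimes> l')"
proof -
  have "f (f (f (l \<otimes> l'))) \<otimes> (f (l \<otimes> l') \<otimes> f (l \<otimes> l')) =
      (f (f (f l)) \<otimes> (f l \<otimes> f l)) \<otimes> (f (f (f l')) \<otimes> (f l' \<otimes> f l'))"
    using assms(1,2) by (simp add: m_assoc D_ac)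
  also have "\<dots> = f (f (l \<otimes> l')) \<otimes> f (f (l \<otimes> l')) \<otimes> (l \<otimes> l')"
    using assms by (simp add: annihilated_def m_assoc D_ac)
  finally show ?thesis by (simp add: annihilated_def)
qed

lemma annihilated_one: "annihilated \<one>"
  by (simp add: annihilated_def)

lemma annihilated_inv: "l \<in> D \<Longrightarrow> annihilated l \<Longrightarrow> annihilated (inv l)"
proof -
  assume l: "l \<in> D" "annihilated l"
  have "inv (f (f (f l)) \<otimes> (f l \<otimes> f l)) = inv (f (f l) \<otimes> f (f l) \<otimes> l)"
    using l(2) by (simp add: annihilated_def)
  then show ?thesis using l(1) by (simp add: annihilated_def inv_mult_group m_assoc D_ac)
qed

lemma annihilated_fixed: "l \<in> D \<Longrightarrow> f l = l \<Longrightarrow> annihilated l"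
  by (simp add: annihilated_def m_assoc)

text \<open>The commutator of \<open>x\<close> and \<open>y\<close> is fixed because the rotation
  has determinant one, and commutators within \<open>Z\<close> are fixed too: both are killed by
  \<open>T - 1\<close>. For \<open>z\<close> in \<open>Z\<close>, the commutators of
  \<open>z\<close> with \<open>x\<close> and \<open>y\<close> transform like the rotated plane and
  are killed by \<open>T^2 - T + 1\<close>.\<close>

lemma annihilated_comm_gens:
  assumes "s \<in> insert x (insert y Z)" "s' \<in> insert x (insert y Z)"
  shows "annihilated (comm G s s')"
proof -
  have zx: "annihilated (comm G z x)" and zy: "annihilated (comm G z y)" if z: "z \<in> Z" for z
  proof -
    have zc: "z \<in> carrier G" using z Z by auto
    have z1: "cg (f z) z" "cg (f (f z)) z" "cg (f (f (f z))) z"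
      using fz[OF z] cg_hom[OF f] cg_trans by blast+
    have eq: "comm G (f z) u = comm G z u" "comm G (f (f z)) u = comm G z u" "comm G (f (f (f z))) u = comm G z u"
      if "u \<in> carrier G" for u using that z1 by (auto intro: comm_cg_left)
    have "f (comm G z x) = comm G z y"
      using zc comm_cg_right[OF fx zc] by (simp add: f.hom_comm eq)
    moreover have "f (f (comm G z x)) = comm G z y \<otimes> inv (comm G z x)"
      using zc comm_cg_right[OF ffx zc] by (simp add: f.hom_comm eq comm_mult_right comm_inv_right)
    moreover have "f (f (f (comm G z x))) = inv (comm G z x)"
      using zc comm_cg_right[OF fffx zc] by (simp add: f.hom_comm eq comm_inv_right)
    ultimately show "annihilated (comm G z x)"
      using zc unfolding annihilated_def by (simp only:, simp add: m_assoc, simp add: D_ac)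
    have "f (comm G z y) = comm G z y \<otimes> inv (comm G z x)"
      using zc comm_cg_right[OF fy zc] by (simp add: f.hom_comm eq comm_mult_right comm_inv_right)
    moreover have "f (f (comm G z y)) = inv (comm G z x)"
      using zc comm_cg_right[OF ffy zc] by (simp add: f.hom_comm eq comm_inv_right)
    moreover have "f (f (f (comm G z y))) = inv (comm G z y)"
      using zc comm_cg_right[OF fffy zc] by (simp add: f.hom_comm eq comm_inv_right)
    ultimately show "annihilated (comm G z y)"
      using zc unfolding annihilated_def by (simp only:, simp add: m_assoc, simp add: D_ac)
  qed
  have xy: "annihilated (comm G x y)"
  proof (rule annihilated_fixed)
    have "f (comm G x y) = comm G y (y \<otimes> inv x)"
      by (simp add: f.hom_comm comm_cg_left[OF fx] comm_cg_right[OF fy])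
    then show "f (comm G x y) = comm G x y"
      by (simp add: comm_mult_right comm_inv_right inv_comm_eq)
  qed simp
  have zz: "annihilated (comm G z z')" if "z \<in> Z" "z' \<in> Z" for z z'
  proof (rule annihilated_fixed)
    show "f (comm G z z') = comm G z z'"
      using that Z by (simp add: f.hom_comm comm_cg_left[OF fz] comm_cg_right[OF fz] subset_iff)
  qed (use that Z in \<open>simp add: subset_iff\<close>)
  have inv: "annihilated (comm G b a)" if "annihilated (comm G a b)" "a \<in> carrier G" "b \<in> carrier G" for a b
    using annihilated_inv[of "comm G a b"] that by (simp add: inv_comm_eq)
  show ?thesis using assms zx zy xy zz inv[OF xy] inv[OF zx] inv[OF zy] Z annihilated_one
    by (auto simp: subset_iff)
qed

lemma annihilated_D:
  assumes "l \<in> D"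
  shows "annihilated l"
proof -
  let ?S = "insert x (insert y Z)"
  have S: "?S \<subseteq> carrier G" using Z by auto
  have 1: "annihilated (comm G a s)" if "a \<in> carrier G" "s \<in> ?S" for a s
  proof -
    have "a \<in> generate G ?S" using that gen by simp
    then show ?thesis
    proof (induction rule: generate.induct)
      case (inv h)
      moreover have "h \<in> carrier G" "s \<in> carrier G" using inv that(2) S by auto
      ultimately show ?case using annihilated_comm_gens[of h s] that
        by (simp add: comm_inv_left annihilated_inv)
    next
      case (eng h1 h2)
      then have "h1 \<in> carrier G" "h2 \<in> carrier G" using gen by auto
      moreover have "s \<in> carrier G" using that(2) S by auto
      ultimately show ?case using eng by (simp add: comm_mult_left annihilated_mult)
    qed (use that S annihilated_one annihilated_comm_gens in \<open>auto simp: subset_iff\<close>)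
  qed
  have 2: "annihilated (comm G a b)" if "a \<in> carrier G" "b \<in> carrier G" for a b
  proof -
    have "b \<in> generate G ?S" using that gen by simp
    then show ?thesis
    proof (induction rule: generate.induct)
      case (inv h)
      moreover have "h \<in> carrier G" using inv S by auto
      ultimately show ?case using 1[OF that(1), of h] that
        by (simp add: comm_inv_right annihilated_inv)
    next
      case (eng h1 h2)
      then have "h1 \<in> carrier G" "h2 \<in> carrier G" using gen by auto
      then show ?case using eng that(1) by (simp add: comm_mult_right annihilated_mult)
    qed (use that S annihilated_one 1 in \<open>auto simp: subset_iff\<close>)
  qed
  have "l \<in> generate G (derived_set G (carrier G))" using assms by (simp only: generate_derived_set)
  then show ?thesis
  proof (induction rule: generate.induct)
    case (incl h)
    then show ?case using 2 by (auto simp: comm_def[symmetric])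
  next
    case (inv h)
    then obtain a b where "a \<in> carrier G" "b \<in> carrier G" "h = comm G a b" by (auto simp: comm_def)
    then show ?case using 2 annihilated_inv by simp
  next
    case (eng h1 h2)
    have "h1 \<in> D" "h2 \<in> D" using eng.hyps by (simp_all only: generate_derived_set)
    then show ?case using eng annihilated_mult by simp
  qed (rule annihilated_one)
qed

text \<open>Additively, \<open>T^3 = 1 + 2 * (T^2 - T)\<close> modulo the annihilating polynomial.
  Hence \<open>f\<close> cubed is the identity on \<open>D\<close> modulo squares, the source of the
  parity arguments below.\<close>

lemma fff_D:
  assumes "l \<in> D"
  shows "f (f (f l)) = l \<otimes> (f (f l) \<otimes> inv (f l)) \<otimes> (f (f l) \<otimes> inv (f l))"
proof -
  have "f (f (f l)) \<otimes> (f l \<otimes> f l) = f (f l) \<otimes> f (f l) \<otimes> l"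
    using annihilated_D[OF assms] by (simp add: annihilated_def)
  then have "f (f (f l)) = f (f l) \<otimes> f (f l) \<otimes> l \<otimes> inv (f l \<otimes> f l)"
    using assms inv_solve_right[of "f (f (f l))" "f (f l) \<otimes> f (f l) \<otimes> l" "f l \<otimes> f l"] by simp
  also have "\<dots> = l \<otimes> (f (f l) \<otimes> inv (f l)) \<otimes> (f (f l) \<otimes> inv (f l))"
    using assms by (simp add: inv_mult_group m_assoc D_ac)
  finally show ?thesis .
qed

text \<open>If \<open>f\<close> cubed sends \<open>u\<close> to \<open>inv u \<otimes> b\<close>,
  then its square sends \<open>u\<close> to \<open>u\<close> times
  \<open>inv b \<otimes> f (f (f b))\<close>, which is a square by \<open>fff_D\<close>. This will
  force the class of \<open>h\<close> in the abelianization to be even.\<close>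

lemma comm_square:
  assumes h: "h \<in> carrier G" and u: "u \<in> carrier G" "cg (f (f (f u))) (inv u)"
    and six: "f (f (f (f (f (f u))))) = h \<otimes> u \<otimes> inv h"
  shows "\<exists>l\<in>D. comm G h u = l \<otimes> l"
proof -
  obtain b where b: "b \<in> D" "f (f (f u)) = inv u \<otimes> b" using u by (auto simp: cg_def)
  define l where "l = f (f b) \<otimes> inv (f b)"
  have "h \<otimes> u \<otimes> inv h = f (f (f (inv u \<otimes> b)))" using six b by simp
  also have "\<dots> = inv (inv u \<otimes> b) \<otimes> f (f (f b))" using u b by simp
  also have "\<dots> = inv b \<otimes> (u \<otimes> (b \<otimes> (l \<otimes> l)))"
    using u b by (simp add: fff_D[OF b(1)] l_def inv_mult_group m_assoc)
  also have "\<dots> = u \<otimes> (l \<otimes> l)"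
    using u b D_lcomm[of b u "l \<otimes> l"] by (simp add: l_def)
  finally have "comm G h u = u \<otimes> (l \<otimes> l) \<otimes> inv u" using h u by (simp add: comm_def)
  also have "\<dots> = l \<otimes> l" using u b D_lcomm[of "l \<otimes> l" u "inv u"] by (simp add: l_def m_assoc)
  finally show ?thesis using b by (intro bexI[of _ l]) (auto simp: l_def)
qed

text \<open>\<open>\<tau>\<close> is \<open>f\<close> cubed, corrected by an inner automorphism into
  an involution. The condition \<open>cg (f k) k\<close> makes \<open>f k\<close> differ from
  \<open>k\<close> by a central element only, so that \<open>\<tau>\<close> commutes with
  \<open>f\<close>.\<close>

context
  fixes k \<tau>
  assumes k: "k \<in> carrier G" "cg (f k) k"
    and \<tau>_def: "\<And>a. a \<in> carrier G \<Longrightarrow> \<tau> a = k \<otimes> f (f (f a)) \<otimes> inv k"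
    and \<tau>\<tau>: "\<And>a. a \<in> carrier G \<Longrightarrow> \<tau> (\<tau> a) = a"
begin

lemma \<tau>_closed [simp]: "a \<in> carrier G \<Longrightarrow> \<tau> a \<in> carrier G"
  using k by (simp add: \<tau>_def)

lemma \<tau>_mult: "a \<in> carrier G \<Longrightarrow> b \<in> carrier G \<Longrightarrow> \<tau> (a \<otimes> b) = \<tau> a \<otimes> \<tau> b"
  using k by (simp add: \<tau>_def m_assoc)

lemma \<tau>_D: "l \<in> D \<Longrightarrow> \<tau> l = f (f (f l))"
  using k D_lcomm[of "f (f (f l))" k "inv k"] by (simp add: \<tau>_def m_assoc)

lemma q_in_D: "x \<otimes> \<tau> x \<in> D"
proof -
  have "cg (\<tau> x) (f (f (f x)))" using cg_conj[of "f (f (f x))" k] k by (simp add: \<tau>_def)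
  then have "cg (\<tau> x) (inv x)" using fffx cg_trans by blast
  then have "cg (x \<otimes> \<tau> x) (x \<otimes> inv x)" by (intro cg_mult cg_refl x)
  then show ?thesis by (simp add: cg_one_iff)
qed

text \<open>As a central element, \<open>q\<close> equals its conjugate
  \<open>\<tau> x \<otimes> x\<close>, which is \<open>\<tau> q\<close>; thus \<open>f\<close> cubed
  fixes \<open>q\<close>. By \<open>fff_D\<close> the element \<open>r\<close> then has trivial
  square, and torsion-freeness gives \<open>f (f q) = f q\<close>, whence
  \<open>f q = q\<close>.\<close>

lemma f_q: "f (x \<otimes> \<tau> x) = x \<otimes> \<tau> x"
proof -
  define q where "q = x \<otimes> \<tau> x"
  have q: "q \<in> D" using q_in_D by (simp add: q_def)
  have "\<tau> q = \<tau> x \<otimes> x" by (simp add: q_def \<tau>_mult \<tau>\<tau>)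
  also have "\<dots> = inv x \<otimes> q \<otimes> x" by (simp add: q_def m_assoc)
  also have "\<dots> = q" using q by (simp add: D_central m_assoc)
  finally have 3: "f (f (f q)) = q" using q by (simp add: \<tau>_D)
  define r where "r = f (f q) \<otimes> inv (f q)"
  have r: "r \<in> D" using q by (simp add: r_def)
  have "q \<otimes> (r \<otimes> r) = q" using fff_D[OF q] 3 q r by (simp add: r_def[symmetric] m_assoc)
  then have "r \<otimes> r = \<one>" using q r by simp
  then have "r = \<one>" by (rule torsion_free[OF r])
  then have 2: "f (f q) = f q" using q inv_solve_right'[of \<one> "f (f q)" "f q"] by (simp add: r_def)
  then have "f (f (f q)) = f q" by simp
  then show ?thesis using 3 by (simp add: q_def)
qed

lemma f_\<tau>: "a \<in> carrier G \<Longrightarrow> f (\<tau> a) = \<tau> (f a)"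
proof -
  assume a: "a \<in> carrier G"
  obtain d where "d \<in> D" "f k = k \<otimes> d" using k by (auto simp: cg_def)
  then show ?thesis using a k by (simp add: \<tau>_def inv_mult_group m_assoc D_lcomm)
qed

text \<open>Since \<open>f\<close> fixes \<open>q\<close> and commutes with \<open>\<tau>\<close>,
  the quadratic map \<open>u \<mapsto> u \<otimes> \<tau> u\<close> takes the value \<open>q\<close>
  at \<open>x\<close>, at \<open>A = f x\<close> and at \<open>f A\<close>. The last point is
  \<open>A \<otimes> inv x\<close> up to \<open>D\<close>; expanding there, the contributions of
  \<open>A\<close> and \<open>inv x\<close> cancel and a commutator of \<open>A\<close> and
  \<open>x\<close> remains, up to squares.\<close>

lemma q_eq: "\<exists>l\<in>D. x \<otimes> \<tau> x = comm G (f x) x \<otimes> (l \<otimes> l)"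
proof -
  define q where "q = x \<otimes> \<tau> x"
  have q: "q \<in> D" using q_in_D by (simp add: q_def)
  define A where "A = f x"
  have A: "A \<in> carrier G" by (simp add: A_def)
  have fq: "f q = q" using f_q by (simp add: q_def)
  have "cg (f A) (A \<otimes> inv x)"
    unfolding A_def by (rule cg_trans[OF ffx cg_mult[OF cg_sym[OF fx]]]) simp
  then obtain n where n: "n \<in> D" "f A = A \<otimes> inv x \<otimes> n" by (auto simp: cg_def)
  have \<tau>x: "\<tau> x = inv x \<otimes> q" by (simp add: q_def)
  have "q = A \<otimes> \<tau> A" using fq by (simp add: q_def A_def f_\<tau>)
  then have \<tau>A: "\<tau> A = inv A \<otimes> q" using A by simp
  have inv\<tau>x: "\<tau> (inv x) = inv (\<tau> x)"
    using \<tau>_mult[of "inv x" x] inv_equality[of "\<tau> (inv x)" "\<tau> x"] k by (simp add: \<tau>_def)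
  have "q = f (A \<otimes> \<tau> A)" using fq \<open>q = A \<otimes> \<tau> A\<close> by simp
  also have "\<dots> = f A \<otimes> \<tau> (f A)" using A by (simp add: f_\<tau>)
  also have "\<tau> (f A) = \<tau> A \<otimes> inv (\<tau> x) \<otimes> f (f (f n))" using n A by (simp add: \<tau>_mult inv\<tau>x \<tau>_D)
  also have "\<dots> = inv A \<otimes> x \<otimes> f (f (f n))" using A q n by (simp add: \<tau>A \<tau>x inv_mult_group m_assoc)
  also have "f A \<otimes> \<dots> = A \<otimes> inv x \<otimes> inv A \<otimes> x \<otimes> (n \<otimes> f (f (f n)))"
    using A n D_lcomm[of n "inv A \<otimes> x" "f (f (f n))"] by (simp add: m_assoc)
  also have "A \<otimes> inv x \<otimes> inv A \<otimes> x = inv (comm G A x)"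
    using A comm_inv_right[of A x] by (simp add: comm_def)
  finally have "q = inv (comm G A x) \<otimes> (n \<otimes> f (f (f n)))" .
  \<comment> \<open>An inverse is the element itself times a square, and
    \<open>n \<otimes> f (f (f n))\<close> is a square by \<open>fff_D\<close>.\<close>
  also have "\<dots> = comm G A x \<otimes> ((inv (comm G A x) \<otimes> n \<otimes> (f (f n) \<otimes> inv (f n))) \<otimes> (inv (comm G A x) \<otimes> n \<otimes> (f (f n) \<otimes> inv (f n))))"
    using A n by (simp add: fff_D[OF n(1)] m_assoc D_ac)
  finally show ?thesis using A n
    by (intro bexI[of _ "inv (comm G A x) \<otimes> n \<otimes> (f (f n) \<otimes> inv (f n))"]) (auto simp: q_def A_def)
qed

text \<open>Replacing \<open>z\<close> by \<open>z \<otimes> f w\<close> changes its defect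
  \<open>w\<close> under \<open>f\<close> into \<open>(T^2 - T + 1) w\<close>, which
  \<open>T - 1\<close> kills. The defect \<open>w'\<close> of the new element under
  \<open>\<tau>\<close> is then fixed by \<open>\<tau>\<close>, so the involution property gives it
  trivial square, and torsion-freeness makes it trivial.\<close>

lemma fixed_lift:
  assumes z: "z \<in> Z"
  shows "\<exists>d\<in>D. \<tau> (z \<otimes> d) = z \<otimes> d"
proof -
  have zc [simp]: "z \<in> carrier G" using z Z by auto
  obtain w where w: "w \<in> D" "f z = z \<otimes> w" using fz[OF z] by (auto simp: cg_def)
  define z' where "z' = z \<otimes> f w"
  define m where "m = inv (f w) \<otimes> w \<otimes> f (f w)"
  have z' [simp]: "z' \<in> carrier G" and m [simp]: "m \<in> D" using w by (auto simp: z'_def m_def)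
  have fz': "f z' = z' \<otimes> m" using w by (simp add: z'_def m_def m_assoc)
  have fm: "f m = m"
  proof -
    define r where "r = f (f w) \<otimes> inv (f w)"
    have r: "r \<in> D" using w by (simp add: r_def)
    have "f m = inv r \<otimes> f (f (f w))" using w by (simp add: m_def r_def inv_mult_group D_ac)
    also have "\<dots> = inv r \<otimes> (r \<otimes> (w \<otimes> r))" using w r fff_D[OF w(1)] by (simp add: r_def[symmetric] D_ac)
    also have "\<dots> = m" using w r by (simp add: m_def) (simp add: r_def m_assoc D_ac)
    finally show ?thesis .
  qed
  define w' where "w' = comm G k z' \<otimes> (m \<otimes> m \<otimes> m)"
  have w' [simp]: "w' \<in> D" using k by (simp add: w'_def)
  have "f (f (f z')) = z' \<otimes> (m \<otimes> m \<otimes> m)" by (simp add: fz' fm m_assoc)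
  then have "\<tau> z' = k \<otimes> z' \<otimes> (m \<otimes> m \<otimes> m) \<otimes> inv k" using k by (simp add: \<tau>_def m_assoc)
  also have "\<dots> = comm G k z' \<otimes> z' \<otimes> (m \<otimes> m \<otimes> m)"
    using k by (simp add: comm_def m_assoc D_central D_lcomm)
  also have "\<dots> = z' \<otimes> w'"
    using k D_lcomm[of "comm G k z'" z' "m \<otimes> m \<otimes> m"] by (simp add: w'_def m_assoc)
  finally have \<tau>z': "\<tau> z' = z' \<otimes> w'" .
  have "comm G (f k) (f z') = comm G k z'"
    using k cg_D[of z' m] by (simp add: comm_cg_left[OF k(2)] fz' comm_cg_right)
  then have "f w' = w'" using k fm by (simp only: w'_def f.hom_mult f.hom_comm m D_closed D_mult z' comm_closed fm)
  then have "\<tau> w' = w'" by (simp add: \<tau>_D)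
  then have "z' = z' \<otimes> (w' \<otimes> w')" using \<tau>\<tau>[of z'] by (simp add: \<tau>z' \<tau>_mult m_assoc)
  then have "w' \<otimes> w' = \<one>" by (metis D_closed D_mult l_cancel_one' w' z')
  then have "w' = \<one>" by (rule torsion_free[OF w'])
  then show ?thesis using \<tau>z' w by (intro bexI[of _ "f w"]) (auto simp: z'_def)
qed

end

end

section \<open>An order six matrix that is not induced by a torsion outer automorphism\<close>

definition gamma2 :: "('a, 'c) monoid_scheme \<Rightarrow> 'a set" where
  "gamma2 G = derived G (carrier G)"

definition gamma3 :: "('a, 'c) monoid_scheme \<Rightarrow> 'a set" where
  "gamma3 G = generate G {comm G l t |l t. l \<in> gamma2 G \<and> t \<in> carrier G}"

context group
begin

lemma normal_gamma2: "gamma2 G \<lhd> G"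
  unfolding gamma2_def by (rule derived_self_is_normal)

lemma subgroup_gamma2: "subgroup (gamma2 G) G"
  by (rule normal_imp_subgroup[OF normal_gamma2])

lemma gamma2_closed [simp]: "l \<in> gamma2 G \<Longrightarrow> l \<in> carrier G"
  using subgroup.subset[OF subgroup_gamma2] by blast

lemma gamma2_mult [simp]: "l \<in> gamma2 G \<Longrightarrow> l' \<in> gamma2 G \<Longrightarrow> l \<otimes> l' \<in> gamma2 G"
  by (rule subgroup.m_closed[OF subgroup_gamma2])

lemma gamma2_inv [simp]: "l \<in> gamma2 G \<Longrightarrow> inv l \<in> gamma2 G"
  by (rule subgroup.m_inv_closed[OF subgroup_gamma2])

lemma comm_in_gamma2 [simp]: "a \<in> carrier G \<Longrightarrow> b \<in> carrier G \<Longrightarrow> comm G a b \<in> gamma2 G"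
  unfolding gamma2_def derived_def comm_def by (rule generate.incl) auto

lemma gamma2_induct [consumes 1, case_names one comm inv mult]:
  assumes "l \<in> gamma2 G" and "P \<one>" and "\<And>a b. a \<in> carrier G \<Longrightarrow> b \<in> carrier G \<Longrightarrow> P (comm G a b)"
    and "\<And>l. l \<in> gamma2 G \<Longrightarrow> P l \<Longrightarrow> P (inv l)"
    and "\<And>l l'. l \<in> gamma2 G \<Longrightarrow> P l \<Longrightarrow> l' \<in> gamma2 G \<Longrightarrow> P l' \<Longrightarrow> P (l \<otimes> l')"
  shows "P l"
proof -
  have g: "generate G (derived_set G (carrier G)) = gamma2 G" by (simp only: gamma2_def derived_def)
  have "l \<in> generate G (derived_set G (carrier G))" using assms(1) by (simp only: g)
  then show ?thesis
  proof (induction rule: generate.induct)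
    case one
    then show ?case by (rule assms(2))
  next
    case (incl h)
    then show ?case using assms(3) by (auto simp: comm_def)
  next
    case (inv h)
    then obtain a b where "a \<in> carrier G" "b \<in> carrier G" "h = comm G a b" by (auto simp: comm_def)
    then show ?case using assms(3,4) by simp
  next
    case (eng h1 h2)
    have "h1 \<in> gamma2 G" "h2 \<in> gamma2 G" using eng.hyps by (simp_all only: g)
    then show ?case using eng.IH assms(5) by blast
  qed
qed

lemma gamma3_generators: "{comm G l t |l t. l \<in> gamma2 G \<and> t \<in> carrier G} \<subseteq> carrier G"
  by auto

lemma normal_gamma3: "gamma3 G \<lhd> G"
  unfolding gamma3_def
proof (rule normal_generateI[OF gamma3_generators])
  fix c g assume "c \<in> {comm G l t |l t. l \<in> gamma2 G \<and> t \<in> carrier G}" and g: "g \<in> carrier G"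
  then obtain l t where lt: "l \<in> gamma2 G" "t \<in> carrier G" "c = comm G l t" by auto
  have "g \<otimes> c \<otimes> inv g = comm G (g \<otimes> l \<otimes> inv g) (g \<otimes> t \<otimes> inv g)"
    using lt g by (simp add: comm_conj)
  moreover have "g \<otimes> l \<otimes> inv g \<in> gamma2 G" by (rule normal.inv_op_closed2[OF normal_gamma2 g lt(1)])
  ultimately show "g \<otimes> c \<otimes> inv g \<in> {comm G l t |l t. l \<in> gamma2 G \<and> t \<in> carrier G}"
    using lt g by blast
qed

lemma subgroup_gamma3: "subgroup (gamma3 G) G"
  by (rule normal_imp_subgroup[OF normal_gamma3])

lemma gamma3_subset: "gamma3 G \<subseteq> gamma2 G"
  unfolding gamma3_def by (rule generate_subgroup_incl[OF _ subgroup_gamma2]) auto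

lemma gamma3_closed [simp]: "l \<in> gamma3 G \<Longrightarrow> l \<in> gamma2 G"
  using gamma3_subset by blast

lemma comm_in_gamma3: "l \<in> gamma2 G \<Longrightarrow> t \<in> carrier G \<Longrightarrow> comm G l t \<in> gamma3 G"
  unfolding gamma3_def by (rule generate.incl) auto

lemma gamma3_induct [consumes 1, case_names one comm inv mult]:
  assumes "l \<in> gamma3 G" and "P \<one>" and "\<And>l b. l \<in> gamma2 G \<Longrightarrow> b \<in> carrier G \<Longrightarrow> P (comm G l b)"
    and "\<And>l. l \<in> gamma3 G \<Longrightarrow> P l \<Longrightarrow> P (inv l)"
    and "\<And>l l'. l \<in> gamma3 G \<Longrightarrow> P l \<Longrightarrow> l' \<in> gamma3 G \<Longrightarrow> P l' \<Longrightarrow> P (l \<otimes> l')"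
  shows "P l"
proof -
  have "l \<in> generate G {comm G l t |l t. l \<in> gamma2 G \<and> t \<in> carrier G}"
    using assms(1) by (simp only: gamma3_def)
  then show ?thesis
  proof (induction rule: generate.induct)
    case one
    then show ?case by (rule assms(2))
  next
    case (incl h)
    then show ?case using assms(3) by auto
  next
    case (inv h)
    then obtain a b where "a \<in> gamma2 G" "b \<in> carrier G" "h = comm G a b" by auto
    then show ?case using assms(3,4) comm_in_gamma3 by simp
  next
    case (eng h1 h2)
    have "h1 \<in> gamma3 G" "h2 \<in> gamma3 G" using eng.hyps by (simp_all only: gamma3_def)
    then show ?case using eng.IH assms(5) by blast
  qed
qed

lemma gamma2_endo: "\<phi> \<in> hom G G \<Longrightarrow> l \<in> gamma2 G \<Longrightarrow> \<phi> l \<in> gamma2 G"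
proof -
  assume "\<phi> \<in> hom G G" and l: "l \<in> gamma2 G"
  then interpret \<phi>: group_hom G G \<phi> by (simp add: group_homI is_group)
  show ?thesis using l
    by (induction rule: gamma2_induct) (auto simp: \<phi>.hom_comm subgroup.one_closed[OF subgroup_gamma2])
qed

lemma gamma3_endo: "\<phi> \<in> hom G G \<Longrightarrow> l \<in> gamma3 G \<Longrightarrow> \<phi> l \<in> gamma3 G"
proof -
  assume \<phi>: "\<phi> \<in> hom G G" and l: "l \<in> gamma3 G"
  then interpret \<phi>: group_hom G G \<phi> by (simp add: group_homI is_group)
  show ?thesis using l
    by (induction rule: gamma3_induct)
      (auto simp: \<phi>.hom_comm comm_in_gamma3 gamma2_endo[OF \<phi>] subgroup.one_closed[OF subgroup_gamma3]
        subgroup.m_closed[OF subgroup_gamma3] subgroup.m_inv_closed[OF subgroup_gamma3])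
qed

section \<open>The class two quotient by \<open>gamma3 G\<close>\<close>

definition pr :: "'a \<Rightarrow> 'a set" where "pr g = gamma3 G #> g"

lemma group_hom_pr: "group_hom G (G Mod gamma3 G) pr"
  using normal.r_coset_hom_Mod[OF normal_gamma3] normal.factorgroup_is_group[OF normal_gamma3]
  by (simp add: group_hom_def group_hom_axioms_def is_group pr_def[abs_def])

lemma pr_surj: "pr ` carrier G = carrier (G Mod gamma3 G)"
  by (simp add: carrier_FactGroup pr_def[abs_def])

lemma pr_eq_one_iff: "g \<in> carrier G \<Longrightarrow> pr g = \<one>\<^bsub>G Mod gamma3 G\<^esub> \<longleftrightarrow> g \<in> gamma3 G"
  using coset_join1[of "gamma3 G" g] coset_join2[of g "gamma3 G"] subgroup_gamma3
  by (auto simp: pr_def)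

lemma pr_eqE:
  assumes "a \<in> carrier G" "b \<in> carrier G" "pr a = pr b"
  obtains c where "c \<in> gamma3 G" "a = b \<otimes> c"
proof -
  interpret pr: group_hom G "G Mod gamma3 G" pr by (rule group_hom_pr)
  have "pr (inv b \<otimes> a) = \<one>\<^bsub>G Mod gamma3 G\<^esub>" using assms by (simp del: one_FactGroup mult_FactGroup)
  then have "inv b \<otimes> a \<in> gamma3 G" using assms pr_eq_one_iff[of "inv b \<otimes> a"] by simp
  then show ?thesis using that[of "inv b \<otimes> a"] assms by simp
qed

lemma derived_pr: "derived (G Mod gamma3 G) (carrier (G Mod gamma3 G)) = pr ` gamma2 G"
  using group_hom.derived_img[OF group_hom_pr, of "carrier G"] by (simp add: pr_surj gamma2_def)

lemma pr_in_derived_iff: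
  assumes "g \<in> carrier G"
  shows "pr g \<in> pr ` gamma2 G \<longleftrightarrow> g \<in> gamma2 G"
proof
  assume "pr g \<in> pr ` gamma2 G"
  then obtain l where "l \<in> gamma2 G" "pr g = pr l" by auto
  then obtain c where "c \<in> gamma3 G" "g = l \<otimes> c" using pr_eqE[OF assms, of l] gamma2_closed by blast
  then show "g \<in> gamma2 G" using \<open>l \<in> gamma2 G\<close> by simp
qed auto

lemma class2_group_pr: "class2_group (G Mod gamma3 G)"
proof -
  interpret pr: group_hom G "G Mod gamma3 G" pr by (rule group_hom_pr)
  show ?thesis
  proof unfold_locales
    fix l a assume "l \<in> derived (G Mod gamma3 G) (carrier (G Mod gamma3 G))" "a \<in> carrier (G Mod gamma3 G)"
    then have "l \<in> pr ` gamma2 G" "a \<in> pr ` carrier G" by (simp_all only: derived_pr pr_surj)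
    then obtain l' a' where la: "l' \<in> gamma2 G" "l = pr l'" "a' \<in> carrier G" "a = pr a'" by auto
    have "pr (comm G l' a') = \<one>\<^bsub>G Mod gamma3 G\<^esub>"
      using la comm_in_gamma3[of l' a'] pr_eq_one_iff[of "comm G l' a'"] by simp
    then have "pr l' \<otimes>\<^bsub>G Mod gamma3 G\<^esub> pr a' = pr (comm G l' a') \<otimes>\<^bsub>G Mod gamma3 G\<^esub> (pr a' \<otimes>\<^bsub>G Mod gamma3 G\<^esub> pr l') \<longrightarrow>
      pr l' \<otimes>\<^bsub>G Mod gamma3 G\<^esub> pr a' = pr a' \<otimes>\<^bsub>G Mod gamma3 G\<^esub> pr l'"
      using la by (simp del: mult_FactGroup one_FactGroup)
    moreover have "l' \<otimes> a' = comm G l' a' \<otimes> (a' \<otimes> l')" using la by (simp add: comm_def m_assoc)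
    then have "pr (l' \<otimes> a') = pr (comm G l' a' \<otimes> (a' \<otimes> l'))" by simp
    then have "pr l' \<otimes>\<^bsub>G Mod gamma3 G\<^esub> pr a' = pr (comm G l' a') \<otimes>\<^bsub>G Mod gamma3 G\<^esub> (pr a' \<otimes>\<^bsub>G Mod gamma3 G\<^esub> pr l')"
      using la by (simp del: mult_FactGroup one_FactGroup)
    ultimately show "a \<otimes>\<^bsub>G Mod gamma3 G\<^esub> l = l \<otimes>\<^bsub>G Mod gamma3 G\<^esub> a" using la by metis
  qed
qed

section \<open>Dihedral images of the lower central series\<close>

lemma dinf_gamma2:
  assumes "\<theta> \<in> hom G dinf" "l \<in> gamma2 G"
  shows "\<exists>a. \<theta> l = (2 * a, False)"
proof -
  interpret \<theta>: group_hom G dinf \<theta> using assms(1) group_dinf by (simp add: group_homI is_group)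
  show ?thesis using assms(2)
  proof (induction rule: gamma2_induct)
    case (comm a b)
    then show ?case by (cases "\<theta> a"; cases "\<theta> b") (auto simp: \<theta>.hom_comm intro: exI[of _ "p - q" for p q])
  next
    case (inv l)
    then show ?case by (auto intro: exI[of _ "- p" for p])
  next
    case (mult l l')
    then obtain a a' where "\<theta> l = (2 * a, False)" "\<theta> l' = (2 * a', False)" by blast
    then show ?case using mult by (intro exI[of _ "a + a'"]) simp
  qed simp
qed

text \<open>The commutator of a translation with a reflection doubles the translation, up to sign,
  and with a translation it is trivial. One step further the images lie in the multiples of 8, so
  congruences modulo 8 express relations in class three.\<close>

lemma dinf_gamma3:
  assumes "\<theta> \<in> hom G dinf" "l \<in> gamma3 G"
  shows "\<exists>a. \<theta> l = (4 * a, False)"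
proof -
  interpret \<theta>: group_hom G dinf \<theta> using assms(1) group_dinf by (simp add: group_homI is_group)
  show ?thesis using assms(2)
  proof (induction rule: gamma3_induct)
    case (comm l b)
    obtain a where "\<theta> l = (2 * a, False)" using dinf_gamma2[OF assms(1) comm(1)] by blast
    then show ?case using comm by (cases "\<theta> b") (auto simp: \<theta>.hom_comm)
  next
    case (inv l)
    then show ?case by (auto intro: exI[of _ "- p" for p])
  next
    case (mult l l')
    then obtain a a' where "\<theta> l = (4 * a, False)" "\<theta> l' = (4 * a', False)" by blast
    then show ?case using mult by (intro exI[of _ "a + a'"]) simp
  qed simp
qed

text \<open>The same doubling applied to differences: an endomorphism invisible modulo 2 is
  invisible modulo 4 on \<open>gamma2 G\<close>, and by the next lemma modulo 8 on
  \<open>gamma3 G\<close>. It will be \<open>\<tau>\<close>, which acts on the generators by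
  inversion or trivially up to \<open>gamma2 G\<close>.\<close>

lemma dinf_gamma2_cong:
  assumes \<theta>: "\<theta> \<in> hom G dinf" and \<sigma>: "\<sigma> \<in> hom G G"
    and mod2: "\<And>t. t \<in> carrier G \<Longrightarrow> snd (\<theta> (\<sigma> t)) = snd (\<theta> t) \<and> even (fst (\<theta> (\<sigma> t)) - fst (\<theta> t))"
    and "l \<in> gamma2 G"
  shows "4 dvd fst (\<theta> (\<sigma> l)) - fst (\<theta> l)"
proof -
  interpret \<theta>: group_hom G dinf \<theta> using \<theta> group_dinf by (simp add: group_homI is_group)
  interpret \<sigma>: group_hom G G \<sigma> using \<sigma> by (simp add: group_homI is_group)
  show ?thesis using assms(4)
  proof (induction rule: gamma2_induct)
    case (comm a b)
    obtain q where "fst (\<theta> (\<sigma> a)) - fst (\<theta> a) = 2 * q" using mod2[OF comm(1)] by blast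
    then obtain p s where a: "\<theta> a = (p, s)" "\<theta> (\<sigma> a) = (p + 2 * q, s)"
      using mod2[OF comm(1)] by (cases "\<theta> a"; cases "\<theta> (\<sigma> a)") (auto simp: algebra_simps)
    obtain q' where "fst (\<theta> (\<sigma> b)) - fst (\<theta> b) = 2 * q'" using mod2[OF comm(2)] by blast
    then obtain p' s' where b: "\<theta> b = (p', s')" "\<theta> (\<sigma> b) = (p' + 2 * q', s')"
      using mod2[OF comm(2)] by (cases "\<theta> b"; cases "\<theta> (\<sigma> b)") (auto simp: algebra_simps)
    have "fst (\<theta> (\<sigma> (comm G a b))) - fst (\<theta> (comm G a b)) = 4 * ((if s' then q else 0) - (if s then q' else 0))"
      using comm a b by (simp add: \<sigma>.hom_comm \<theta>.hom_comm)
    then show ?case by simp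
  next
    case (inv l)
    obtain a a' where "\<theta> l = (2 * a, False)" "\<theta> (\<sigma> l) = (2 * a', False)"
      using dinf_gamma2[OF \<theta>] gamma2_endo[OF \<sigma>] inv by metis
    then show ?case using inv by (simp add: dvd_diff_commute)
  next
    case (mult l l')
    obtain a a' b b' where "\<theta> l = (2 * a, False)" "\<theta> (\<sigma> l) = (2 * a', False)"
      "\<theta> l' = (2 * b, False)" "\<theta> (\<sigma> l') = (2 * b', False)"
      using dinf_gamma2[OF \<theta>] gamma2_endo[OF \<sigma>] mult by metis
    then show ?case using mult dvd_add[of 4 "2 * a' - 2 * a" "2 * b' - 2 * b"] by (simp add: algebra_simps)
  qed simp
qed

lemma dinf_gamma3_cong:
  assumes \<theta>: "\<theta> \<in> hom G dinf" and \<sigma>: "\<sigma> \<in> hom G G"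
    and mod2: "\<And>t. t \<in> carrier G \<Longrightarrow> snd (\<theta> (\<sigma> t)) = snd (\<theta> t) \<and> even (fst (\<theta> (\<sigma> t)) - fst (\<theta> t))"
    and "l \<in> gamma3 G"
  shows "8 dvd fst (\<theta> (\<sigma> l)) - fst (\<theta> l)"
proof -
  interpret \<theta>: group_hom G dinf \<theta> using \<theta> group_dinf by (simp add: group_homI is_group)
  interpret \<sigma>: group_hom G G \<sigma> using \<sigma> by (simp add: group_homI is_group)
  show ?thesis using assms(4)
  proof (induction rule: gamma3_induct)
    case (comm l b)
    obtain a a' where l: "\<theta> l = (2 * a, False)" "\<theta> (\<sigma> l) = (2 * a', False)"
      using dinf_gamma2[OF \<theta>] gamma2_endo[OF \<sigma>] comm by metis
    have "4 dvd 2 * a' - 2 * a" using dinf_gamma2_cong[OF \<theta> \<sigma> mod2 comm(1)] l by simp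
    then have 8: "8 dvd 4 * a' - 4 * a" by presburger
    have "snd (\<theta> (\<sigma> b)) = snd (\<theta> b)" using mod2 comm by blast
    then show ?case using comm l 8 by (cases "\<theta> b"; cases "\<theta> (\<sigma> b)") (simp add: \<sigma>.hom_comm \<theta>.hom_comm)
  next
    case (inv l)
    obtain a a' where "\<theta> l = (4 * a, False)" "\<theta> (\<sigma> l) = (4 * a', False)"
      using dinf_gamma3[OF \<theta>] gamma3_endo[OF \<sigma>] inv by metis
    then show ?case using inv by (simp add: dvd_diff_commute)
  next
    case (mult l l')
    obtain a a' b b' where "\<theta> l = (4 * a, False)" "\<theta> (\<sigma> l) = (4 * a', False)"
      "\<theta> l' = (4 * b, False)" "\<theta> (\<sigma> l') = (4 * b', False)"
      using dinf_gamma3[OF \<theta>] gamma3_endo[OF \<sigma>] mult by metis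
    then show ?case using mult dvd_add[of 8 "4 * a' - 4 * a" "4 * b' - 4 * b"] by (simp add: algebra_simps)
  qed simp
qed

lemma intg_gamma2:
  assumes "e \<in> hom G intg" "l \<in> gamma2 G"
  shows "e l = 0"
proof -
  interpret e: group_hom G intg e using assms(1) group_intg by (simp add: group_homI is_group)
  show ?thesis using assms(2)
    by (induction rule: gamma2_induct) (auto simp: e.hom_comm, simp add: comm_def)
qed

text \<open>The common core for free and surface groups. \<open>E\<close> stands for coordinates on
  the abelianization, and \<open>even\<close> turns the squares found by \<open>comm_square\<close>
  into an element \<open>k\<close> whose class is minus half of that of \<open>h\<close>.
  \<open>\<Theta>\<close> reflects in \<open>x\<close> and \<open>z\<close> and translates by
  \<open>y\<close>: it sees the commutator of \<open>y\<close> and \<open>x\<close>, and it tests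
  elements of \<open>gamma2 G\<close> against \<open>z\<close>.\<close>

theorem no_torsion_rotation:
  assumes \<phi>: "\<phi> \<in> hom G G" and surj: "\<phi> ` carrier G = carrier G"
    and x: "x \<in> carrier G" and y: "y \<in> carrier G" and Z: "Z \<subseteq> carrier G" and z: "z \<in> Z"
    and gen: "carrier G = generate G (insert x (insert y Z))"
    and \<phi>x: "inv y \<otimes> \<phi> x \<in> gamma2 G" and \<phi>y: "inv (y \<otimes> inv x) \<otimes> \<phi> y \<in> gamma2 G"
    and \<phi>z: "\<And>z. z \<in> Z \<Longrightarrow> inv z \<otimes> \<phi> z \<in> gamma2 G"
    and h0: "h0 \<in> carrier G" and six: "\<And>g. g \<in> carrier G \<Longrightarrow> (\<phi> ^^ 6) g = h0 \<otimes> g \<otimes> inv h0"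
    and torsion_free: "\<And>l. l \<in> gamma2 G \<Longrightarrow> l \<otimes> l \<in> gamma3 G \<Longrightarrow> l \<in> gamma3 G"
    and E: "E \<subseteq> hom G intg" and gamma2I: "\<And>g. g \<in> carrier G \<Longrightarrow> (\<And>e. e \<in> E \<Longrightarrow> e g = 0) \<Longrightarrow> g \<in> gamma2 G"
    and central: "\<And>u e. u \<in> carrier G \<Longrightarrow> (\<And>g. g \<in> carrier G \<Longrightarrow> u \<otimes> g = g \<otimes> u) \<Longrightarrow> e \<in> E \<Longrightarrow> e u = 0"
    and even: "\<And>h. h \<in> carrier G \<Longrightarrow> \<exists>l\<in>gamma2 G. comm G h x \<otimes> inv (l \<otimes> l) \<in> gamma3 G \<Longrightarrow>
      \<exists>l\<in>gamma2 G. comm G h y \<otimes> inv (l \<otimes> l) \<in> gamma3 G \<Longrightarrow> \<exists>k\<in>carrier G. \<forall>e\<in>E. e h + 2 * e k = 0"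
    and \<Theta>: "\<Theta> \<in> hom G dinf" "\<Theta> x = (0, True)" "\<Theta> y = (1, False)" "\<Theta> z = (0, True)"
  shows False
proof -
  let ?N = "G Mod gamma3 G"
  let ?D = "derived ?N (carrier ?N)"
  note mult_FactGroup [simp del] one_FactGroup [simp del]
  note [simp] = x y h0
  have zc [simp]: "z \<in> carrier G" using z Z by auto
  interpret pr: group_hom G ?N pr by (rule group_hom_pr)
  interpret \<phi>: group_hom G G \<phi> using \<phi> by (simp add: group_homI is_group)
  interpret \<Theta>: group_hom G dinf \<Theta> using \<Theta>(1) group_dinf by (simp add: group_homI is_group)
  interpret N: class2_group ?N ?D by (rule class2_group_pr)
  have e_hom: "group_hom G intg e" if "e \<in> E" for e
    using that E group_intg by (auto intro!: group_homI)
  have D_iff: "pr g \<in> ?D \<longleftrightarrow> g \<in> gamma2 G" if "g \<in> carrier G" for g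
    unfolding derived_pr by (rule pr_in_derived_iff[OF that])
  have D_ex: "\<exists>l'\<in>gamma2 G. l = pr l'" if "l \<in> ?D" for l
    using that unfolding derived_pr by auto
  have cgI: "N.cg (pr a) (pr b)" if "a \<in> carrier G" "b \<in> carrier G" "inv b \<otimes> a \<in> gamma2 G" for a b
  proof -
    have "pr a = pr b \<otimes>\<^bsub>?N\<^esub> pr (inv b \<otimes> a)" using that by (simp flip: pr.hom_mult)
    moreover have "pr (inv b \<otimes> a) \<in> ?D" using that D_iff[of "inv b \<otimes> a"] by blast
    ultimately show ?thesis unfolding N.cg_def using that pr.hom_closed by blast
  qed
  have cgD: "inv b \<otimes> a \<in> gamma2 G" if ab: "a \<in> carrier G" "b \<in> carrier G" "N.cg (pr a) (pr b)" for a b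
  proof -
    obtain d where "d \<in> ?D" "pr a = pr b \<otimes>\<^bsub>?N\<^esub> d" using ab(3) by (auto simp: N.cg_def)
    then have "pr (inv b \<otimes> a) = d" using ab(1,2) N.D_closed by simp
    then show ?thesis using \<open>d \<in> ?D\<close> D_iff[of "inv b \<otimes> a"] ab by simp
  qed
  obtain f where f: "f \<in> hom ?N ?N" and f_pr: "\<And>g. g \<in> carrier G \<Longrightarrow> f (pr g) = pr (\<phi> g)"
  proof -
    have h: "(\<lambda>g. pr (\<phi> g)) \<in> hom G ?N" by (rule homI) auto
    have "pr (\<phi> a) = pr (\<phi> b)" if ab: "a \<in> carrier G" "b \<in> carrier G" "gamma3 G #> a = gamma3 G #> b" for a b
    proof -
      obtain c where c: "c \<in> gamma3 G" "a = b \<otimes> c" using pr_eqE[of a b] ab by (auto simp: pr_def)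
      then have "pr (\<phi> c) = \<one>\<^bsub>?N\<^esub>" using gamma3_endo[OF \<phi> c(1)] by (subst pr_eq_one_iff) auto
      then show ?thesis using c ab by simp
    qed
    then show ?thesis using FactGroup_universal[OF h normal_gamma3] that unfolding pr_def by metis
  qed
  interpret R: class2_rotation ?N ?D f "pr x" "pr y" "pr ` Z"
  proof unfold_locales
    have "carrier ?N = pr ` generate G (insert x (insert y Z))" using pr_surj gen by simp
    also have "\<dots> = generate ?N (pr ` insert x (insert y Z))"
      using Z by (intro pr.generate_img[symmetric]) auto
    finally show "carrier ?N = generate ?N (insert (pr x) (insert (pr y) (pr ` Z)))" by simp
    show "N.cg (f (pr x)) (pr y)" using \<phi>x by (simp add: f_pr cgI)
    have "N.cg (pr (\<phi> y)) (pr (y \<otimes> inv x))" using \<phi>y by (intro cgI) auto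
    then show "N.cg (f (pr y)) (pr y \<otimes>\<^bsub>?N\<^esub> inv\<^bsub>?N\<^esub> pr x)" by (simp add: f_pr)
    show "N.cg (f a) a" if "a \<in> pr ` Z" for a
      using that Z \<phi>z by (auto simp: f_pr subset_iff intro!: cgI)
    show "l = \<one>\<^bsub>?N\<^esub>" if l: "l \<in> ?D" "l \<otimes>\<^bsub>?N\<^esub> l = \<one>\<^bsub>?N\<^esub>" for l
    proof -
      obtain l' where l': "l' \<in> gamma2 G" "l = pr l'" using D_ex l(1) by blast
      have "pr (l' \<otimes> l') = \<one>\<^bsub>?N\<^esub>" using l l' by simp
      then have "l' \<otimes> l' \<in> gamma3 G" using l' by (subst (asm) pr_eq_one_iff) auto
      then show ?thesis using torsion_free[OF l'(1)] l' by (simp add: pr_eq_one_iff)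
    qed
  qed (use f Z in auto)
  have pow6: "\<phi> (\<phi> (\<phi> (\<phi> (\<phi> (\<phi> g))))) = h0 \<otimes> g \<otimes> inv h0" if "g \<in> carrier G" for g
    using six[OF that] by (simp add: eval_nat_numeral)
  have sq: "\<exists>l\<in>gamma2 G. comm G h0 u \<otimes> inv (l \<otimes> l) \<in> gamma3 G"
    if u: "u \<in> carrier G" "N.cg (f (f (f (pr u)))) (inv\<^bsub>?N\<^esub> (pr u))" for u
  proof -
    have "f (f (f (f (f (f (pr u)))))) = pr h0 \<otimes>\<^bsub>?N\<^esub> pr u \<otimes>\<^bsub>?N\<^esub> inv\<^bsub>?N\<^esub> (pr h0)"
      using u by (simp add: f_pr pow6)
    then obtain l where "l \<in> ?D" "comm ?N (pr h0) (pr u) = l \<otimes>\<^bsub>?N\<^esub> l"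
      using R.comm_square[of "pr h0" "pr u"] u by auto
    then obtain l' where l': "l' \<in> gamma2 G" "comm ?N (pr h0) (pr u) = pr l' \<otimes>\<^bsub>?N\<^esub> pr l'"
      using D_ex by blast
    have "pr (comm G h0 u \<otimes> inv (l' \<otimes> l')) = \<one>\<^bsub>?N\<^esub>"
      using l' u by (simp add: pr.hom_comm)
    then have "comm G h0 u \<otimes> inv (l' \<otimes> l') \<in> gamma3 G"
      using l'(1) u(1) by (subst (asm) pr_eq_one_iff) auto
    then show ?thesis using l'(1) by blast
  qed
  \<comment> \<open>This choice will put \<open>h\<close>, the element inducing the square of
    \<open>\<tau>\<close>, into \<open>gamma2 G\<close>.\<close>
  obtain k where k [simp]: "k \<in> carrier G" and ek: "\<And>e. e \<in> E \<Longrightarrow> e h0 + 2 * e k = 0"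
    using even[OF h0 sq sq] R.fffx R.fffy by auto
  \<comment> \<open>\<open>\<phi>\<close> commutes with its sixth power, so by surjectivity
    \<open>h0\<close> and \<open>\<phi> h0\<close> induce the same conjugation. They differ by a
    central element, whose class is trivial.\<close>
  have e\<phi>h0: "e (\<phi> h0) = e h0" if "e \<in> E" for e
  proof -
    interpret e: group_hom G intg e by (rule e_hom[OF that])
    have "e (inv h0 \<otimes> \<phi> h0) = 0"
    proof (rule central[OF _ _ that])
      fix g assume "g \<in> carrier G"
      then obtain g' where g': "g' \<in> carrier G" "g = \<phi> g'" using surj by auto
      have "\<phi> h0 \<otimes> g \<otimes> inv (\<phi> h0) = h0 \<otimes> g \<otimes> inv h0"
        using arg_cong[OF pow6[OF g'(1)], of \<phi>] pow6[of "\<phi> g'"] g' by simp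
      then have "\<phi> h0 \<otimes> g = h0 \<otimes> g \<otimes> inv h0 \<otimes> \<phi> h0"
        using \<open>g \<in> carrier G\<close> inv_solve_right'[of "h0 \<otimes> g \<otimes> inv h0" "\<phi> h0 \<otimes> g" "\<phi> h0"] by simp
      then show "inv h0 \<otimes> \<phi> h0 \<otimes> g = g \<otimes> (inv h0 \<otimes> \<phi> h0)"
        using \<open>g \<in> carrier G\<close> by (simp add: m_assoc)
    qed simp
    then show ?thesis by simp
  qed
  \<comment> \<open>Twice the class of \<open>k\<close> is minus the \<open>\<phi>\<close>-invariant
    class of \<open>h0\<close>, and the coordinates are integers.\<close>
  have e\<phi>k: "e (\<phi> k) = e k" if "e \<in> E" for e
  proof -
    interpret e: group_hom G intg e by (rule e_hom[OF that])
    have "h0 \<otimes> (k \<otimes> k) \<in> gamma2 G"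
    proof (rule gamma2I)
      fix e assume "e \<in> E"
      interpret e: group_hom G intg e by (rule e_hom[OF \<open>e \<in> E\<close>])
      show "e (h0 \<otimes> (k \<otimes> k)) = 0" using ek[OF \<open>e \<in> E\<close>] by simp
    qed simp
    then have "e (\<phi> (h0 \<otimes> (k \<otimes> k))) = 0" by (intro intg_gamma2[OF e.homh] gamma2_endo[OF \<phi>])
    then show ?thesis using ek[OF that] e\<phi>h0[OF that] by simp
  qed
  have \<phi>k: "inv k \<otimes> \<phi> k \<in> gamma2 G"
  proof (rule gamma2I)
    fix e assume "e \<in> E"
    interpret e: group_hom G intg e by (rule e_hom[OF \<open>e \<in> E\<close>])
    show "e (inv k \<otimes> \<phi> k) = 0" using e\<phi>k[OF \<open>e \<in> E\<close>] by simp
  qed simp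
  define h where "h = k \<otimes> \<phi> (\<phi> (\<phi> k)) \<otimes> h0"
  have h [simp]: "h \<in> gamma2 G"
  proof (rule gamma2I)
    fix e assume e: "e \<in> E"
    interpret e: group_hom G intg e by (rule e_hom[OF e])
    have "e (\<phi> (inv k \<otimes> \<phi> k)) = 0" "e (\<phi> (\<phi> (inv k \<otimes> \<phi> k))) = 0"
      by (intro intg_gamma2[OF e.homh] gamma2_endo[OF \<phi>] \<phi>k)+
    then show "e h = 0" using ek[OF e] e\<phi>k[OF e] by (simp add: h_def)
  qed (simp add: h_def)
  define \<tau> where "\<tau> g = k \<otimes> \<phi> (\<phi> (\<phi> g)) \<otimes> inv k" for g
  have \<tau>: "\<tau> \<in> hom G G" by (rule homI) (auto simp: \<tau>_def m_assoc)
  interpret \<tau>: group_hom G G \<tau> using \<tau> by (simp add: group_homI is_group)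
  have \<tau>\<tau>: "\<tau> (\<tau> g) = h \<otimes> g \<otimes> inv h" if "g \<in> carrier G" for g
    using that by (simp add: \<tau>_def h_def pow6 m_assoc inv_mult_group)
  define \<tau>' where "\<tau>' a = pr k \<otimes>\<^bsub>?N\<^esub> f (f (f a)) \<otimes>\<^bsub>?N\<^esub> inv\<^bsub>?N\<^esub> pr k" for a
  have \<tau>'_pr: "\<tau>' (pr g) = pr (\<tau> g)" if "g \<in> carrier G" for g
    using that by (simp add: \<tau>'_def \<tau>_def f_pr)
  have ctx: "pr k \<in> carrier ?N" "N.cg (f (pr k)) (pr k)"
    "\<And>a. a \<in> carrier ?N \<Longrightarrow> \<tau>' a = pr k \<otimes>\<^bsub>?N\<^esub> f (f (f a)) \<otimes>\<^bsub>?N\<^esub> inv\<^bsub>?N\<^esub> pr k"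
    "\<And>a. a \<in> carrier ?N \<Longrightarrow> \<tau>' (\<tau>' a) = a"
  proof -
    show "N.cg (f (pr k)) (pr k)" using \<phi>k by (simp add: f_pr cgI)
    fix a assume "a \<in> carrier ?N"
    then obtain g where g: "g \<in> carrier G" "a = pr g" using pr_surj by auto
    have "pr g \<otimes>\<^bsub>?N\<^esub> pr h = pr h \<otimes>\<^bsub>?N\<^esub> pr g"
      using g D_iff[of h] by (intro N.D_central) auto
    then have "pr h \<otimes>\<^bsub>?N\<^esub> pr g \<otimes>\<^bsub>?N\<^esub> inv\<^bsub>?N\<^esub> pr h = pr g \<otimes>\<^bsub>?N\<^esub> pr h \<otimes>\<^bsub>?N\<^esub> inv\<^bsub>?N\<^esub> pr h" by simp
    also have "\<dots> = pr g" using g by (simp add: pr.H.m_assoc)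
    finally have "pr h \<otimes>\<^bsub>?N\<^esub> pr g \<otimes>\<^bsub>?N\<^esub> inv\<^bsub>?N\<^esub> pr h = pr g" .
    then show "\<tau>' (\<tau>' a) = a" using g by (simp add: \<tau>'_pr \<tau>\<tau>)
  qed (auto simp: \<tau>'_def)
  define q where "q = x \<otimes> \<tau> x"
  have q [simp]: "q \<in> gamma2 G" using R.q_in_D[OF ctx] D_iff[of q] by (simp add: q_def \<tau>'_pr)
  obtain c3 where c3: "c3 \<in> gamma3 G" "\<phi> q = q \<otimes> c3"
  proof -
    have "pr (\<phi> q) = pr q" using R.f_q[OF ctx] by (simp add: q_def \<tau>'_pr flip: f_pr)
    then show ?thesis using pr_eqE[of "\<phi> q" q] that by auto
  qed
  obtain l c where lc: "l \<in> gamma2 G" "c \<in> gamma3 G" "q = comm G (\<phi> x) x \<otimes> (l \<otimes> l) \<otimes> c"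
  proof -
    obtain l where "l \<in> ?D" "pr x \<otimes>\<^bsub>?N\<^esub> \<tau>' (pr x) = comm ?N (f (pr x)) (pr x) \<otimes>\<^bsub>?N\<^esub> (l \<otimes>\<^bsub>?N\<^esub> l)"
      using R.q_eq[OF ctx] by blast
    then obtain l' where l': "l' \<in> gamma2 G" "pr q = comm ?N (f (pr x)) (pr x) \<otimes>\<^bsub>?N\<^esub> (pr l' \<otimes>\<^bsub>?N\<^esub> pr l')"
      using D_ex by (auto simp: q_def \<tau>'_pr)
    then have "pr q = pr (comm G (\<phi> x) x \<otimes> (l' \<otimes> l'))" by (simp add: pr.hom_comm f_pr)
    then show ?thesis using pr_eqE[of q "comm G (\<phi> x) x \<otimes> (l' \<otimes> l')"] that l' by auto
  qed
  obtain d w where dw: "d \<in> gamma2 G" "w \<in> gamma3 G" "\<tau> (z \<otimes> d) = z \<otimes> d \<otimes> w"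
  proof -
    obtain d where "d \<in> ?D" "\<tau>' (pr z \<otimes>\<^bsub>?N\<^esub> d) = pr z \<otimes>\<^bsub>?N\<^esub> d"
      using R.fixed_lift[OF ctx, of "pr z"] z by blast
    then obtain d' where d': "d' \<in> gamma2 G" "\<tau>' (pr z \<otimes>\<^bsub>?N\<^esub> pr d') = pr z \<otimes>\<^bsub>?N\<^esub> pr d'"
      using D_ex by blast
    have "pr (\<tau> (z \<otimes> d')) = pr (z \<otimes> d')"
      using d' \<tau>'_pr[of "z \<otimes> d'"] by (simp del: \<tau>.hom_mult)
    then show ?thesis using pr_eqE[of "\<tau> (z \<otimes> d')" "z \<otimes> d'"] that d' by auto
  qed
  \<comment> \<open>Up to \<open>gamma2 G\<close>, which \<open>\<Theta>\<close> sends to even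
    translations, \<open>\<tau>\<close> inverts \<open>x\<close> and \<open>y\<close> and fixes
    \<open>Z\<close>; both are invisible modulo 2.\<close>
  have mod2: "snd (\<Theta> (\<tau> t)) = snd (\<Theta> t) \<and> Parity.even (fst (\<Theta> (\<tau> t)) - fst (\<Theta> t))" if "t \<in> carrier G" for t
  proof -
    define P where "P t \<longleftrightarrow> snd (\<Theta> (\<tau> t)) = snd (\<Theta> t) \<and> Parity.even (fst (\<Theta> (\<tau> t)) - fst (\<Theta> t))" for t
    have P_inv: "P u" if u: "u \<in> carrier G" "u \<otimes> \<tau> u \<in> gamma2 G" for u
    proof -
      obtain a where "\<Theta> (u \<otimes> \<tau> u) = (2 * a, False)" using dinf_gamma2[OF \<Theta>(1) u(2)] by blast
      then show ?thesis using u(1) by (cases "\<Theta> u"; cases "\<Theta> (\<tau> u)") (auto simp: P_def split: if_splits, presburger+)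
    qed
    have P_fix: "P u" if u: "u \<in> carrier G" "inv u \<otimes> \<tau> u \<in> gamma2 G" for u
    proof -
      obtain a where "\<Theta> (inv u \<otimes> \<tau> u) = (2 * a, False)" using dinf_gamma2[OF \<Theta>(1) u(2)] by blast
      then show ?thesis using u(1) by (cases "\<Theta> u"; cases "\<Theta> (\<tau> u)") (auto simp: P_def split: if_splits, presburger+)
    qed
    have \<tau>_cg: "N.cg (pr (\<tau> u)) (f (f (f (pr u))))" if "u \<in> carrier G" for u
      using that N.cg_conj[of "f (f (f (pr u)))" "pr k"] by (simp add: f_pr \<tau>_def)
    have "P s" if s: "s \<in> insert x (insert y Z)" for s
    proof -
      consider "s = x" | "s = y" | "s \<in> Z" using s by auto
      then show ?thesis
      proof cases
        case 1
        then show ?thesis using P_inv[of x] q by (simp add: q_def)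
      next
        case 2
        have "N.cg (pr (\<tau> y)) (pr (inv y))" using N.cg_trans[OF \<tau>_cg[of y] R.fffy] by simp
        then have "inv (inv y) \<otimes> \<tau> y \<in> gamma2 G" by (intro cgD) auto
        then show ?thesis using P_inv[of y] 2 by simp
      next
        case 3
        then have s: "s \<in> carrier G" using Z by auto
        have "N.cg (f (pr s)) (pr s)" using R.fz 3 by blast
        then have "N.cg (f (f (f (pr s)))) (pr s)" using N.cg_hom[OF f] N.cg_trans by blast
        then have "N.cg (pr (\<tau> s)) (pr s)" using N.cg_trans[OF \<tau>_cg[OF s]] by blast
        then have "inv s \<otimes> \<tau> s \<in> gamma2 G" using s by (intro cgD) auto
        then show ?thesis using P_fix s by blast
      qed
    qed
    note P_gen = this
    have S: "insert x (insert y Z) \<subseteq> carrier G" using Z by auto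
    have "t \<in> generate G (insert x (insert y Z))" using that gen by simp
    then have "P t"
    proof (induction rule: generate.induct)
      case one
      then show ?case by (simp add: P_def)
    next
      case (incl u)
      then show ?case by (rule P_gen)
    next
      case (inv u)
      then have "u \<in> carrier G" "P u" using S P_gen by auto
      then show ?case by (cases "\<Theta> u"; cases "\<Theta> (\<tau> u)") (auto simp: P_def)
    next
      case (eng u v)
      then have "u \<in> carrier G" "v \<in> carrier G" using gen by auto
      then show ?case using eng.IH
        by (cases "\<Theta> u"; cases "\<Theta> (\<tau> u)"; cases "\<Theta> v"; cases "\<Theta> (\<tau> v)") (auto simp: P_def)
    qed
    then show ?thesis by (simp add: P_def)
  qed
  obtain b where b: "\<Theta> h = (2 * b, False)" using dinf_gamma2[OF \<Theta>(1) h] by blast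
  \<comment> \<open>The lift \<open>z \<otimes> d\<close> is fixed by \<open>\<tau>\<close> up to
    \<open>w\<close> in \<open>gamma3 G\<close>. Conjugation by \<open>h\<close> moves its image, a
    reflection, by \<open>4 * b\<close>, whereas \<open>w \<otimes> \<tau> w\<close> moves it by a
    multiple of 8.\<close>
  have "Parity.even b"
  proof -
    obtain p where p: "\<Theta> (z \<otimes> d) = (p, True)"
      using dinf_gamma2[OF \<Theta>(1) dw(1)] dw(1) \<Theta>(4) by auto
    obtain r where r: "\<Theta> w = (4 * r, False)" using dinf_gamma3[OF \<Theta>(1) dw(2)] by blast
    obtain r' where r': "\<Theta> (\<tau> w) = (4 * r', False)" using dinf_gamma3[OF \<Theta>(1) gamma3_endo[OF \<tau> dw(2)]] by blast
    have "8 dvd 4 * r' - 4 * r" using dinf_gamma3_cong[OF \<Theta>(1) \<tau> mod2 dw(2)] r r' by simp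
    moreover have "h \<otimes> (z \<otimes> d) \<otimes> inv h = z \<otimes> d \<otimes> w \<otimes> \<tau> w"
      using \<tau>\<tau>[of "z \<otimes> d"] dw by (metis \<tau>.hom_mult gamma2_closed gamma3_closed m_closed zc)
    then have "\<Theta> (h \<otimes> (z \<otimes> d) \<otimes> inv h) = \<Theta> (z \<otimes> d \<otimes> w \<otimes> \<tau> w)" by simp
    then have "\<Theta> h \<otimes>\<^bsub>dinf\<^esub> \<Theta> (z \<otimes> d) \<otimes>\<^bsub>dinf\<^esub> inv\<^bsub>dinf\<^esub> \<Theta> h = \<Theta> (z \<otimes> d) \<otimes>\<^bsub>dinf\<^esub> \<Theta> w \<otimes>\<^bsub>dinf\<^esub> \<Theta> (\<tau> w)"
      using dw by (simp del: dinf_simps inv_dinf)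
    then have "4 * b = - 4 * r - 4 * r'" using b p r r' by simp
    ultimately show ?thesis by presburger
  qed
  moreover have "odd b"
  proof -
    obtain a where a: "\<Theta> q = (2 * a, False)" using dinf_gamma2[OF \<Theta>(1) q] by blast
    obtain a' where a': "\<Theta> (\<tau> q) = (2 * a', False)" using dinf_gamma2[OF \<Theta>(1) gamma2_endo[OF \<tau> q]] by blast
    \<comment> \<open>Both sides are \<open>u \<otimes> \<tau> u \<otimes> \<tau> (\<tau> u)
      \<otimes> inv u\<close>. For \<open>u = x\<close> this relates \<open>\<tau> q\<close> to
      \<open>q\<close> and to the commutator of \<open>h\<close> with \<open>x\<close>.\<close>
    have id: "u \<otimes> \<tau> (u \<otimes> \<tau> u) \<otimes> inv u = u \<otimes> \<tau> u \<otimes> (h \<otimes> u \<otimes> inv h \<otimes> inv u)" if "u \<in> carrier G" for u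
      using that by (simp add: \<tau>\<tau> m_assoc)
    have "\<Theta> (x \<otimes> \<tau> q \<otimes> inv x) = \<Theta> (q \<otimes> (h \<otimes> x \<otimes> inv h \<otimes> inv x))" using id[of x] by (simp only: q_def x)
    then have "\<Theta> x \<otimes>\<^bsub>dinf\<^esub> \<Theta> (\<tau> q) \<otimes>\<^bsub>dinf\<^esub> inv\<^bsub>dinf\<^esub> \<Theta> x =
        \<Theta> q \<otimes>\<^bsub>dinf\<^esub> (\<Theta> h \<otimes>\<^bsub>dinf\<^esub> \<Theta> x \<otimes>\<^bsub>dinf\<^esub> inv\<^bsub>dinf\<^esub> \<Theta> h \<otimes>\<^bsub>dinf\<^esub> inv\<^bsub>dinf\<^esub> \<Theta> x)"
      by (simp del: dinf_simps inv_dinf)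
    then have eq1: "a' = - a - 2 * b" using a a' b \<Theta>(2) by simp
    obtain v where v: "\<Theta> (\<phi> x) = (1 + 2 * v, False)"
    proof -
      obtain v where "\<Theta> (inv y \<otimes> \<phi> x) = (2 * v, False)" using dinf_gamma2[OF \<Theta>(1) \<phi>x] by blast
      then have "\<Theta> (\<phi> x) = (1 + 2 * v, False)" using \<Theta>(3) by (cases "\<Theta> (\<phi> x)") auto
      then show ?thesis by (rule that)
    qed
    \<comment> \<open>The same identity transported by \<open>\<phi>\<close>: now
      \<open>\<phi> x\<close> goes to a translation, so both the conjugation and the commutator with
      \<open>\<phi> h\<close> disappear.\<close>
    have "\<Theta> (\<phi> (x \<otimes> \<tau> q \<otimes> inv x)) = \<Theta> (\<phi> (q \<otimes> (h \<otimes> x \<otimes> inv h \<otimes> inv x)))" using id[of x] by (simp only: q_def x)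
    then have "\<Theta> (\<phi> x) \<otimes>\<^bsub>dinf\<^esub> \<Theta> (\<phi> (\<tau> q)) \<otimes>\<^bsub>dinf\<^esub> inv\<^bsub>dinf\<^esub> \<Theta> (\<phi> x) =
        \<Theta> (\<phi> q) \<otimes>\<^bsub>dinf\<^esub> (\<Theta> (\<phi> h) \<otimes>\<^bsub>dinf\<^esub> \<Theta> (\<phi> x) \<otimes>\<^bsub>dinf\<^esub> inv\<^bsub>dinf\<^esub> \<Theta> (\<phi> h) \<otimes>\<^bsub>dinf\<^esub> inv\<^bsub>dinf\<^esub> \<Theta> (\<phi> x))"
      by (simp del: dinf_simps inv_dinf)
    moreover obtain s1 s2 s3 where "\<Theta> (\<phi> (\<tau> q)) = (2 * s1, False)" "\<Theta> (\<phi> q) = (2 * s2, False)" "\<Theta> (\<phi> h) = (2 * s3, False)"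
      using dinf_gamma2[OF \<Theta>(1)] gamma2_endo[OF \<phi>] gamma2_endo[OF \<tau> q] q h by meson
    ultimately have eq2: "\<Theta> (\<phi> (\<tau> q)) = \<Theta> (\<phi> q)" using v by simp
    \<comment> \<open>\<open>\<phi>\<close> and \<open>\<tau>\<close> commute up to conjugation by
      an element of \<open>gamma2 G\<close>. Under \<open>\<Theta>\<close> this is a conjugation of
      a translation by a translation, hence trivial.\<close>
    have "\<phi> (\<tau> q) = (\<phi> k \<otimes> inv k) \<otimes> \<tau> (\<phi> q) \<otimes> inv (\<phi> k \<otimes> inv k)"
      by (simp add: \<tau>_def m_assoc inv_mult_group)
    moreover have "\<phi> k \<otimes> inv k \<in> gamma2 G"
      using normal.inv_op_closed2[OF normal_gamma2 k \<phi>k] by (simp add: m_assoc)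
    then obtain s where "\<Theta> (\<phi> k \<otimes> inv k) = (2 * s, False)" using dinf_gamma2[OF \<Theta>(1)] by blast
    moreover obtain s' where "\<Theta> (\<tau> (\<phi> q)) = (2 * s', False)"
      using dinf_gamma2[OF \<Theta>(1)] gamma2_endo[OF \<phi> q] gamma2_endo[OF \<tau>] by blast
    ultimately have "\<Theta> (\<phi> (\<tau> q)) = \<Theta> (\<tau> (\<phi> q))"
      by (simp del: \<phi>.hom_mult \<tau>.hom_mult)
    then have "\<Theta> (\<tau> q) \<otimes>\<^bsub>dinf\<^esub> \<Theta> (\<tau> c3) = \<Theta> q \<otimes>\<^bsub>dinf\<^esub> \<Theta> c3"
      using eq2 c3 by (simp del: dinf_simps)
    moreover obtain r r' where r: "\<Theta> c3 = (4 * r, False)" "\<Theta> (\<tau> c3) = (4 * r', False)"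
      using dinf_gamma3[OF \<Theta>(1)] gamma3_endo[OF \<tau>] c3(1) by meson
    ultimately have "2 * a' + 4 * r' = 2 * a + 4 * r" using a a' by simp
    moreover have "8 dvd 4 * r' - 4 * r" using dinf_gamma3_cong[OF \<Theta>(1) \<tau> mod2 c3(1)] r by simp
    \<comment> \<open>The reflection gave \<open>a' = - a - 2 * b\<close>, the translation gives
      that 4 divides \<open>a' - a\<close>.\<close>
    ultimately have "Parity.even (a + b)" using eq1 by presburger
    \<comment> \<open>The commutator of \<open>\<phi> x\<close> and \<open>x\<close> is seen as
      twice an odd number; squares from \<open>gamma2 G\<close> and elements of
      \<open>gamma3 G\<close> contribute multiples of 4.\<close>
    moreover have "odd a"
    proof -
      obtain s s' where "\<Theta> l = (2 * s, False)" "\<Theta> c = (4 * s', False)"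
        using dinf_gamma2[OF \<Theta>(1) lc(1)] dinf_gamma3[OF \<Theta>(1) lc(2)] by blast
      then have "\<Theta> q = (2 * (1 + 2 * v) + 4 * s + 4 * s', False)"
        using lc v \<Theta>(2) by (simp add: \<Theta>.hom_comm)
      then have "2 * a = 2 * (1 + 2 * v) + 4 * s + 4 * s'" using a by simp
      then show ?thesis by presburger
    qed
    ultimately show ?thesis by simp
  qed
  ultimately show False by simp
qed

end

section \<open>The lower central series of free groups and surface groups\<close>

context group
begin

text \<open>Additivity is required on \<open>K\<close> alone, since the corner coordinate of a map
  to \<open>heis\<close> is additive on \<open>gamma2 G\<close> but in general not on
  \<open>G\<close>.\<close>

lemma additive_int_pow:
  assumes K: "subgroup K G" and add: "\<And>a b. a \<in> K \<Longrightarrow> b \<in> K \<Longrightarrow> p (a \<otimes> b) = p a + (p b :: int)" and s: "s \<in> K"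
  shows "p (s [^] (k::int)) = k * p s"
proof -
  have 1: "p \<one> = 0" using add[of \<one> \<one>] subgroup.one_closed[OF K] by simp
  have inv: "p (inv a) = - p a" if "a \<in> K" for a
    using add[of "inv a" a] that subgroup.m_inv_closed[OF K that] subgroup.mem_carrier[OF K that] 1 by simp
  have nat: "s [^] (n::nat) \<in> K \<and> p (s [^] n) = int n * p s" for n
    using s K by (induction n) (auto simp: 1 add subgroup.one_closed subgroup.m_closed algebra_simps)
  show ?thesis
  proof (cases "k \<ge> 0")
    case True
    then have "s [^] k = s [^] nat k" unfolding int_pow_def2 by simp
    then show ?thesis using nat[of "nat k"] True by simp
  next
    case False
    then have "s [^] k = inv (s [^] nat (- k))" unfolding int_pow_def2 by simp
    then show ?thesis using nat[of "nat (- k)"] inv[of "s [^] nat (- k)"] False by simp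
  qed
qed

text \<open>\<open>K\<close> is abelian modulo \<open>M\<close>, so powers of \<open>s\<close> can
  be collected in front at the cost of commutators in \<open>M\<close>.\<close>

lemma split_generate:
  assumes K: "subgroup K G" and M: "M \<lhd> G" "M \<subseteq> K" and S: "insert s S \<subseteq> K"
    and ab: "\<And>a b. a \<in> K \<Longrightarrow> b \<in> K \<Longrightarrow> comm G a b \<in> M"
    and l: "l \<in> generate G (insert s S \<union> M)"
  shows "\<exists>a::int. \<exists>b \<in> generate G (S \<union> M). l = s [^] a \<otimes> b"
proof -
  have SM: "S \<union> M \<subseteq> carrier G" and SK: "S \<union> M \<subseteq> K" using S M(2) subgroup.subset[OF K] by auto
  have sK: "s \<in> K" and sc: "s \<in> carrier G" using S subgroup.mem_carrier[OF K] by auto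
  note sub = generate_is_subgroup[OF SM]
  note K_sub = generate_subgroup_incl[OF SK K]
  show ?thesis using l
  proof (induction rule: generate.induct)
    case one
    have "\<one> = s [^] (0::int) \<otimes> \<one>" using sc by simp
    then show ?case using generate.one by blast
  next
    case (incl h)
    show ?case
    proof (cases "h = s")
      case True
      have "h = s [^] (1::int) \<otimes> \<one>" using True sc by simp
      then show ?thesis using generate.one by blast
    next
      case False
      then have h: "h \<in> S \<union> M" using incl by auto
      then have "h = s [^] (0::int) \<otimes> h" using SM by auto
      then show ?thesis using generate.incl[OF h] by blast
    qed
  next
    case (inv h)
    show ?case
    proof (cases "h = s")
      case True
      have "inv h = s [^] (-1::int) \<otimes> \<one>" using True sc by (simp add: int_pow_neg)
      then show ?thesis using generate.one by blast
    next
      case False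
      then have h: "h \<in> S \<union> M" using inv by auto
      then have "inv h = s [^] (0::int) \<otimes> inv h" using SM by auto
      then show ?thesis using generate.inv[OF h] by blast
    qed
  next
    case (eng h1 h2)
    then obtain a b a' b' where 1: "b \<in> generate G (S \<union> M)" "h1 = s [^] (a::int) \<otimes> b"
      "b' \<in> generate G (S \<union> M)" "h2 = s [^] (a'::int) \<otimes> b'" by blast
    have bc: "b \<in> carrier G" "b' \<in> carrier G" using 1 generate_in_carrier[OF SM] by auto
    have sa: "s [^] a' \<in> K" "inv (s [^] a') \<in> K"
      using subgroup_int_pow_closed[OF K sK] subgroup.m_inv_closed[OF K] by auto
    have "comm G (inv (s [^] a')) b \<in> M" using ab[OF sa(2)] K_sub 1 by auto
    then have c: "comm G (inv (s [^] a')) b \<otimes> (b \<otimes> b') \<in> generate G (S \<union> M)"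
      using 1 by (intro generate.eng) (auto intro: generate.incl)
    have "h1 \<otimes> h2 = s [^] (a + a') \<otimes> (comm G (inv (s [^] a')) b \<otimes> (b \<otimes> b'))"
      using 1 bc sc by (simp add: comm_def m_assoc int_pow_mult)
    then show ?case using c by blast
  qed
qed

text \<open>Elimination along a triangular system: the functional of the first generator kills
  \<open>M\<close> and all later generators, so it isolates the exponent of the first one. A
  diagonal system would be too restrictive for surface groups, where the relator correlates the
  commutator coordinates.\<close>

lemma triangular_trivial:
  assumes K: "subgroup K G" and M: "M \<lhd> G" "M \<subseteq> K"
    and ab: "\<And>a b. a \<in> K \<Longrightarrow> b \<in> K \<Longrightarrow> comm G a b \<in> M"
    and "fst ` set ps \<subseteq> K" "sorted_wrt (\<lambda>(s, p) (s', p'). p s' = 0) ps"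
    and "\<And>s p. (s, p) \<in> set ps \<Longrightarrow> p s \<noteq> (0::int)"
    and "\<And>s p a b. (s, p) \<in> set ps \<Longrightarrow> a \<in> K \<Longrightarrow> b \<in> K \<Longrightarrow> p (a \<otimes> b) = p a + p b"
    and "\<And>s p a. (s, p) \<in> set ps \<Longrightarrow> a \<in> M \<Longrightarrow> p a = 0"
    and "l \<in> generate G (fst ` set ps \<union> M)" "\<And>s p. (s, p) \<in> set ps \<Longrightarrow> p l = 0"
  shows "l \<in> M"
  using assms(5-)
proof (induction ps)
  case Nil
  then show ?case using generate_subgroup_incl[OF subset_refl normal_imp_subgroup[OF M(1)]] by auto
next
  case (Cons sp ps)
  obtain s p where sp: "sp = (s, p)" by (cases sp)
  let ?S = "fst ` set ps"
  have S: "insert s ?S \<subseteq> K" using Cons.prems(1) sp by auto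
  have "l \<in> generate G (insert s ?S \<union> M)" using Cons.prems(6) sp by simp
  then obtain a b where ab: "b \<in> generate G (?S \<union> M)" "l = s [^] (a::int) \<otimes> b"
    using split_generate[OF K M S ab] by blast
  have add: "p (c \<otimes> d) = p c + p d" if "c \<in> K" "d \<in> K" for c d
    using Cons.prems(4)[of s p] sp that by simp
  have pM: "p c = 0" if "c \<in> M" for c using Cons.prems(5)[of s p] sp that by simp
  have SK: "?S \<union> M \<subseteq> K" using S M(2) by auto
  have b0: "b \<in> K \<and> p b = 0"
    using ab(1)
  proof (induction rule: generate.induct)
    case one
    then show ?case using subgroup.one_closed[OF K] pM subgroup.one_closed[OF normal_imp_subgroup[OF M(1)]] by auto
  next
    case (incl h)
    then show ?case using Cons.prems(2) sp SK pM by auto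
  next
    case (inv h)
    then have h: "h \<in> K" "p h = 0" using Cons.prems(2) sp SK pM by auto
    then have "p (inv h \<otimes> h) = p (inv h)" using add[of "inv h" h] subgroup.m_inv_closed[OF K] by simp
    moreover have "p (inv h \<otimes> h) = 0"
      using h subgroup.mem_carrier[OF K] pM subgroup.one_closed[OF normal_imp_subgroup[OF M(1)]] by simp
    ultimately show ?case using h subgroup.m_inv_closed[OF K] by simp
  next
    case (eng h1 h2)
    then show ?case using add subgroup.m_closed[OF K] by simp
  qed
  have s: "s \<in> K" using S by simp
  have "p l = a * p s"
    using ab(2) b0 add[OF subgroup_int_pow_closed[OF K s]] additive_int_pow[OF K add s] by simp
  then have "a = 0" using Cons.prems(3)[of s p] Cons.prems(7)[of s p] sp by simp
  then have "l = b" using ab(2) b0 subgroup.mem_carrier[OF K] s by simp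
  show ?case
  proof (rule Cons.IH)
    show "fst ` set ps \<subseteq> K" using S by simp
    show "sorted_wrt (\<lambda>(s, p) (s', p'). p s' = 0) ps" using Cons.prems(2) by simp
    show "l \<in> generate G (fst ` set ps \<union> M)" using ab(1) \<open>l = b\<close> by simp
    fix s' p' assume "(s', p') \<in> set ps"
    then have sp': "(s', p') \<in> set (sp # ps)" by simp
    show "p' s' \<noteq> 0" by (rule Cons.prems(3)[OF sp'])
    show "p' l = 0" by (rule Cons.prems(7)[OF sp'])
    show "p' (a \<otimes> b) = p' a + p' b" if "a \<in> K" "b \<in> K" for a b by (rule Cons.prems(4)[OF sp' that])
    show "p' a = 0" if "a \<in> M" for a by (rule Cons.prems(5)[OF sp' that])
  qed
qed

lemma sorted_wrt_distinct:
  "distinct xs \<Longrightarrow> (\<And>x y. x \<in> set xs \<Longrightarrow> y \<in> set xs \<Longrightarrow> x \<noteq> y \<Longrightarrow> R x y) \<Longrightarrow> sorted_wrt R xs"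
  by (induction xs) auto

lemma heis_gamma2:
  assumes "\<eta> \<in> hom G heis" "l \<in> gamma2 G"
  shows "\<exists>c. \<eta> l = (0, 0, c)"
proof -
  interpret \<eta>: group_hom G heis \<eta> using assms(1) group_heis by (simp add: group_homI is_group)
  show ?thesis using assms(2)
  proof (induction rule: gamma2_induct)
    case (comm a b)
    then show ?case by (cases "\<eta> a"; cases "\<eta> b") (auto simp: \<eta>.hom_comm)
  qed auto
qed

lemma heis_gamma3:
  assumes "\<eta> \<in> hom G heis" "l \<in> gamma3 G"
  shows "\<eta> l = (0, 0, 0)"
proof -
  interpret \<eta>: group_hom G heis \<eta> using assms(1) group_heis by (simp add: group_homI is_group)
  show ?thesis using assms(2)
  proof (induction rule: gamma3_induct)
    case (comm l b)
    obtain c where "\<eta> l = (0, 0, c)" using heis_gamma2[OF assms(1) comm(1)] by blast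
    then show ?case using comm by (cases "\<eta> b") (auto simp: \<eta>.hom_comm)
  qed auto
qed

text \<open>In the applications \<open>P\<close> lists pairs of generators whose commutators form a basis of
  \<open>gamma2 G\<close> modulo \<open>gamma3 G\<close>.\<close>
lemma gamma2_torsion_free:
  fixes gn :: "nat \<Rightarrow> 'a"
  assumes gen: "carrier G = generate G (gn ` {..<n})"
    and \<eta>: "\<And>ij. ij \<in> set P \<Longrightarrow> fst ij < n \<and> snd ij < n \<and> \<eta> ij \<in> hom G heis"
    and tri: "sorted_wrt (\<lambda>ij kl. snd (snd (\<eta> ij (comm G (gn (fst kl)) (gn (snd kl))))) = 0) P"
    and nz: "\<And>ij. ij \<in> set P \<Longrightarrow> snd (snd (\<eta> ij (comm G (gn (fst ij)) (gn (snd ij))))) \<noteq> 0"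
    and span: "\<And>i j. i < n \<Longrightarrow> j < n \<Longrightarrow>
      comm G (gn i) (gn j) \<in> generate G ((\<lambda>ij. comm G (gn (fst ij)) (gn (snd ij))) ` set P \<union> gamma3 G)"
    and l: "l \<in> gamma2 G" "l \<otimes> l \<in> gamma3 G"
  shows "l \<in> gamma3 G"
proof -
  have gn: "gn i \<in> carrier G" if "i < n" for i using gen generate.incl[of "gn i" "gn ` {..<n}" G] that by auto
  define c where "c ij = comm G (gn (fst ij)) (gn (snd ij))" for ij
  have c: "c ij \<in> gamma2 G" if "ij \<in> set P" for ij using \<eta>[OF that] gn by (simp add: c_def)
  let ?W = "generate G (c ` set P \<union> gamma3 G)"
  have Wsub: "c ` set P \<union> gamma3 G \<subseteq> gamma2 G" using c by auto
  have Wc: "c ` set P \<union> gamma3 G \<subseteq> carrier G" using Wsub by auto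
  have W: "subgroup ?W G" by (rule generate_is_subgroup[OF Wc])
  have W2: "?W \<subseteq> gamma2 G" by (rule generate_subgroup_incl[OF Wsub subgroup_gamma2])
  have W3: "d \<in> ?W" if "d \<in> gamma3 G" for d using generate.incl[of d "c ` set P \<union> gamma3 G" G] that by simp
  \<comment> \<open>\<open>?W\<close> lies between \<open>gamma3 G\<close> and
    \<open>gamma2 G\<close>, hence is normal; therefore commutators of generators being in it
    suffices for all commutators.\<close>
  have conj: "a \<otimes> w \<otimes> inv a \<in> ?W" if "a \<in> carrier G" "w \<in> ?W" for a w
  proof -
    have w: "w \<in> gamma2 G" using that W2 by auto
    have "a \<otimes> w \<otimes> inv a = inv (comm G w a) \<otimes> w"
      using that w by (simp add: inv_comm_eq) (simp add: comm_def m_assoc)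
    moreover have "inv (comm G w a) \<in> ?W"
      using W3[OF comm_in_gamma3[OF w that(1)]] subgroup.m_inv_closed[OF W] by blast
    ultimately show ?thesis using that(2) subgroup.m_closed[OF W] by simp
  qed
  have comm_inv1: "comm G (inv a) b \<in> ?W" if "comm G a b \<in> ?W" "a \<in> carrier G" "b \<in> carrier G" for a b
  proof -
    have "comm G (inv a) b = inv a \<otimes> inv (comm G a b) \<otimes> inv (inv a)"
      using that by (simp add: comm_def m_assoc inv_mult_group)
    then show ?thesis using conj[of "inv a" "inv (comm G a b)"] that subgroup.m_inv_closed[OF W] by simp
  qed
  have comm_mult1: "comm G (a \<otimes> a') b \<in> ?W" if "comm G a b \<in> ?W" "comm G a' b \<in> ?W" "a \<in> carrier G" "a' \<in> carrier G" "b \<in> carrier G" for a a' b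
  proof -
    have "comm G (a \<otimes> a') b = (a \<otimes> comm G a' b \<otimes> inv a) \<otimes> comm G a b"
      using that by (simp add: comm_def m_assoc inv_mult_group)
    then show ?thesis using conj[of a "comm G a' b"] that subgroup.m_closed[OF W] by simp
  qed
  have swap: "comm G a b \<in> ?W" if "comm G b a \<in> ?W" "a \<in> carrier G" "b \<in> carrier G" for a b
    using subgroup.m_inv_closed[OF W that(1)] that by (simp add: inv_comm_eq)
  have gnG: "gn ` {..<n} \<subseteq> carrier G" using gn by auto
  have left: "comm G a b \<in> ?W" if "a \<in> carrier G" "b \<in> carrier G" "\<And>i. i < n \<Longrightarrow> comm G (gn i) b \<in> ?W" for a b
  proof -
    have "a \<in> generate G (gn ` {..<n})" using that gen by simp
    then show ?thesis
    proof (induction rule: generate.induct)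
      case one
      have "comm G \<one> b = \<one>" using that by (simp add: comm_def)
      then show ?case using subgroup.one_closed[OF W] by simp
    next
      case (incl h)
      then show ?case using that by auto
    next
      case (inv h)
      then show ?case using that gn by (auto intro!: comm_inv1)
    next
      case (eng h1 h2)
      then show ?case using that gen by (intro comm_mult1) auto
    qed
  qed
  have comm_W: "comm G a b \<in> ?W" if "a \<in> carrier G" "b \<in> carrier G" for a b
  proof (rule left[OF that])
    fix i assume i: "i < n"
    have "comm G b (gn i) \<in> ?W"
      by (rule left[OF that(2) gn[OF i]]) (rule span[OF _ i, folded c_def])
    then show "comm G (gn i) b \<in> ?W" by (rule swap[OF _ gn[OF i] that(2)])
  qed
  have lW: "l \<in> ?W"
    using l(1) by (induction rule: gamma2_induct)
      (simp_all add: comm_W subgroup.one_closed[OF W] subgroup.m_closed[OF W] subgroup.m_inv_closed[OF W])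
  define ps where "ps = map (\<lambda>ij. (c ij, \<lambda>l. snd (snd (\<eta> ij l)))) P"
  have fst_ps: "fst ` set ps = c ` set P" by (auto simp: ps_def image_image)
  show ?thesis
  proof (rule triangular_trivial[OF subgroup_gamma2 normal_gamma3 gamma3_subset, of ps])
    show "comm G a b \<in> gamma3 G" if "a \<in> gamma2 G" "b \<in> gamma2 G" for a b
      using that by (intro comm_in_gamma3) auto
    show "sorted_wrt (\<lambda>(s, p) (s', p'). p s' = 0) ps"
      using tri by (simp add: ps_def sorted_wrt_map c_def)
    fix s p assume "(s, p) \<in> set ps"
    then obtain ij where ij: "ij \<in> set P" "s = c ij" "p = (\<lambda>l. snd (snd (\<eta> ij l)))" by (auto simp: ps_def)
    interpret \<eta>: group_hom G heis "\<eta> ij" using \<eta>[OF ij(1)] group_heis by (simp add: group_homI is_group)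
    show "p s \<noteq> 0" using ij nz by (simp add: c_def)
    show add: "p (a \<otimes> b) = p a + p b" if ab: "a \<in> gamma2 G" "b \<in> gamma2 G" for a b
    proof -
      obtain a' b' where "\<eta> ij a = (0, 0, a')" "\<eta> ij b = (0, 0, b')"
        using heis_gamma2[OF \<eta>.homh] ab by meson
      then show ?thesis using ij ab by simp
    qed
    show "p a = 0" if "a \<in> gamma3 G" for a using heis_gamma3[OF \<eta>.homh that] ij by simp
    \<comment> \<open>The functionals detecting \<open>gamma3 G\<close> inside
      \<open>gamma2 G\<close> have integer values, so vanishing on the square of \<open>l\<close>
      means vanishing on \<open>l\<close>.\<close>
    have "p (l \<otimes> l) = 0" using heis_gamma3[OF \<eta>.homh l(2)] ij by simp
    then show "p l = 0" using add l by simp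
  qed (use lW fst_ps Wsub in auto)
qed

lemma gamma2I_coordinates:
  fixes gn :: "nat \<Rightarrow> 'a"
  assumes gen: "carrier G = generate G (gn ` {..<n})"
    and e: "\<And>i. i < n \<Longrightarrow> e i \<in> hom G intg" "\<And>i j. i < n \<Longrightarrow> j < n \<Longrightarrow> e i (gn j) = (if j = i then 1 else 0)"
    and l: "l \<in> carrier G" "\<And>i. i < n \<Longrightarrow> e i l = 0"
  shows "l \<in> gamma2 G"
proof -
  have gn: "gn i \<in> carrier G" if "i < n" for i using gen generate.incl[of "gn i" "gn ` {..<n}" G] that by auto
  define ps where "ps = map (\<lambda>i. (gn i, e i)) [0..<n]"
  have fst_ps: "fst ` set ps = gn ` {..<n}" by (auto simp: ps_def image_image)
  show ?thesis
  proof (rule triangular_trivial[OF subgroup_self normal_gamma2, of ps])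
    show "sorted_wrt (\<lambda>(s, p) (s', p'). p s' = 0) ps"
      unfolding ps_def sorted_wrt_map by (rule sorted_wrt_distinct) (auto simp: e)
    show "l \<in> generate G (fst ` set ps \<union> gamma2 G)"
      using l(1) gen mono_generate[of "gn ` {..<n}" "fst ` set ps \<union> gamma2 G"] fst_ps by auto
    fix s p assume "(s, p) \<in> set ps"
    then obtain i where i: "i < n" "s = gn i" "p = e i" by (auto simp: ps_def)
    interpret e: group_hom G intg "e i" using e(1)[OF i(1)] group_intg by (simp add: group_homI is_group)
    show "p s \<noteq> 0" using i e(2) by simp
    show "p (a \<otimes> b) = p a + p b" if "a \<in> carrier G" "b \<in> carrier G" for a b using that i by simp
    show "p a = 0" if "a \<in> gamma2 G" for a using intg_gamma2[OF e.homh that] i by simp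
    show "p l = 0" using l(2) i by simp
  qed (use gn fst_ps in auto)
qed

lemma exists_coordinates:
  fixes gn :: "nat \<Rightarrow> 'a"
  assumes gn: "\<And>i. i < n \<Longrightarrow> gn i \<in> carrier G"
    and e: "\<And>i. i < n \<Longrightarrow> e i \<in> hom G intg" "\<And>i j. i < n \<Longrightarrow> j < n \<Longrightarrow> e i (gn j) = (if j = i then 1 else 0)"
  shows "\<exists>k\<in>carrier G. \<forall>i<n. e i k = v i"
proof -
  have "\<exists>k\<in>carrier G. \<forall>i<n. e i k = (if i < m then v i else 0)" if "m \<le> n" for m
    using that
  proof (induction m)
    case 0
    have "e i \<one> = 0" if "i < n" for i
      using hom_one[OF e(1)[OF that] is_group group_intg] by simp
    then show ?case by (intro bexI[of _ \<one>]) auto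
  next
    case (Suc m)
    then obtain k where k: "k \<in> carrier G" "\<And>i. i < n \<Longrightarrow> e i k = (if i < m then v i else 0)" by auto
    have "e i (k \<otimes> gn m [^] v m) = (if i < Suc m then v i else 0)" if i: "i < n" for i
    proof -
      interpret e: group_hom G intg "e i" using e(1)[OF i] group_intg by (simp add: group_homI is_group)
      have "e i (gn m [^] v m) = v m * e i (gn m)"
        by (rule additive_int_pow[OF subgroup_self]) (use Suc.prems gn in auto)
      then show ?thesis using i k gn Suc.prems e(2)[of i m] by (auto simp: less_Suc_eq)
    qed
    then show ?case using k gn Suc.prems by (intro bexI[of _ "k \<otimes> gn m [^] v m"]) auto
  qed
  from this[of n] show ?thesis by auto
qed

text \<open>\<open>\<eta>\<close> kills \<open>gamma3 G\<close> and gives squares from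
  \<open>gamma2 G\<close> an even corner entry, while the corner entry of a commutator is the
  determinant of the first two coordinates.\<close>

lemma heis_comm_even:
  assumes \<eta>: "\<eta> \<in> hom G heis" and "h \<in> carrier G" "u \<in> carrier G"
    and "\<exists>l\<in>gamma2 G. comm G h u \<otimes> inv (l \<otimes> l) \<in> gamma3 G"
  shows "even (fst (\<eta> h) * fst (snd (\<eta> u)) - fst (\<eta> u) * fst (snd (\<eta> h)))"
proof -
  interpret \<eta>: group_hom G heis \<eta> using assms(1) group_heis by (simp add: group_homI is_group)
  obtain l where l: "l \<in> gamma2 G" "comm G h u \<otimes> inv (l \<otimes> l) \<in> gamma3 G" using assms(4) by blast
  obtain c where c: "\<eta> l = (0, 0, c)" using heis_gamma2[OF \<eta> l(1)] by blast
  have "\<eta> (comm G h u \<otimes> inv (l \<otimes> l)) = (0, 0, 0)" by (rule heis_gamma3[OF \<eta> l(2)])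
  then have "fst (\<eta> h) * fst (snd (\<eta> u)) - fst (\<eta> u) * fst (snd (\<eta> h)) = 2 * c"
    using assms(2,3) l c by (cases "\<eta> h"; cases "\<eta> u") (simp add: \<eta>.hom_comm)
  then show ?thesis by simp
qed

end

text \<open>With coordinates dual to the generators, the element \<open>k\<close> demanded by
  \<open>no_torsion_rotation\<close> can be built from prescribed exponents, and evenness becomes
  divisibility of each coordinate.\<close>

lemma (in group) no_torsion_rotation_coordinates:
  fixes gn :: "nat \<Rightarrow> 'a"
  assumes gen: "carrier G = generate G (gn ` {..<n})"
    and e: "\<And>i. i < n \<Longrightarrow> e i \<in> hom G intg" "\<And>i j. i < n \<Longrightarrow> j < n \<Longrightarrow> e i (gn j) = (if j = i then 1 else 0)"
    and abc: "a < n" "b < n" "c < n" "a \<noteq> b" "c \<noteq> a" "c \<noteq> b"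
    and \<phi>: "\<phi> \<in> auto G"
    and \<phi>a: "\<And>i. i < n \<Longrightarrow> e i (\<phi> (gn a)) = (if i = b then 1 else 0)"
    and \<phi>b: "\<And>i. i < n \<Longrightarrow> e i (\<phi> (gn b)) = (if i = b then 1 else if i = a then - 1 else 0)"
    and \<phi>c: "\<And>i j. i < n \<Longrightarrow> j < n \<Longrightarrow> j \<noteq> a \<Longrightarrow> j \<noteq> b \<Longrightarrow> e i (\<phi> (gn j)) = (if i = j then 1 else 0)"
    and h0: "h0 \<in> carrier G" and six: "\<And>g. g \<in> carrier G \<Longrightarrow> (\<phi> ^^ 6) g = h0 \<otimes> g \<otimes> inv h0"
    and torsion_free: "\<And>l. l \<in> gamma2 G \<Longrightarrow> l \<otimes> l \<in> gamma3 G \<Longrightarrow> l \<in> gamma3 G"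
    and central: "\<And>u i. u \<in> carrier G \<Longrightarrow> (\<And>g. g \<in> carrier G \<Longrightarrow> u \<otimes> g = g \<otimes> u) \<Longrightarrow> i < n \<Longrightarrow> e i u = 0"
    and even: "\<And>h i. h \<in> carrier G \<Longrightarrow> \<exists>l\<in>gamma2 G. comm G h (gn a) \<otimes> inv (l \<otimes> l) \<in> gamma3 G \<Longrightarrow>
      \<exists>l\<in>gamma2 G. comm G h (gn b) \<otimes> inv (l \<otimes> l) \<in> gamma3 G \<Longrightarrow> i < n \<Longrightarrow> 2 dvd e i h"
    and \<Theta>: "\<Theta> \<in> hom G dinf" "\<Theta> (gn a) = (0, True)" "\<Theta> (gn b) = (1, False)" "\<Theta> (gn c) = (0, True)"
  shows False
proof -
  have gn [simp]: "gn i \<in> carrier G" if "i < n" for i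
    using gen generate.incl[of "gn i" "gn ` {..<n}" G] that by auto
  have \<phi>h: "\<phi> \<in> hom G G" and surj: "\<phi> ` carrier G = carrier G"
    using \<phi> by (auto simp: auto_def Bij_def bij_betw_def)
  interpret \<phi>: group_hom G G \<phi> using \<phi>h by (simp add: group_homI is_group)
  have e_hom: "group_hom G intg (e i)" if "i < n" for i
    using e(1)[OF that] group_intg by (auto intro!: group_homI)
  have gamma2I: "g \<in> gamma2 G" if "g \<in> carrier G" "\<And>i. i < n \<Longrightarrow> e i g = 0" for g
    by (rule gamma2I_coordinates[OF gen e that])
  have e_mult: "e i (u \<otimes> v) = e i u + e i v" if "i < n" "u \<in> carrier G" "v \<in> carrier G" for i u v
    using group_hom.hom_mult[OF e_hom[OF that(1)] that(2,3)] by simp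
  have e_inv: "e i (inv u) = - e i u" if "i < n" "u \<in> carrier G" for i u
    using group_hom.hom_inv[OF e_hom[OF that(1)] that(2)] by simp
  show False
  proof (rule no_torsion_rotation[OF \<phi>h surj gn[OF abc(1)] gn[OF abc(2)] _ _ _ _ _ _ h0 six torsion_free _ _ _ _ \<Theta>,
        where Z = "gn ` ({..<n} - {a, b})" and E = "e ` {..<n}"])
    show "gn ` ({..<n} - {a, b}) \<subseteq> carrier G" using gn by auto
    show "gn c \<in> gn ` ({..<n} - {a, b})" using abc by simp
    show "e ` {..<n} \<subseteq> hom G intg" using e(1) by auto
    show "carrier G = generate G (insert (gn a) (insert (gn b) (gn ` ({..<n} - {a, b}))))"
    proof -
      have "{..<n} = insert a (insert b ({..<n} - {a, b}))" using abc by auto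
      then have "gn ` {..<n} = insert (gn a) (insert (gn b) (gn ` ({..<n} - {a, b})))" by (metis image_insert)
      then show ?thesis using gen by simp
    qed
    show "inv gn b \<otimes> \<phi> (gn a) \<in> gamma2 G"
      by (rule gamma2I) (use abc in \<open>auto simp: e_mult e_inv e(2) \<phi>a\<close>)
    show "inv (gn b \<otimes> inv gn a) \<otimes> \<phi> (gn b) \<in> gamma2 G"
      by (rule gamma2I) (use abc in \<open>auto simp: e_mult e_inv e(2) \<phi>b\<close>)
    show "inv z \<otimes> \<phi> z \<in> gamma2 G" if "z \<in> gn ` ({..<n} - {a, b})" for z
      by (rule gamma2I) (use that in \<open>auto simp: e_mult e_inv e(2) \<phi>c\<close>)
    show "g \<in> gamma2 G" if "g \<in> carrier G" "\<And>f. f \<in> e ` {..<n} \<Longrightarrow> f g = 0" for g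
      by (rule gamma2I) (use that in auto)
    show "\<exists>k\<in>carrier G. \<forall>f\<in>e ` {..<n}. f h + 2 * f k = 0"
      if h: "h \<in> carrier G" "\<exists>l\<in>gamma2 G. comm G h (gn a) \<otimes> inv (l \<otimes> l) \<in> gamma3 G"
        "\<exists>l\<in>gamma2 G. comm G h (gn b) \<otimes> inv (l \<otimes> l) \<in> gamma3 G" for h
    proof -
      obtain k where k: "k \<in> carrier G" "\<And>i. i < n \<Longrightarrow> e i k = - (e i h div 2)"
        using exists_coordinates[OF gn e, of n "\<lambda>i. - (e i h div 2)"] by blast
      have "e i h + 2 * e i k = 0" if "i < n" for i
        using even[OF h that] k(2)[OF that] by auto
      then show ?thesis using k(1) by auto
    qed
    show "f u = 0" if "u \<in> carrier G" "\<And>g. g \<in> carrier G \<Longrightarrow> u \<otimes> g = g \<otimes> u" "f \<in> e ` {..<n}" for u f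
      using central[OF that(1,2)] that(3) by auto
  qed
qed

lemma free_no_torsion_rotation:
  assumes n: "n > 2" and \<phi>: "\<phi> \<in> auto (free_group n)"
    and \<phi>0: "\<And>i. i < n \<Longrightarrow> expsum i (\<phi> (gen 0)) = (if i = 1 then 1 else 0)"
    and \<phi>1: "\<And>i. i < n \<Longrightarrow> expsum i (\<phi> (gen 1)) = (if i = 1 then 1 else if i = 0 then - 1 else 0)"
    and \<phi>j: "\<And>i j. i < n \<Longrightarrow> j < n \<Longrightarrow> j \<noteq> 0 \<Longrightarrow> j \<noteq> 1 \<Longrightarrow> expsum i (\<phi> (gen j)) = (if i = j then 1 else 0)"
    and h: "h \<in> carrier (free_group n)"
    and six: "\<And>w. w \<in> carrier (free_group n) \<Longrightarrow> (\<phi> ^^ 6) w = h \<otimes>\<^bsub>free_group n\<^esub> w \<otimes>\<^bsub>free_group n\<^esub> inv\<^bsub>free_group n\<^esub> h"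
  shows False
proof -
  let ?F = "free_group n"
  interpret F: group "?F" by (rule group_free_group)
  \<comment> \<open>Up to sign, the corner entry of \<open>\<eta> (i, j)\<close> is the coordinate
    dual to the commutator of generators \<open>i\<close> and \<open>j\<close>.\<close>
  define \<eta> where "\<eta> ij = ev heis (\<lambda>k. (of_bool (k = fst ij), of_bool (k = snd ij), 0))" for ij :: "nat \<times> nat"
  have \<eta>: "\<eta> ij \<in> hom (?F) heis" for ij unfolding \<eta>_def by (rule group.ev_hom[OF group_heis]) simp
  have \<eta>_gen: "\<eta> ij (gen k) = (of_bool (k = fst ij), of_bool (k = snd ij), 0)" for ij k
    unfolding \<eta>_def by (rule group.ev_gen[OF group_heis]) simp
  have \<eta>_comm: "snd (snd (\<eta> ij (comm (?F) (gen k) (gen l)))) =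
      of_bool (k = fst ij) * of_bool (l = snd ij) - of_bool (l = fst ij) * of_bool (k = snd ij)"
    if "k < n" "l < n" for ij k l
  proof -
    interpret \<eta>: group_hom "?F" heis "\<eta> ij"
      using \<eta> group_heis by (simp add: F.group_homI F.is_group)
    show ?thesis using that by (simp add: \<eta>.hom_comm \<eta>_gen)
  qed
  have \<eta>_expsum: "fst (snd (\<eta> (i, t) u)) = expsum t u" if "u \<in> carrier (?F)" for i t u
    by (rule hom_eq_on_generate[OF group_free_group group_intg heis_snd_hom[OF \<eta>] expsum_hom, where S = "gen ` {..<n}"])
      (use that in \<open>auto simp: free_group_generate[symmetric] \<eta>_gen\<close>)
  define P where "P = filter (\<lambda>(i, j). i < j) (List.product [0..<n] [0..<n])"
  have P: "(i, j) \<in> set P \<longleftrightarrow> i < j \<and> j < n" for i j by (auto simp: P_def)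
  let ?C = "\<lambda>ij. comm (?F) (gen (fst ij)) (gen (snd ij))"
  have torsion_free: "l \<in> gamma3 (?F)" if l: "l \<in> gamma2 (?F)" "l \<otimes>\<^bsub>?F\<^esub> l \<in> gamma3 (?F)" for l
  proof (rule F.gamma2_torsion_free[OF free_group_generate, of P \<eta>])
    show "fst ij < n \<and> snd ij < n \<and> \<eta> ij \<in> hom (?F) heis" if "ij \<in> set P" for ij
      using that \<eta> P[of "fst ij" "snd ij"] by simp
    show "sorted_wrt (\<lambda>ij kl. snd (snd (\<eta> ij (?C kl))) = 0) P"
    proof (rule F.sorted_wrt_distinct)
      show "distinct P" by (simp add: P_def distinct_product)
      show "snd (snd (\<eta> ij (?C kl))) = 0" if "ij \<in> set P" "kl \<in> set P" "ij \<noteq> kl" for ij kl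
        using that by (cases ij rule: prod.exhaust; cases kl rule: prod.exhaust) (auto simp: P \<eta>_comm)
    qed
    show "snd (snd (\<eta> ij (?C ij))) \<noteq> 0" if "ij \<in> set P" for ij
      using that by (cases ij rule: prod.exhaust) (auto simp: P \<eta>_comm)
    show "comm (?F) (gen i) (gen j) \<in> generate (?F) (?C ` set P \<union> gamma3 (?F))"
      if ij: "i < n" "j < n" for i j
    proof -
      let ?S = "?C ` set P \<union> gamma3 (?F)"
      have lt: "comm (?F) (gen k) (gen l) \<in> ?S" if "k < l" "l < n" for k l
        using that P[of k l] by force
      consider "i < j" | "i = j" | "j < i" by linarith
      then show ?thesis
      proof cases
        case 1
        then show ?thesis using lt[of i j] ij by (intro generate.incl) auto
      next
        case 2
        then have "comm (?F) (gen i) (gen j) = \<one>\<^bsub>?F\<^esub>"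
          using ij by (simp add: comm_def F.m_assoc)
        then show ?thesis by (simp only: generate.one)
      next
        case 3
        have "comm (?F) (gen i) (gen j) = inv\<^bsub>?F\<^esub> (comm (?F) (gen j) (gen i))"
          using ij by (simp add: F.inv_comm_eq)
        then show ?thesis using generate.inv[OF lt[OF 3 ij(1)], of "?F"] by simp
      qed
    qed
  qed (use l in auto)
  obtain \<Theta> where \<Theta>: "\<Theta> \<in> hom (?F) dinf"
    "\<And>i. i < n \<Longrightarrow> \<Theta> (gen i) = (if i = 0 \<or> i = 2 then (0, True) else if i = 1 then (1, False) else (0, False))"
    using free_hom_exists[OF group_dinf, of n "\<lambda>i. if i = 0 \<or> i = 2 then (0, True) else if i = 1 then (1, False) else (0, False)"] by auto
  show False
  proof (rule F.no_torsion_rotation_coordinates[OF free_group_generate expsum_hom expsum_gen _ _ _ _ _ _ \<phi> \<phi>0 \<phi>1 \<phi>j h six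
        torsion_free _ _ \<Theta>(1)])
    show "\<Theta> (gen 0) = (0, True)" "\<Theta> (gen 1) = (1, False)" "\<Theta> (gen 2) = (0, True)" using \<Theta>(2) n by auto
    show "expsum i u = 0" if "u \<in> carrier (?F)"
      "\<And>g. g \<in> carrier (?F) \<Longrightarrow> u \<otimes>\<^bsub>?F\<^esub> g = g \<otimes>\<^bsub>?F\<^esub> u" "i < n" for u i
      using free_central_expsum[OF _ that(3,1,2)] n by simp
    fix u i assume u: "u \<in> carrier (?F)"
      and sq: "\<exists>l\<in>gamma2 (?F). comm (?F) u (gen 0) \<otimes>\<^bsub>?F\<^esub> inv\<^bsub>?F\<^esub> (l \<otimes>\<^bsub>?F\<^esub> l) \<in> gamma3 (?F)"
        "\<exists>l\<in>gamma2 (?F). comm (?F) u (gen 1) \<otimes>\<^bsub>?F\<^esub> inv\<^bsub>?F\<^esub> (l \<otimes>\<^bsub>?F\<^esub> l) \<in> gamma3 (?F)"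
      and i: "i < n"
    show "2 dvd expsum i u"
    \<comment> \<open>The commutator with \<open>gen 0\<close> sees every exponent except that of
      \<open>gen 0\<close> itself, which is read off from the commutator with
      \<open>gen 1\<close>.\<close>
    proof (cases "i = 0")
      case True
      then show ?thesis using F.heis_comm_even[OF \<eta>[of "(1, 0)"] u _ sq(2)] n u by (simp add: \<eta>_expsum \<eta>_gen)
    next
      case False
      then show ?thesis using F.heis_comm_even[OF \<eta>[of "(0, i)"] u _ sq(1)] n u by (simp add: \<eta>_expsum \<eta>_gen)
    qed
  qed (use n in auto)
qed

lemma surface_no_torsion_rotation:
  assumes g: "g \<ge> 2" and \<phi>: "\<phi> \<in> auto (surface_group g)"
    and \<phi>0: "\<And>i. i < 2*g \<Longrightarrow> sexp g i (\<phi> (sgen g 0)) = (if i = g then 1 else 0)"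
    and \<phi>1: "\<And>i. i < 2*g \<Longrightarrow> sexp g i (\<phi> (sgen g g)) = (if i = g then 1 else if i = 0 then - 1 else 0)"
    and \<phi>j: "\<And>i j. i < 2*g \<Longrightarrow> j < 2*g \<Longrightarrow> j \<noteq> 0 \<Longrightarrow> j \<noteq> g \<Longrightarrow> sexp g i (\<phi> (sgen g j)) = (if i = j then 1 else 0)"
    and h: "h \<in> carrier (surface_group g)"
    and six: "\<And>w. w \<in> carrier (surface_group g) \<Longrightarrow> (\<phi> ^^ 6) w = h \<otimes>\<^bsub>surface_group g\<^esub> w \<otimes>\<^bsub>surface_group g\<^esub> inv\<^bsub>surface_group g\<^esub> h"
  shows False
proof -
  define G where "G = surface_group g"
  interpret G: group G unfolding G_def by (rule group_surface_group)
  have gen: "carrier G = generate G (sgen g ` {..<2*g})" unfolding G_def by (rule surface_group_generate)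
  have sg [simp]: "sgen g i \<in> carrier G" if "i < 2*g" for i using that by (simp add: G_def)
  \<comment> \<open>For a dual pair \<open>(k, g + k)\<close> the plain coordinates pair to one,
    which the relator forbids. Adding handle 0 with the roles of its two generators exchanged
    contributes minus one. The handle \<open>k = 0\<close> itself cannot be treated in this way and
    is excluded by \<open>ok\<close>.\<close>
  define \<alpha> where "\<alpha> ij k = (of_bool (k = fst ij) + of_bool (snd ij = g + fst ij \<and> k = g) :: int)" for ij :: "nat \<times> nat" and k
  define \<beta> where "\<beta> ij k = (of_bool (k = snd ij) + of_bool (snd ij = g + fst ij \<and> k = 0) :: int)" for ij :: "nat \<times> nat" and k
  define ok where "ok ij \<longleftrightarrow> fst ij \<noteq> snd ij \<and> snd ij < 2*g \<and> fst ij < 2*g \<and> fst ij \<noteq> g + snd ij \<and> (snd ij = g + fst ij \<longrightarrow> fst ij \<noteq> 0)" for ij :: "nat \<times> nat"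
  have rel: "(\<Sum>k<g. \<alpha> ij k * \<beta> ij (g + k) - \<alpha> ij (g + k) * \<beta> ij k) = 0" if "ok ij" for ij
  proof (cases "snd ij = g + fst ij")
    case True
    then have 0: "0 < fst ij" "fst ij < g" using that by (auto simp: ok_def)
    have "(\<Sum>k<g. \<alpha> ij k * \<beta> ij (g + k) - \<alpha> ij (g + k) * \<beta> ij k) = (\<Sum>k<g. of_bool (k = fst ij) - of_bool (k = 0))"
      by (rule sum.cong) (use True 0 in \<open>auto simp: \<alpha>_def \<beta>_def\<close>)
    also have "\<dots> = 0" using 0 by (simp add: sum_subtractf of_bool_def sum.delta)
    finally show ?thesis .
  next
    case False
    then show ?thesis using that by (intro sum.neutral) (auto simp: \<alpha>_def \<beta>_def ok_def)
  qed
  have "\<exists>h. h \<in> hom G heis \<and> (\<forall>k<2*g. h (sgen g k) = (\<alpha> ij k, \<beta> ij k, 0))" if "ok ij" for ij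
    using surface_heis_hom_exists[OF rel[OF that]] by (auto simp: G_def)
  then obtain \<eta> where \<eta>: "\<And>ij. ok ij \<Longrightarrow> \<eta> ij \<in> hom G heis"
    and \<eta>_gen: "\<And>ij k. ok ij \<Longrightarrow> k < 2*g \<Longrightarrow> \<eta> ij (sgen g k) = (\<alpha> ij k, \<beta> ij k, 0)" by metis
  have \<eta>_comm: "snd (snd (\<eta> ij (comm G (sgen g k) (sgen g l)))) = \<alpha> ij k * \<beta> ij l - \<alpha> ij l * \<beta> ij k"
    if "ok ij" "k < 2*g" "l < 2*g" for ij k l
  proof -
    interpret \<eta>: group_hom G heis "\<eta> ij"
      using \<eta>[OF that(1)] group_heis by (simp add: G.group_homI G.is_group)
    show ?thesis using that by (simp add: \<eta>.hom_comm \<eta>_gen)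
  qed
  \<comment> \<open>Dual pairs come last: their corrected functionals also see the commutator of
    generators \<open>0\<close> and \<open>k\<close>, a pair in \<open>P1\<close>, whereas the
    functionals of \<open>P1\<close> vanish on dual pairs. The pair \<open>(0, g)\<close> is left
    out, since the relator expresses its commutator through the other dual pairs.\<close>
  define P1 where "P1 = filter (\<lambda>(i, j). i < j \<and> j \<noteq> g + i) (List.product [0..<2*g] [0..<2*g])"
  define P2 where "P2 = map (\<lambda>k. (k, g + k)) [1..<g]"
  have P1: "(i, j) \<in> set P1 \<longleftrightarrow> i < j \<and> j \<noteq> g + i \<and> j < 2*g" for i j by (auto simp: P1_def)
  have P2: "(i, j) \<in> set P2 \<longleftrightarrow> 1 \<le> i \<and> i < g \<and> j = g + i" for i j by (auto simp: P2_def)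
  have ok: "ok (i, j)" if "(i, j) \<in> set (P1 @ P2)" for i j using that by (auto simp: P1 P2 ok_def)
  let ?C = "\<lambda>ij. comm G (sgen g (fst ij)) (sgen g (snd ij))"
  have torsion_free: "l \<in> gamma3 G" if l: "l \<in> gamma2 G" "l \<otimes>\<^bsub>G\<^esub> l \<in> gamma3 G" for l
  proof (rule G.gamma2_torsion_free[OF gen, of "P1 @ P2" \<eta>])
    show "fst ij < 2*g \<and> snd ij < 2*g \<and> \<eta> ij \<in> hom G heis" if "ij \<in> set (P1 @ P2)" for ij
      using that \<eta>[of ij] ok[of "fst ij" "snd ij"] by (auto simp: ok_def)
    have "sorted_wrt (\<lambda>ij kl. snd (snd (\<eta> ij (?C kl))) = 0) P1"
    proof (rule G.sorted_wrt_distinct)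
      show "distinct P1" by (simp add: P1_def distinct_product)
      show "snd (snd (\<eta> ij (?C kl))) = 0" if "ij \<in> set P1" "kl \<in> set P1" "ij \<noteq> kl" for ij kl
        using that ok[of "fst ij" "snd ij"] by (cases ij rule: prod.exhaust; cases kl rule: prod.exhaust) (auto simp: P1 \<eta>_comm \<alpha>_def \<beta>_def)
    qed
    moreover have "sorted_wrt (\<lambda>ij kl. snd (snd (\<eta> ij (?C kl))) = 0) P2"
    proof (rule G.sorted_wrt_distinct)
      show "distinct P2" by (simp add: P2_def distinct_map inj_on_def)
      show "snd (snd (\<eta> ij (?C kl))) = 0" if "ij \<in> set P2" "kl \<in> set P2" "ij \<noteq> kl" for ij kl
        using that ok[of "fst ij" "snd ij"] by (cases ij rule: prod.exhaust; cases kl rule: prod.exhaust) (auto simp: P2 \<eta>_comm \<alpha>_def \<beta>_def)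
    qed
    moreover have "snd (snd (\<eta> ij (?C kl))) = 0" if "ij \<in> set P1" "kl \<in> set P2" for ij kl
      using that ok[of "fst ij" "snd ij"] by (cases ij rule: prod.exhaust; cases kl rule: prod.exhaust) (auto simp: P1 P2 \<eta>_comm \<alpha>_def \<beta>_def)
    ultimately show "sorted_wrt (\<lambda>ij kl. snd (snd (\<eta> ij (?C kl))) = 0) (P1 @ P2)"
      by (simp add: sorted_wrt_append)
    show "snd (snd (\<eta> ij (?C ij))) \<noteq> 0" if "ij \<in> set (P1 @ P2)" for ij
      using that ok[of "fst ij" "snd ij"] by (cases ij rule: prod.exhaust) (auto simp: P1 P2 \<eta>_comm \<alpha>_def \<beta>_def)
    let ?S = "?C ` set (P1 @ P2) \<union> gamma3 G"
    have S: "?S \<subseteq> carrier G"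
      using ok by (force simp: ok_def)
    have lt: "comm G (sgen g k) (sgen g l) \<in> ?S" if "(k, l) \<in> set (P1 @ P2)" for k l
      using that by force
    have dual: "comm G (sgen g k) (sgen g (g + k)) \<in> generate G ?S" if "1 \<le> k" "k < g" for k
      by (rule generate.incl[OF lt]) (use that P2 in auto)
    have zero: "comm G (sgen g 0) (sgen g (g + 0)) \<in> generate G ?S"
    proof -
      let ?p = "\<lambda>i. comm G (sgen g i) (sgen g (g + i))"
      have W: "subgroup (generate G ?S) G" by (rule G.generate_is_subgroup[OF S])
      have in_W: "lprod G ?p is \<in> generate G ?S" if "set is \<subseteq> {1..<g}" for "is"
        using that
      proof (induction "is")
        case Nil
        then show ?case using subgroup.one_closed[OF W] by (simp only: lprod_Nil)
      next
        case (Cons i "is")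
        have "?p i \<in> generate G ?S" by (rule dual) (use Cons.prems in auto)
        moreover have "lprod G ?p is \<in> generate G ?S" by (rule Cons.IH) (use Cons.prems in auto)
        ultimately show ?case unfolding lprod_Cons by (rule subgroup.m_closed[OF W])
      qed
      have "lprod G ?p [0..<g] = \<one>\<^bsub>G\<^esub>" unfolding G_def by (rule surface_relation)
      then have "?p 0 \<otimes>\<^bsub>G\<^esub> lprod G ?p [1..<g] = \<one>\<^bsub>G\<^esub>" using g by (simp add: upt_conv_Cons)
      moreover have "lprod G ?p [1..<g] \<in> generate G ?S" by (rule in_W) auto
      moreover have "lprod G ?p [1..<g] \<in> carrier G" by (rule G.lprod_closed) auto
      moreover have "?p 0 \<in> carrier G" using g by (intro G.comm_closed sg) auto
      ultimately have "?p 0 = inv\<^bsub>G\<^esub> lprod G ?p [1..<g]" using G.inv_equality[of "?p 0" "lprod G ?p [1..<g]"] by simp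
      then show ?thesis using subgroup.m_inv_closed[OF W] \<open>lprod G ?p [1..<g] \<in> generate G ?S\<close> by simp
    qed
    have le: "comm G (sgen g i) (sgen g j) \<in> generate G ?S" if ij: "i < j" "j < 2*g" for i j
    proof -
      consider "(i, j) \<in> set (P1 @ P2)" | "i = 0" "j = g + 0" using ij P1[of i j] P2[of i j] by fastforce
      then show ?thesis
      proof cases
        case 1
        then show ?thesis by (intro generate.incl lt)
      next
        case 2
        then show ?thesis using zero by (simp only:)
      qed
    qed
    show "comm G (sgen g i) (sgen g j) \<in> generate G ?S" if ij: "i < 2*g" "j < 2*g" for i j
    proof -
      consider "i < j" | "i = j" | "j < i" by linarith
      then show ?thesis
      proof cases
        case 1
        then show ?thesis using le ij by blast
      next
        case 2
        then have "comm G (sgen g i) (sgen g j) = \<one>\<^bsub>G\<^esub>"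
          using ij by (simp add: comm_def G.m_assoc)
        then show ?thesis by (simp only: generate.one)
      next
        case 3
        have "comm G (sgen g i) (sgen g j) = inv\<^bsub>G\<^esub> (comm G (sgen g j) (sgen g i))"
          using ij by (simp add: G.inv_comm_eq)
        then show ?thesis using G.generate_m_inv_closed[OF S le[OF 3 ij(1)]] by simp
      qed
    qed
  qed (use l in auto)
  \<comment> \<open>Handle 0 carries the rotated plane. Handle 1 repeats its values with exchanged
    roles, which cancels the commutator in the relator and makes generator \<open>g + 1\<close> the
    reflection required of \<open>z\<close>.\<close>
  define f where "f i = (if i = 0 \<or> i = g + 1 then (0, True) else if i = g \<or> i = 1 then (1, False) else (0::int, False))" for i
  have "lprod dinf (\<lambda>i. comm dinf (f i) (f (g + i))) [0..<g] = \<one>\<^bsub>dinf\<^esub>"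
  proof -
    have "[0..<g] = 0 # 1 # [2..<g]" using g by (simp add: upt_conv_Cons numeral_2_eq_2)
    moreover have "lprod dinf (\<lambda>i. comm dinf (f i) (f (g + i))) [2..<g] = \<one>\<^bsub>dinf\<^esub>"
      by (rule group.lprod_one[OF group_dinf]) (auto simp: f_def)
    ultimately show ?thesis using g by (simp add: f_def)
  qed
  then obtain \<Theta> where \<Theta>: "\<Theta> \<in> hom G dinf" "\<And>i. i < 2*g \<Longrightarrow> \<Theta> (sgen g i) = f i"
    using surface_hom_exists[OF group_dinf, of g f] unfolding G_def by auto
  have \<eta>_snd: "fst (snd (\<eta> ij u)) = sexp g (snd ij) u + of_bool (snd ij = g + fst ij) * sexp g 0 u"
    if ij: "ok ij" and u: "u \<in> carrier G" for ij u
  proof -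
    have h: "(\<lambda>u. sexp g (snd ij) u + of_bool (snd ij = g + fst ij) * sexp g 0 u) \<in> hom G intg"
      using hom_mult[OF sexp_hom, of _ g] by (intro homI) (auto simp: G_def algebra_simps)
    have gn: "sgen g ` {..<2*g} \<subseteq> carrier G" by auto
    show ?thesis
    proof (rule hom_eq_on_generate[OF G.is_group group_intg heis_snd_hom[OF \<eta>[OF ij]] h gn])
      show "fst (snd (\<eta> ij s)) = sexp g (snd ij) s + of_bool (snd ij = g + fst ij) * sexp g 0 s" if "s \<in> sgen g ` {..<2*g}" for s
        using that ij by (auto simp: \<eta>_gen sexp_sgen \<beta>_def)
      show "u \<in> generate G (sgen g ` {..<2*g})" using u by (simp only: gen)
    qed
  qed
  have \<eta>_fst: "fst (\<eta> ij u) = sexp g (fst ij) u + of_bool (snd ij = g + fst ij) * sexp g g u"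
    if ij: "ok ij" and u: "u \<in> carrier G" for ij u
  proof -
    have h: "(\<lambda>u. sexp g (fst ij) u + of_bool (snd ij = g + fst ij) * sexp g g u) \<in> hom G intg"
      using hom_mult[OF sexp_hom, of _ g] by (intro homI) (auto simp: G_def algebra_simps)
    have gn: "sgen g ` {..<2*g} \<subseteq> carrier G" by auto
    show ?thesis
    proof (rule hom_eq_on_generate[OF G.is_group group_intg heis_fst_hom[OF \<eta>[OF ij]] h gn])
      show "fst (\<eta> ij s) = sexp g (fst ij) s + of_bool (snd ij = g + fst ij) * sexp g g s" if "s \<in> sgen g ` {..<2*g}" for s
        using that ij by (auto simp: \<eta>_gen sexp_sgen \<alpha>_def)
      show "u \<in> generate G (sgen g ` {..<2*g})" using u by (simp only: gen)
    qed
  qed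
  show False
  proof (rule G.no_torsion_rotation_coordinates[OF gen _ sexp_sgen _ _ _ _ _ _ \<phi>[folded G_def] \<phi>0 \<phi>1 \<phi>j h[folded G_def] six[folded G_def]
        torsion_free _ _ \<Theta>(1)])
    show "sexp g i \<in> hom G intg" for i unfolding G_def by (rule sexp_hom)
    show "\<Theta> (sgen g 0) = (0, True)" "\<Theta> (sgen g g) = (1, False)" "\<Theta> (sgen g (g + 1)) = (0, True)"
      using \<Theta>(2) g by (auto simp: f_def)
    show "sexp g i u = 0" if "u \<in> carrier G" "\<And>v. v \<in> carrier G \<Longrightarrow> u \<otimes>\<^bsub>G\<^esub> v = v \<otimes>\<^bsub>G\<^esub> u" "i < 2*g" for u i
      by (rule surface_central_sexp[OF g that(3) that(1,2)[unfolded G_def]])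
    fix u i assume u: "u \<in> carrier G"
      and sq: "\<exists>l\<in>gamma2 G. comm G u (sgen g 0) \<otimes>\<^bsub>G\<^esub> inv\<^bsub>G\<^esub> (l \<otimes>\<^bsub>G\<^esub> l) \<in> gamma3 G"
        "\<exists>l\<in>gamma2 G. comm G u (sgen g g) \<otimes>\<^bsub>G\<^esub> inv\<^bsub>G\<^esub> (l \<otimes>\<^bsub>G\<^esub> l) \<in> gamma3 G"
      and i: "i < 2*g"
    have other: "2 dvd sexp g i u" if "i \<noteq> 0" "i \<noteq> g" "i < 2*g" for i
    proof -
      have ok: "ok (0, i)" using that by (auto simp: ok_def)
      then show ?thesis
        using G.heis_comm_even[OF \<eta>[OF ok] u _ sq(1)] g u that
        by (simp add: \<eta>_snd[OF ok] \<eta>_gen[OF ok] \<alpha>_def \<beta>_def)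
    qed
    \<comment> \<open>The coordinates \<open>0\<close> and \<open>g\<close> are not isolated by any
      available map to \<open>heis\<close> testing against generators \<open>g\<close> and
      \<open>0\<close>; the corrected one for handle 1 shows them added to coordinates
      \<open>g + 1\<close> and \<open>1\<close>, which are even already.\<close>
    define r where "r = (1::nat, g + 1)"
    have ok: "ok r" using g by (simp add: r_def ok_def)
    have r: "fst (\<eta> r u) = sexp g 1 u + sexp g g u" "fst (snd (\<eta> r u)) = sexp g (g + 1) u + sexp g 0 u"
      using \<eta>_fst[OF ok u] \<eta>_snd[OF ok u] by (simp_all add: r_def)
    have r_gen: "\<eta> r (sgen g 0) = (0, 1, 0)" "\<eta> r (sgen g g) = (1, 0, 0)"
      using \<eta>_gen[OF ok, of 0] \<eta>_gen[OF ok, of g] g by (auto simp: r_def \<alpha>_def \<beta>_def)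
    have "2 dvd sexp g 1 u + sexp g g u"
      using G.heis_comm_even[OF \<eta>[OF ok] u _ sq(1)] g by (simp add: r r_gen)
    moreover have "2 dvd sexp g (g + 1) u + sexp g 0 u"
      using G.heis_comm_even[OF \<eta>[OF ok] u _ sq(2)] g by (simp add: r r_gen)
    ultimately show "2 dvd sexp g i u"
      using other[of 1] other[of "g + 1"] other[of i] g i by (cases "i = 0"; cases "i = g") (auto simp: dvd_add_right_iff)
  qed (use g in auto)
qed

section \<open>Matrix groups\<close>

lemma mult_carrier_square [simp]:
  "A \<in> carrier_mat n n \<Longrightarrow> B \<in> carrier_mat n n \<Longrightarrow> A * B \<in> carrier_mat n n"
  by (rule mult_carrier_mat)

lemma GL_simps [simp]: "carrier (GL n) = {A. A \<in> carrier_mat n n \<and> (det A = 1 \<or> det A = -1)}"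
  "A \<otimes>\<^bsub>GL n\<^esub> B = A * B" "\<one>\<^bsub>GL n\<^esub> = 1\<^sub>m n"
  by (simp_all add: GL_def)

lemma group_GL: "group (GL n)"
proof (rule groupI)
  fix A B C assume A: "A \<in> carrier (GL n)" and B: "B \<in> carrier (GL n)" and C: "C \<in> carrier (GL n)"
  show "A \<otimes>\<^bsub>GL n\<^esub> B \<in> carrier (GL n)" using A B by (auto simp: det_mult)
  show "A \<otimes>\<^bsub>GL n\<^esub> B \<otimes>\<^bsub>GL n\<^esub> C = A \<otimes>\<^bsub>GL n\<^esub> (B \<otimes>\<^bsub>GL n\<^esub> C)" using A B C by (auto intro: assoc_mult_mat)
next
  fix A assume A: "A \<in> carrier (GL n)"
  then have A': "A \<in> carrier_mat n n" and d: "det A * det A = 1" by auto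
  show "\<one>\<^bsub>GL n\<^esub> \<otimes>\<^bsub>GL n\<^esub> A = A" using A' by simp
  \<comment> \<open>Since \<open>det A\<close> is its own inverse, this multiple of the adjugate is
    the inverse matrix over the integers.\<close>
  define B where "B = det A \<cdot>\<^sub>m adj_mat A"
  have B: "B \<in> carrier_mat n n" using adj_mat(1)[OF A'] by (simp add: B_def)
  have BA: "B * A = 1\<^sub>m n"
  proof -
    have "B * A = det A \<cdot>\<^sub>m (det A \<cdot>\<^sub>m 1\<^sub>m n)"
      using mult_smult_assoc_mat[OF adj_mat(1)[OF A'] A', of "det A"] adj_mat(3)[OF A'] by (simp add: B_def)
    also have "\<dots> = 1\<^sub>m n" using d by (intro eq_matI) auto
    finally show ?thesis .
  qed
  have "det B * det A = 1" using det_mult[OF B A'] BA by simp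
  then have "det B = 1 \<or> det B = -1" using A by auto
  then show "\<exists>B\<in>carrier (GL n). B \<otimes>\<^bsub>GL n\<^esub> A = \<one>\<^bsub>GL n\<^esub>" using B BA by auto
qed auto

section \<open>The symplectic group\<close>

lemma J_symp_carrier [simp]: "J_symp g \<in> carrier_mat (2*g) (2*g)"
  by (simp add: J_symp_def)

lemma Sp_simps [simp]: "carrier (Sp g) = {A. A \<in> carrier_mat (2*g) (2*g) \<and> transpose_mat A * J_symp g * A = J_symp g}"
  "A \<otimes>\<^bsub>Sp g\<^esub> B = A * B" "\<one>\<^bsub>Sp g\<^esub> = 1\<^sub>m (2*g)"
  by (simp_all add: Sp_def)

text \<open>Gives a nonzero determinant of \<open>J_symp g\<close>, from which a symplectic matrix
  has determinant with square one and thus an integral inverse.\<close>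

lemma J_symp_square: "J_symp g * J_symp g = - 1 \<cdot>\<^sub>m 1\<^sub>m (2*g)"
proof (rule eq_matI)
  fix i j assume "i < dim_row (- 1 \<cdot>\<^sub>m 1\<^sub>m (2*g) :: int mat)" "j < dim_col (- 1 \<cdot>\<^sub>m 1\<^sub>m (2*g) :: int mat)"
  then have ij: "i < 2*g" "j < 2*g" by auto
  define i' where "i' = (if i < g then i + g else i - g)"
  have i': "i' < 2*g" using ij by (auto simp: i'_def)
  have "(J_symp g * J_symp g) $$ (i, j) = (\<Sum>k<2*g. J_symp g $$ (i, k) * J_symp g $$ (k, j))"
    using ij by (simp add: J_symp_def scalar_prod_def atLeast0LessThan)
  also have "\<dots> = (\<Sum>k<2*g. if k = i' then J_symp g $$ (i, i') * J_symp g $$ (i', j) else 0)"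
    by (rule sum.cong) (use ij in \<open>auto simp: J_symp_def i'_def\<close>)
  also have "\<dots> = J_symp g $$ (i, i') * J_symp g $$ (i', j)" using i' by (simp add: sum.delta)
  also have "\<dots> = (- 1 \<cdot>\<^sub>m 1\<^sub>m (2*g)) $$ (i, j)"
    using ij i' by (auto simp: J_symp_def i'_def)
  finally show "(J_symp g * J_symp g) $$ (i, j) = (- 1 \<cdot>\<^sub>m 1\<^sub>m (2*g)) $$ (i, j)" .
qed (auto simp: J_symp_def)

lemma group_Sp: "group (Sp g)"
proof (rule groupI)
  let ?J = "J_symp g"
  fix A B C assume A: "A \<in> carrier (Sp g)" and B: "B \<in> carrier (Sp g)" and C: "C \<in> carrier (Sp g)"
  have A': "A \<in> carrier_mat (2*g) (2*g)" and B': "B \<in> carrier_mat (2*g) (2*g)" using A B by auto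
  have "transpose_mat (A * B) * ?J * (A * B) = transpose_mat B * (transpose_mat A * ?J * A) * B"
  proof -
    have "transpose_mat (A * B) * ?J * (A * B) = transpose_mat B * transpose_mat A * ?J * (A * B)"
      using transpose_mult[OF A' B'] by simp
    also have "\<dots> = transpose_mat B * transpose_mat A * ?J * A * B"
      using A' B' by (intro assoc_mult_mat[symmetric, of _ "2*g" "2*g" _ "2*g" _ "2*g"]) auto
    also have "transpose_mat B * transpose_mat A * ?J = transpose_mat B * (transpose_mat A * ?J)"
      using A' B' by (intro assoc_mult_mat[of _ "2*g" "2*g" _ "2*g" _ "2*g"]) auto
    also have "transpose_mat B * (transpose_mat A * ?J) * A = transpose_mat B * (transpose_mat A * ?J * A)"
      using A' B' by (intro assoc_mult_mat[of _ "2*g" "2*g" _ "2*g" _ "2*g"]) auto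
    finally show ?thesis .
  qed
  then show "A \<otimes>\<^bsub>Sp g\<^esub> B \<in> carrier (Sp g)" using A B by auto
  show "A \<otimes>\<^bsub>Sp g\<^esub> B \<otimes>\<^bsub>Sp g\<^esub> C = A \<otimes>\<^bsub>Sp g\<^esub> (B \<otimes>\<^bsub>Sp g\<^esub> C)" using A B C by (auto intro: assoc_mult_mat)
next
  let ?J = "J_symp g"
  show "\<one>\<^bsub>Sp g\<^esub> \<in> carrier (Sp g)"
    by (simp add: left_mult_one_mat[OF J_symp_carrier] right_mult_one_mat[OF J_symp_carrier])
  fix A assume A: "A \<in> carrier (Sp g)"
  then have A': "A \<in> carrier_mat (2*g) (2*g)" and AJ: "transpose_mat A * ?J * A = ?J" by auto
  then have AT: "transpose_mat A \<in> carrier_mat (2*g) (2*g)" by simp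
  show "\<one>\<^bsub>Sp g\<^esub> \<otimes>\<^bsub>Sp g\<^esub> A = A" using A' by simp
  have "det ?J * det ?J = det (- 1 \<cdot>\<^sub>m 1\<^sub>m (2*g) :: int mat)"
    using det_mult[OF J_symp_carrier J_symp_carrier, of g] J_symp_square[of g] by simp
  also have "\<dots> = 1" by (simp add: det_smult power_mult)
  finally have "det ?J \<noteq> 0" by auto
  moreover have "det A * det ?J * det A = det ?J"
    using arg_cong[OF AJ, of det] det_mult[OF mult_carrier_mat[OF AT J_symp_carrier] A'] det_mult[OF AT J_symp_carrier]
    by (simp add: det_transpose[OF A'])
  ultimately have "det A * det A = 1" by (simp add: mult.commute mult.left_commute)
  then have "A \<in> carrier (GL (2*g))" using A' by (simp add: square_eq_1_iff)
  then obtain B where B: "B \<in> carrier (GL (2*g))" "B * A = 1\<^sub>m (2*g)" "A * B = 1\<^sub>m (2*g)"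
    using group.inv_closed[OF group_GL] group.l_inv[OF group_GL] group.r_inv[OF group_GL] unfolding GL_simps(2,3) by blast
  then have B': "B \<in> carrier_mat (2*g) (2*g)" by simp
  have "transpose_mat B * ?J * B = transpose_mat B * (transpose_mat A * ?J * A) * B" using AJ by simp
  also have "\<dots> = transpose_mat B * (transpose_mat A * ?J) * A * B"
    using A' B' by (subst assoc_mult_mat[of "transpose_mat B" "2*g" "2*g" _ "2*g" _ "2*g"]) auto
  also have "\<dots> = transpose_mat B * (transpose_mat A * ?J) * (A * B)"
    using A' B' by (intro assoc_mult_mat[of _ "2*g" "2*g" _ "2*g" _ "2*g"]) auto
  also have "transpose_mat B * (transpose_mat A * ?J) = transpose_mat B * transpose_mat A * ?J"
    using A' B' by (intro assoc_mult_mat[symmetric, of _ "2*g" "2*g" _ "2*g" _ "2*g"]) auto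
  also have "transpose_mat B * transpose_mat A = 1\<^sub>m (2*g)"
    using transpose_mult[OF A' B'] B(3) by simp
  finally have "transpose_mat B * ?J * B = ?J" using B(3) J_symp_carrier[of g] by simp
  then show "\<exists>B\<in>carrier (Sp g). B \<otimes>\<^bsub>Sp g\<^esub> A = \<one>\<^bsub>Sp g\<^esub>" using B' B(2) by auto
qed

text \<open>Columns are images of basis vectors, as in \<open>abmat\<close> and \<open>hmat\<close>:
  \<open>a\<close> goes to \<open>b\<close> and \<open>b\<close> to \<open>b - a\<close>. On this
  plane it is the companion matrix of \<open>T^2 - T + 1\<close>, whose roots are the primitive
  sixth roots of unity.\<close>

definition rot :: "nat \<Rightarrow> nat \<Rightarrow> nat \<Rightarrow> int mat" where
  "rot n a b = mat n n (\<lambda>(i, j). if j = a then (if i = b then 1 else 0)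
     else if j = b then (if i = b then 1 else if i = a then - 1 else 0) else if i = j then 1 else 0)"

lemma rot_carrier [simp]: "rot n a b \<in> carrier_mat n n"
  by (simp add: rot_def)

lemma mult_rot:
  assumes M: "M \<in> carrier_mat m n" and ab: "a < n" "b < n" "a \<noteq> b" and ij: "i < m" "j < n"
  shows "(M * rot n a b) $$ (i, j) = (if j = a then M $$ (i, b) else if j = b then M $$ (i, b) - M $$ (i, a) else M $$ (i, j))"
proof -
  have "(M * rot n a b) $$ (i, j) = (\<Sum>k<n. M $$ (i, k) * rot n a b $$ (k, j))"
    using M ij by (simp add: rot_def scalar_prod_def atLeast0LessThan)
  also have "\<dots> = (\<Sum>k<n. if j = a then (if k = b then M $$ (i, k) else 0)
      else if j = b then (if k = b then M $$ (i, k) else 0) - (if k = a then M $$ (i, k) else 0)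
      else (if k = j then M $$ (i, k) else 0))"
    by (rule sum.cong) (use ij ab in \<open>auto simp: rot_def\<close>)
  also have "\<dots> = (if j = a then M $$ (i, b) else if j = b then M $$ (i, b) - M $$ (i, a) else M $$ (i, j))"
    using ij ab by (simp add: sum_subtractf sum.delta)
  finally show ?thesis .
qed

text \<open>The leading identity matrix matches the unfolding of the power in a monoid and lets
  \<open>mult_rot\<close> evaluate the product by successive column operations.\<close>

lemma rot_six:
  assumes "a < n" "b < n" "a \<noteq> b"
  shows "1\<^sub>m n * rot n a b * rot n a b * rot n a b * rot n a b * rot n a b * rot n a b = 1\<^sub>m n"
proof (rule eq_matI)
  fix i j assume "i < dim_row (1\<^sub>m n :: int mat)" "j < dim_col (1\<^sub>m n :: int mat)"
  then have ij: "i < n" "j < n" by auto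
  note mult = mult_rot[OF _ assms, of _ n]
  have cm: "M * rot n a b \<in> carrier_mat n n" if "M \<in> carrier_mat n n" for M using that by simp
  show "(1\<^sub>m n * rot n a b * rot n a b * rot n a b * rot n a b * rot n a b * rot n a b) $$ (i, j) = 1\<^sub>m n $$ (i, j)"
    using assms ij by (simp add: mult cm del: left_mult_one_mat index_mult_mat(1))
qed (auto simp: rot_def)

lemma rot_GL:
  assumes "a < n" "b < n" "a \<noteq> b"
  shows "rot n a b \<in> carrier (GL n)" "rot n a b [^]\<^bsub>GL n\<^esub> (6::nat) = \<one>\<^bsub>GL n\<^esub>"
proof -
  have "det (1\<^sub>m n * rot n a b * rot n a b * rot n a b * rot n a b * rot n a b * rot n a b) = 1"
    by (simp add: rot_six[OF assms])
  then have "det (rot n a b) * (det (rot n a b) * (det (rot n a b) * (det (rot n a b) * (det (rot n a b) * det (rot n a b))))) = 1"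
    by (simp add: det_mult[of _ n] mult.assoc)
  \<comment> \<open>Finite order makes the determinant a unit of the integers, which avoids
    expanding it.\<close>
  then have "det (rot n a b) dvd 1" by (metis dvd_triv_left)
  then show "rot n a b \<in> carrier (GL n)" by auto
  show "rot n a b [^]\<^bsub>GL n\<^esub> (6::nat) = \<one>\<^bsub>GL n\<^esub>"
    using rot_six[OF assms] by (simp add: eval_nat_numeral)
qed

text \<open>The indices \<open>0\<close> and \<open>g\<close> span a hyperbolic plane, on which
  being symplectic is the same as having determinant one.\<close>

lemma rot_Sp:
  assumes g: "g > 0"
  shows "rot (2*g) 0 g \<in> carrier (Sp g)" "rot (2*g) 0 g [^]\<^bsub>Sp g\<^esub> (6::nat) = \<one>\<^bsub>Sp g\<^esub>"
proof -
  let ?A = "rot (2*g) 0 g" and ?J = "J_symp g"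
  have ab: "0 < 2*g" "g < 2*g" "0 \<noteq> g" using g by auto
  have JT: "transpose_mat ?J \<in> carrier_mat (2*g) (2*g)" by simp
  have AJ: "(transpose_mat ?A * ?J) $$ (i, j) =
      (if i = 0 then ?J $$ (g, j) else if i = g then ?J $$ (g, j) - ?J $$ (0, j) else ?J $$ (i, j))"
    if ij: "i < 2*g" "j < 2*g" for i j
  proof -
    have "transpose_mat (transpose_mat ?J * ?A) = transpose_mat ?A * ?J"
      using transpose_mult[OF JT rot_carrier] by simp
    then have "(transpose_mat ?A * ?J) $$ (i, j) = transpose_mat (transpose_mat ?J * ?A) $$ (i, j)" by simp
    also have "\<dots> = (transpose_mat ?J * ?A) $$ (j, i)"
      using ij by (intro index_transpose_mat(1)) (auto simp: J_symp_def rot_def)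
    also have "\<dots> = (if i = 0 then transpose_mat ?J $$ (j, g) else if i = g then transpose_mat ?J $$ (j, g) - transpose_mat ?J $$ (j, 0) else transpose_mat ?J $$ (j, i))"
      by (rule mult_rot[OF JT ab ij(2,1)])
    finally show ?thesis using ij ab by (simp add: J_symp_def)
  qed
  have "transpose_mat ?A * ?J * ?A = ?J"
  proof (rule eq_matI)
    fix i j assume "i < dim_row ?J" "j < dim_col ?J"
    then have ij: "i < 2*g" "j < 2*g" by (auto simp: J_symp_def)
    have M: "transpose_mat ?A * ?J \<in> carrier_mat (2*g) (2*g)" by simp
    have "(transpose_mat ?A * ?J * ?A) $$ (i, j) = (if j = 0 then (transpose_mat ?A * ?J) $$ (i, g)
        else if j = g then (transpose_mat ?A * ?J) $$ (i, g) - (transpose_mat ?A * ?J) $$ (i, 0) else (transpose_mat ?A * ?J) $$ (i, j))"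
      by (rule mult_rot[OF M ab ij])
    also have "\<dots> = ?J $$ (i, j)" using ij ab by (auto simp: AJ) (auto simp: J_symp_def)
    finally show "(transpose_mat ?A * ?J * ?A) $$ (i, j) = ?J $$ (i, j)" .
  qed (auto simp: J_symp_def rot_def)
  then show "?A \<in> carrier (Sp g)" by simp
  show "?A [^]\<^bsub>Sp g\<^esub> (6::nat) = \<one>\<^bsub>Sp g\<^esub>"
    using rot_six[OF ab] by (simp add: eval_nat_numeral)
qed

section \<open>From outer automorphisms to matrices\<close>

lemma beta_not_lifting:
  assumes n: "n > 2"
  shows "\<exists>C. fin_cyclic_subgroup (GL n) C \<and> \<not> lifts (Out (free_group n)) (beta n) C"
proof (intro exI conjI notI)
  interpret F: group "free_group n" by (rule group_free_group)
  have ab: "0 < n" "1 < n" "0 \<noteq> (1::nat)" using n by auto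
  note A = group_GL rot_GL[OF ab]
  show "fin_cyclic_subgroup (GL n) (generate (GL n) {rot n 0 1})"
    by (rule fin_cyclic_subgroup_generate[OF A]) simp
  assume "lifts (Out (free_group n)) (beta n) (generate (GL n) {rot n 0 1})"
  \<comment> \<open>\<open>lifts_generate_obtains\<close> expects an explicit carrier because of
    \<open>Out_plus\<close>; here it is the whole group.\<close>
  then have "lifts ((Out (free_group n))\<lparr>carrier := carrier (Out (free_group n))\<rparr>) (beta n) (generate (GL n) {rot n 0 1})"
    by simp
  then obtain c where c: "c \<in> carrier (Out (free_group n))" "beta n c = rot n 0 1"
    "c [^]\<^bsub>Out (free_group n)\<^esub> (6::nat) = \<one>\<^bsub>Out (free_group n)\<^esub>"
    using lifts_generate_obtains[OF A _ F.group_Out subset_refl] by (metis zero_less_numeral)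
  define \<phi> where "\<phi> = (SOME \<phi>. \<phi> \<in> c)"
  have \<phi>: "\<phi> \<in> auto (free_group n)" unfolding \<phi>_def by (rule F.Out_torsion(1)[OF c(1,3)])
  obtain h where h: "h \<in> carrier (free_group n)"
    "\<And>w. w \<in> carrier (free_group n) \<Longrightarrow> (\<phi> ^^ 6) w = h \<otimes>\<^bsub>free_group n\<^esub> w \<otimes>\<^bsub>free_group n\<^esub> inv\<^bsub>free_group n\<^esub> h"
    using F.Out_torsion(2)[OF c(1,3)] unfolding \<phi>_def by blast
  have "abmat n \<phi> = rot n 0 1" using c(2) by (simp only: beta_def \<phi>_def)
  moreover have "expsum i (\<phi> (gen j)) = abmat n \<phi> $$ (i, j)" if "i < n" "j < n" for i j
    using that by (simp add: abmat_def)
  ultimately have "expsum i (\<phi> (gen j)) = rot n 0 1 $$ (i, j)" if "i < n" "j < n" for i j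
    using that by metis
  then show False
    using n by (intro free_no_torsion_rotation[OF n \<phi> _ _ _ h]) (auto simp: rot_def)
qed

lemma delta_not_lifting:
  assumes g: "g \<ge> 2"
  shows "\<exists>C. fin_cyclic_subgroup (Sp g) C \<and> \<not> lifts (Out_plus g) (delta g) C"
proof (intro exI conjI notI)
  interpret S: group "surface_group g" by (rule group_surface_group)
  have g0: "g > 0" using g by auto
  note A = group_Sp rot_Sp[OF g0]
  show "fin_cyclic_subgroup (Sp g) (generate (Sp g) {rot (2*g) 0 g})"
    by (rule fin_cyclic_subgroup_generate[OF A]) simp
  assume "lifts (Out_plus g) (delta g) (generate (Sp g) {rot (2*g) 0 g})"
  then obtain c where c: "c \<in> carrier (Out (surface_group g))" "delta g c = rot (2*g) 0 g"
    "c [^]\<^bsub>Out (surface_group g)\<^esub> (6::nat) = \<one>\<^bsub>Out (surface_group g)\<^esub>"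
    unfolding Out_plus_def
    by (rule lifts_generate_obtains[OF A _ S.group_Out, rotated 2]) auto
  define \<phi> where "\<phi> = (SOME \<phi>. \<phi> \<in> c)"
  have \<phi>: "\<phi> \<in> auto (surface_group g)" unfolding \<phi>_def by (rule S.Out_torsion(1)[OF c(1,3)])
  obtain h where h: "h \<in> carrier (surface_group g)"
    "\<And>w. w \<in> carrier (surface_group g) \<Longrightarrow> (\<phi> ^^ 6) w = h \<otimes>\<^bsub>surface_group g\<^esub> w \<otimes>\<^bsub>surface_group g\<^esub> inv\<^bsub>surface_group g\<^esub> h"
    using S.Out_torsion(2)[OF c(1,3)] unfolding \<phi>_def by blast
  have "hmat g \<phi> = rot (2*g) 0 g" using c(2) by (simp only: delta_def \<phi>_def)
  moreover have "sexp g i (\<phi> (sgen g j)) = hmat g \<phi> $$ (i, j)" if "i < 2*g" "j < 2*g" for i j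
    using that by (simp add: hmat_def sexp_def sgen_def)
  ultimately have "sexp g i (\<phi> (sgen g j)) = rot (2*g) 0 g $$ (i, j)" if "i < 2*g" "j < 2*g" for i j
    using that by metis
  then show False
    using g by (intro surface_no_torsion_rotation[OF g \<phi> _ _ _ h]) (auto simp: rot_def)
qed

theorem mainTheorem1:
  fixes n g :: nat
  assumes "n > 2" and "g \<ge> 2"
  shows "(\<exists>C. fin_cyclic_subgroup (Out (free_group n)) C
              \<and> \<not> lifts (Aut (free_group n)) (proj_out (free_group n)) C)
       \<and> (\<exists>C. fin_cyclic_subgroup (GL n) C
              \<and> \<not> lifts (Out (free_group n)) (beta n) C)
       \<and> (\<exists>C. fin_cyclic_subgroup (Out (surface_group g)) C
              \<and> \<not> lifts (Aut (surface_group g)) (proj_out (surface_group g)) C)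
       \<and> (\<exists>C. fin_cyclic_subgroup (Sp g) C
              \<and> \<not> lifts (Out_plus g) (delta g) C)"
  using proj_out_free_group_not_lifting[OF assms(1)] beta_not_lifting[OF assms(1)]
    proj_out_surface_group_not_lifting[OF assms(2)] delta_not_lifting[OF assms(2)] by blast

end
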